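(* Let $X(\mathbb{R}^n)$ be a rearrangement invariant Banach function space with upper Boyd index $\beta_X<1$. A function $f$ belongs to $W^1X(\mathbb{R}^n)$ if and only if $f\in X(\mathbb{R}^n)$ and there exists a non-negative function $g\in X(\mathbb{R}^n)$ such that the inequality $$|f(x)-f(y)|\le|x-y|\,(g(x)+g(y))$$ holds for a.e. $x,y\in\mathbb{R}^n$, i.e. for all $x,y\in\mathbb{R}^n\setminus S$ with some set $S$ of Lebesgue measure zero.
   Context: $W^1X(\mathbb{R}^n)$ is the space of functions $f\in X(\mathbb{R}^n)$ having a weak gradient $\nabla f$ with $|\nabla f|\in X(\mathbb{R}^n)$. Banach function space (in the sense of Bennett--Sharpley): $X=\{f \text{ measurable}:\rho(|f|)<\infty\}$ with norm $\|f\|_X=\rho(|f|)$, where $\rho$ maps non-negative measurable functions on $\mathbb{R}^n$ to $[0,\infty]$ and satisfies: $\rho(f)=0$ iff $f=0$ a.e.; $\rho(cf)=c\rho(f)$ for $c\ge0$; $\rho(f+g)\le\rho(f)+\rho(g)$; $0\le g\le f$ a.e. implies $\rho(g)\le\rho(f)$; $0\le f_k\nearrow f$ a.e. implies $\rho(f_k)\nearrow\rho(f)$; $\rho(\chi_E)<\infty$ if $|E|<\infty$; if $|E|<\infty$ then $\int_E f\,dx\le C_E\,\rho(f)$ with $C_E$ independent of $f$. It is rearrangement invariant if $\rho(f)=\rho(g)$ whenever $f$ and $g$ are equimeasurable. Upper Boyd index: let $\overline{X}$ be the Luxemburg representation space of $X$, i.e. the rearrangement invariant Banach function space on $(0,\infty)$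 with $\|f\|_X=\|f^*\|_{\overline{X}}$, where $f^*$ is the non-increasing rearrangement. For $t>0$ let $h_X(t)$ be the norm on $\overline{X}$ of the dilation operator $f\mapsto f(\cdot/t)$. Then $\beta_X=\lim_{t\to\infty}\frac{\log h_X(t)}{\log t}$. *)

theory Defs
  imports "HOL-Analysis.Analysis"
begin

(* A function norm acts on measurable [0,\<infinity>]-valued functions; its values outside
   borel_measurable M are unconstrained and never used. *)
definition banach_function_norm ::
  "'a measure \<Rightarrow> (('a \<Rightarrow> ennreal) \<Rightarrow> ennreal) \<Rightarrow> bool" where
  "banach_function_norm M \<rho> \<longleftrightarrow>
     (\<forall>f\<in>borel_measurable M. \<rho> f = 0 \<longleftrightarrow> (AE x in M. f x = 0)) \<and>
     (\<forall>f\<in>borel_measurable M. \<forall>c::real. 0 \<le> c \<longrightarrow> \<rho> (\<lambda>x. ennreal c * f x) = ennreal c * \<rho> f) \<and>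
     (\<forall>f\<in>borel_measurable M. \<forall>g\<in>borel_measurable M. \<rho> (\<lambda>x. f x + g x) \<le> \<rho> f + \<rho> g) \<and>
     (\<forall>f\<in>borel_measurable M. \<forall>g\<in>borel_measurable M. (AE x in M. g x \<le> f x) \<longrightarrow> \<rho> g \<le> \<rho> f) \<and>
     (\<forall>F f. (\<forall>k::nat. F k \<in> borel_measurable M) \<longrightarrow> f \<in> borel_measurable M \<longrightarrow>
        (AE x in M. incseq (\<lambda>k. F k x) \<and> (\<lambda>k. F k x) \<longlonglongrightarrow> f x) \<longrightarrow>
        incseq (\<lambda>k. \<rho> (F k)) \<and> (\<lambda>k. \<rho> (F k)) \<longlonglongrightarrow> \<rho> f) \<and>
     (\<forall>E\<in>sets M. emeasure M E < \<infinity> \<longrightarrow> \<rho> (indicator E) < \<infinity>) \<and>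
     (\<forall>E\<in>sets M. emeasure M E < \<infinity> \<longrightarrow>
        (\<exists>C::real. \<forall>f\<in>borel_measurable M. (\<integral>\<^sup>+x\<in>E. f x \<partial>M) \<le> ennreal C * \<rho> f))"

definition distribution_function :: "'a measure \<Rightarrow> ('a \<Rightarrow> ennreal) \<Rightarrow> ennreal \<Rightarrow> ennreal" where
  "distribution_function M f s = emeasure M {x \<in> space M. s < f x}"

definition equimeasurable :: "'a measure \<Rightarrow> ('a \<Rightarrow> ennreal) \<Rightarrow> ('a \<Rightarrow> ennreal) \<Rightarrow> bool" where
  "equimeasurable M f g \<longleftrightarrow> distribution_function M f = distribution_function M g"

definition rearrangement_invariant ::
  "'a measure \<Rightarrow> (('a \<Rightarrow> ennreal) \<Rightarrow> ennreal) \<Rightarrow> bool" where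
  "rearrangement_invariant M \<rho> \<longleftrightarrow>
     (\<forall>f\<in>borel_measurable M. \<forall>g\<in>borel_measurable M. equimeasurable M f g \<longrightarrow> \<rho> f = \<rho> g)"

definition decreasing_rearrangement :: "'a measure \<Rightarrow> ('a \<Rightarrow> ennreal) \<Rightarrow> real \<Rightarrow> ennreal" where
  "decreasing_rearrangement M f t = Inf {s. distribution_function M f s \<le> ennreal t}"

definition function_space ::
  "'a measure \<Rightarrow> (('a \<Rightarrow> ennreal) \<Rightarrow> ennreal) \<Rightarrow> ('a \<Rightarrow> real) set" where
  "function_space M \<rho> = {f \<in> borel_measurable M. \<rho> (\<lambda>x. ennreal \<bar>f x\<bar>) < \<infinity>}"

(* Functions on (0,\<infinity>) are represented by functions on all of real; by the lattice property
   (with a.e. taken in half_line) a function norm does not see their values on {..0}. *)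
abbreviation half_line :: "real measure" where
  "half_line \<equiv> lebesgue_on {0<..}"

definition is_luxemburg_representation ::
  "'a measure \<Rightarrow> (('a \<Rightarrow> ennreal) \<Rightarrow> ennreal) \<Rightarrow> ((real \<Rightarrow> ennreal) \<Rightarrow> ennreal) \<Rightarrow> bool" where
  "is_luxemburg_representation M \<rho> \<rho>' \<longleftrightarrow>
     banach_function_norm half_line \<rho>' \<and> rearrangement_invariant half_line \<rho>' \<and>
     (\<forall>f\<in>borel_measurable M. \<rho> f = \<rho>' (decreasing_rearrangement M f))"

(* For Lebesgue measure on a Euclidean space such a norm exists and its values on measurable
   functions are uniquely determined; SOME rather than THE is used because its values on
   non-measurable functions are not. *)
definition luxemburg_representation ::
  "'a measure \<Rightarrow> (('a \<Rightarrow> ennreal) \<Rightarrow> ennreal) \<Rightarrow> ((real \<Rightarrow> ennreal) \<Rightarrow> ennreal)" where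
  "luxemburg_representation M \<rho> = (SOME \<rho>'. is_luxemburg_representation M \<rho> \<rho>')"

(* Operator norm, as a supremum over the closed unit ball, of the dilation f \<mapsto> f(. / t). *)
definition dilation_norm :: "((real \<Rightarrow> ennreal) \<Rightarrow> ennreal) \<Rightarrow> real \<Rightarrow> ennreal" where
  "dilation_norm \<rho>' t =
     (SUP f \<in> {f \<in> function_space half_line \<rho>'. \<rho>' (\<lambda>s. ennreal \<bar>f s\<bar>) \<le> 1}.
        \<rho>' (\<lambda>s. ennreal \<bar>f (s / t)\<bar>))"

definition upper_boyd_index :: "'a measure \<Rightarrow> (('a \<Rightarrow> ennreal) \<Rightarrow> ennreal) \<Rightarrow> real" where
  "upper_boyd_index M \<rho> =
     Lim at_top (\<lambda>t. ln (enn2real (dilation_norm (luxemburg_representation M \<rho>) t)) / ln t)"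

(* C^k: for k > 0, differentiable with all first-order partial derivatives of class C^(k-1). *)
primrec times_continuously_differentiable ::
  "nat \<Rightarrow> ('a::euclidean_space \<Rightarrow> real) \<Rightarrow> bool" where
  "times_continuously_differentiable 0 \<phi> \<longleftrightarrow> continuous_on UNIV \<phi>"
| "times_continuously_differentiable (Suc k) \<phi> \<longleftrightarrow>
     (\<forall>x. \<phi> differentiable (at x)) \<and>
     (\<forall>i\<in>Basis. times_continuously_differentiable k (\<lambda>x. frechet_derivative \<phi> (at x) i))"

definition test_function :: "('a::euclidean_space \<Rightarrow> real) \<Rightarrow> bool" where
  "test_function \<phi> \<longleftrightarrow>
     (\<forall>k. times_continuously_differentiable k \<phi>) \<and> compact (closure {x. \<phi> x \<noteq> 0})"

definition locally_integrable ::
  "('a::euclidean_space \<Rightarrow> 'b::{banach, second_countable_topology}) \<Rightarrow> bool" where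
  "locally_integrable f \<longleftrightarrow>
     f \<in> borel_measurable lebesgue \<and> (\<forall>K. compact K \<longrightarrow> set_integrable lebesgue K f)"

definition weak_gradient :: "('a::euclidean_space \<Rightarrow> real) \<Rightarrow> ('a \<Rightarrow> 'a) \<Rightarrow> bool" where
  "weak_gradient f G \<longleftrightarrow>
     locally_integrable f \<and> locally_integrable G \<and>
     (\<forall>\<phi>. test_function \<phi> \<longrightarrow> (\<forall>i\<in>Basis.
        (LINT x|lebesgue. f x * frechet_derivative \<phi> (at x) i) =
        - (LINT x|lebesgue. (G x \<bullet> i) * \<phi> x)))"

definition sobolev_space ::
  "(('a::euclidean_space \<Rightarrow> ennreal) \<Rightarrow> ennreal) \<Rightarrow> ('a \<Rightarrow> real) set" where
  "sobolev_space \<rho> =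
     {f \<in> function_space lebesgue \<rho>.
        \<exists>G. weak_gradient f G \<and> (\<lambda>x. norm (G x)) \<in> function_space lebesgue \<rho>}"

end

theory Submission
  imports Defs
begin

text \<open>
  Write n for the dimension, T x for the volume of the ball of radius |x| around 0, M for the
  Hardy--Littlewood maximal operator and u* for the decreasing rearrangement of u.

  \<^bold>\<open>From the gradient to the pointwise inequality.\<close> Let G be the weak gradient of f. Averaging f
  against a smooth bump of radius t centred at x + t e, where |e| \<le> 1, gives a function of t whose
  derivative is an average of the values of G at distance at most 2 t from x, and hence is bounded by
  a constant times M|G| x. As t tends to 0 the average tends to a constant times f x at every Lebesgue
  point x. So a bump of radius r = |x - y| / 2 around the midpoint of x and y, which is reached along
  such a path from x as well as from y, has an average within C r M|G| x of c f x and within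
  C r M|G| y of c f y (\<open>pointwise_maximal_estimate\<close>). The inequality thus holds with a multiple of
  M|G| for g, off the null set where a point is not a Lebesgue point or M|G| is infinite.

  What remains is that M maps X into X, and this is where the Boyd index enters. The weak type (1,1)
  estimate and the trivial bound on bounded functions combine to
  (M u)* \<le> C \<Sum>k. N^(-k) u*(. / N^(k+1)) for every N > 1
  (\<open>rearrangement_maximal_function_le\<close>). In the norm of the representation space the k-th summand is
  at most N^(-k) h(N)^(k+1) times the norm of u, where h is the norm of the dilation, so it is enough
  to find one N > 1 with h(N) < N. If there were none, then t \<le> h(t) for all t > 1. But h(t) \<le> 2 t,
  since a function can be cut along a hyperplane through 0 into two halves, so that log h(t) / log t
  would tend to 1, and 1 would be the index (\<open>ex_dilation_norm_less\<close>). The limit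
  that defines the index is thus computed in this contradictory case only.

  The index is defined through a representation space on the half-line that is chosen by
  \<open>SOME\<close>, so a representation has to be produced. As T maps Lebesgue measure to Lebesgue measure on the
  half-line, g \<mapsto> \<rho> (g \<circ> T) is one.

  \<^bold>\<open>From the pointwise inequality to the gradient.\<close> The inequality bounds the difference quotient
  (f(x + h e) - f x) / h by g x + g(x + h e). Divide by this bound, test with \<phi> and move the
  translation from g to \<phi>: up to a vanishing error, the integral of \<phi> against the difference quotient
  is the integral of g \<phi> V h with |V h| \<le> 2, where V h is the sum of the
  normalised difference quotient and its translate. A bounded sequence has averages of its tails that converge
  almost everywhere (\<open>midpoint_hull_AE_convergent\<close>), and if w is such a limit for the V h, then g w is
  the weak derivative of f in direction e, bounded by 2 g.
\<close>

section \<open>Lebesgue measure on the half-line as a radial image\<close>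

text \<open>
  The volume of the ball of radius |x| around 0. The value 1 at the origin, instead of 0, keeps the
  range inside the half-line; a single point does not matter for the image measure.
\<close>

definition radial_volume :: "'a::euclidean_space \<Rightarrow> real" where
  "radial_volume x = (if x = 0 then 1 else unit_ball_vol DIM('a) * norm x ^ DIM('a))"

lemma radial_volume_pos: "0 < radial_volume (x::'a::euclidean_space)"
  by (simp add: radial_volume_def)

lemma radial_volume_borel [measurable]:
  "(radial_volume :: 'a::euclidean_space \<Rightarrow> real) \<in> borel_measurable borel"
  unfolding radial_volume_def[abs_def] by measurable

text \<open>
  The points with radial volume at most a form a ball of volume a, up to the origin.
\<close>

lemma distr_radial_volume_borel:
  "distr (lborel :: 'a::euclidean_space measure) borel radial_volume
     = density lborel (indicator {0<..})"
proof (rule measure_eqI_generator_eq[where E="range atMost" and \<Omega>=UNIV and A="\<lambda>i. {..real i}"])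
  show "Int_stable (range (atMost :: real \<Rightarrow> real set))"
    by (auto simp: Int_stable_def)
  show "sets (distr (lborel :: 'a measure) borel radial_volume) = sigma_sets UNIV (range (atMost :: real \<Rightarrow> real set))"
    by (simp add: borel_eq_atMost)
  show "sets (density lborel (indicator {0<..})) = sigma_sets UNIV (range (atMost :: real \<Rightarrow> real set))"
    by (simp add: borel_eq_atMost)
  have *: "emeasure (distr (lborel :: 'a measure) borel radial_volume) {..a} = ennreal a \<and>
      emeasure (density lborel (indicator {0<..})) {..a} = ennreal a" for a :: real
  proof (cases "0 < a")
    case False
    have "\<not> radial_volume x \<le> a" for x :: 'a
      using False radial_volume_pos[of x] by linarith
    then have "{x::'a. radial_volume x \<le> a} = {}" by blast
    then have "emeasure (distr (lborel :: 'a measure) borel radial_volume) {..a} = 0"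
      by (simp add: emeasure_distr vimage_def)
    moreover have "{0<..} \<inter> {..a} = {}" using False by auto
    then have "emeasure (density lborel (indicator {0<..})) {..a} = 0"
      by (subst emeasure_density) (auto simp: indicator_inter_arith[symmetric])
    ultimately show ?thesis using False by (simp add: ennreal_neg)
  next
    case True
    define v where "v = unit_ball_vol DIM('a)"
    have v: "v > 0" by (simp add: v_def)
    define r where "r = root DIM('a) (a / v)"
    have r: "r > 0" "r ^ DIM('a) = a / v" using True v by (auto simp: r_def)
    have arv: "a = v * r ^ DIM('a)" using v r by simp
    have "v * norm x ^ DIM('a) \<le> a \<longleftrightarrow> norm x \<le> r" for x :: 'a
    proof -
      have "v * norm x ^ DIM('a) \<le> a \<longleftrightarrow> norm x ^ DIM('a) \<le> r ^ DIM('a)"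
        using v r(1) arv by simp
      also have "\<dots> \<longleftrightarrow> norm x \<le> r"
        by (rule power_mono_iff) (use r(1) in auto)
      finally show ?thesis .
    qed
    then have "radial_volume x \<le> a \<longleftrightarrow> x \<in> cball 0 r" if "x \<noteq> 0" for x :: 'a
      using that by (simp only: radial_volume_def v_def[symmetric] if_False mem_cball_0)
    then have eq: "{x::'a. radial_volume x \<le> a} - {0} = cball 0 r - {0}"
      by blast
    have [measurable]: "{x::'a. radial_volume x \<le> a} \<in> sets borel" by measurable
    have "emeasure lborel {x::'a. radial_volume x \<le> a} = emeasure lborel ({x::'a. radial_volume x \<le> a} - {0})"
      by (intro emeasure_Diff_null_set[symmetric]) auto
    also have "\<dots> = emeasure lborel (cball (0::'a) r)"
      unfolding eq by (intro emeasure_Diff_null_set) auto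
    also have "\<dots> = ennreal a"
      using r v by (simp add: emeasure_cball flip: v_def)
    finally have 1: "emeasure (distr (lborel :: 'a measure) borel radial_volume) {..a} = ennreal a"
      by (simp add: emeasure_distr vimage_def)
    have "emeasure (density lborel (indicator {0<..})) {..a} = emeasure lborel ({0<..} \<inter> {..a})"
      by (subst emeasure_density) (auto simp: indicator_inter_arith[symmetric])
    also have "{0<..} \<inter> {..a} = {0<..a}" by auto
    finally show ?thesis using 1 True by simp
  qed
  show "emeasure (distr (lborel :: 'a measure) borel radial_volume) X = emeasure (density lborel (indicator {0<..})) X"
    if "X \<in> range (atMost :: real \<Rightarrow> real set)" for X using that * by auto
  show "(\<Union>i. {..real i}) = UNIV" by (auto intro: real_arch_simple)
  show "emeasure (distr (lborel :: 'a measure) borel radial_volume) {..real i} \<noteq> \<infinity>" for i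
    using * by simp
qed auto

text \<open>
  Measure preservation passes from Borel to Lebesgue measurable sets because preimages of null sets
  are null sets.
\<close>

lemma radial_volume_measurable [measurable]:
  "(radial_volume :: 'a::euclidean_space \<Rightarrow> real) \<in> lebesgue \<rightarrow>\<^sub>M half_line"
    (is ?M)
  and distr_radial_volume:
  "distr (lebesgue :: 'a measure) half_line radial_volume = half_line" (is ?D)
proof -
  let ?T = "radial_volume :: 'a \<Rightarrow> real"
  have em: "emeasure lborel (?T -` A) = emeasure lborel (A \<inter> {0<..})" if A: "A \<in> sets borel" for A
  proof -
    have "emeasure lborel (?T -` A) = emeasure (distr lborel borel ?T) A"
      using A by (simp add: emeasure_distr)
    also have "\<dots> = emeasure lborel (A \<inter> {0<..})"
      unfolding distr_radial_volume_borel using A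
      by (subst emeasure_density) (auto simp: indicator_inter_arith[symmetric] Int_commute)
    finally show ?thesis .
  qed
  have null: "?T -` N \<in> null_sets lborel" if "N \<in> null_sets lborel" for N
  proof -
    have N: "N \<in> sets borel" "emeasure lborel N = 0" using that by auto
    have "emeasure lborel (N \<inter> {0<..}) \<le> emeasure lborel N"
      using N by (intro emeasure_mono) auto
    then show ?thesis
      using N em[of N] measurable_sets[of ?T borel borel N] by (auto simp: null_sets_def)
  qed
  have T0: "?T \<in> lebesgue \<rightarrow>\<^sub>M lebesgue"
  proof (rule completion.measurable_completion2)
    show "?T \<in> lebesgue \<rightarrow>\<^sub>M lborel"
      by (rule measurable_completion) simp
    show "null_sets lborel \<subseteq> null_sets (distr lebesgue lborel ?T)"
    proof
      fix N :: "real set" assume N: "N \<in> null_sets lborel"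
      then have "emeasure lborel (?T -` N) = 0" "?T -` N \<in> sets borel" using null[OF N] by auto
      then show "N \<in> null_sets (distr lebesgue lborel ?T)"
        using N \<open>?T \<in> lebesgue \<rightarrow>\<^sub>M lborel\<close>
        by (auto simp: null_sets_def emeasure_distr)
    qed
  qed
  show M: ?M
    by (rule measurable_restrict_space2) (use T0 radial_volume_pos in auto)
  show ?D
  proof (rule measure_eqI)
    fix A assume "A \<in> sets (distr (lebesgue :: 'a measure) half_line ?T)"
    then have A: "A \<in> sets half_line" by simp
    then have A': "A \<in> sets lebesgue" "A \<subseteq> {0<..}"
      by (auto simp: sets_restrict_space_iff)
    obtain S N N' where S: "A = S \<union> N" "N \<subseteq> N'" "N' \<in> null_sets lborel" "S \<in> sets lborel"
      using sets_completionE[OF A'(1)] by metis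
    have "AE x in lebesgue. ?T x \<notin> N'"
      using null[OF S(3)] by (intro AE_completion AE_I'[OF null[OF S(3)]]) auto
    then have "emeasure lebesgue (?T -` A) = emeasure lebesgue (?T -` S)"
    proof (intro emeasure_eq_AE)
      show "?T -` A \<in> sets lebesgue" using measurable_sets[OF T0 A'(1)] by simp
      show "?T -` S \<in> sets lebesgue" using measurable_sets[OF T0, of S] S by simp
    qed (use S in auto)
    also have "\<dots> = emeasure lborel (S \<inter> {0<..})"
      using em[of S] S measurable_sets[of ?T borel borel S] by simp
    also have "S \<inter> {0<..} = S" using S A' by auto
    also have "emeasure lborel S = emeasure lebesgue S" using S by simp
    also have "\<dots> = emeasure lebesgue A"
    proof (intro emeasure_eq_AE)
      have "AE x in lborel. x \<notin> N'" using S(3) by (rule AE_not_in)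
      then have "AE x in lebesgue. x \<notin> N'" by (rule AE_completion)
      then show "AE x in lebesgue. x \<in> S \<longleftrightarrow> x \<in> A" by eventually_elim (use S in auto)
    qed (use S A' in auto)
    finally show "emeasure (distr (lebesgue :: 'a measure) half_line ?T) A = emeasure half_line A"
      using A A' M by (simp add: emeasure_distr emeasure_restrict_space)
  qed simp
qed

section \<open>Rearrangements and their distribution\<close>

lemma distribution_function_mono:
  assumes [measurable]: "u \<in> borel_measurable M" and "s \<le> s'"
  shows "distribution_function M u s' \<le> distribution_function M u s"
  unfolding distribution_function_def using \<open>s \<le> s'\<close>
  by (intro emeasure_mono) (auto intro: le_less_trans)

text \<open>
  The distribution function is right-continuous, so it is still above t a little to the right of s.
  This Galois connection yields the distribution of the rearrangement.
\<close>

lemma less_decreasing_rearrangement_iff: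
  assumes [measurable]: "u \<in> borel_measurable M"
  shows "s < decreasing_rearrangement M u t \<longleftrightarrow> ennreal t < distribution_function M u s"
proof
  assume "s < decreasing_rearrangement M u t"
  then show "ennreal t < distribution_function M u s"
    unfolding decreasing_rearrangement_def
    by (metis (mono_tags, lifting) Inf_lower leD linorder_not_le mem_Collect_eq)
next
  assume t: "ennreal t < distribution_function M u s"
  have s: "s < \<infinity>"
  proof (rule ccontr)
    assume "\<not> s < \<infinity>"
    then have "s = \<infinity>" by (simp add: less_top[symmetric])
    then have "distribution_function M u s = 0" by (simp add: distribution_function_def)
    then show False using t by simp
  qed
  define A where "A n = {x \<in> space M. s + ennreal (1 / Suc n) < u x}" for n
  have [measurable]: "A n \<in> sets M" for n unfolding A_def by measurable
  have inc: "incseq A"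
  proof (rule incseq_SucI)
    fix n
    have "ennreal (1 / Suc (Suc n)) \<le> ennreal (1 / Suc n)"
      by (intro ennreal_leI) (simp add: field_simps)
    then have "s + ennreal (1 / Suc (Suc n)) \<le> s + ennreal (1 / Suc n)" by (rule add_left_mono)
    then show "A n \<subseteq> A (Suc n)"
      unfolding A_def using le_less_trans by blast
  qed
  have "{x \<in> space M. s < u x} = (\<Union>n. A n)"
  proof (intro equalityI subsetI)
    fix x assume x: "x \<in> {x \<in> space M. s < u x}"
    have "(\<lambda>n. ennreal (1 / Suc n)) \<longlonglongrightarrow> ennreal 0"
      by (intro tendsto_ennrealI) (rule LIMSEQ_Suc[OF lim_1_over_n])
    then have "(\<lambda>n. s + ennreal (1 / Suc n)) \<longlonglongrightarrow> s + 0"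
      by (intro tendsto_add) auto
    then have "\<forall>\<^sub>F n in sequentially. s + ennreal (1 / Suc n) < u x"
      using x by (intro order_tendstoD(2)) auto
    then obtain n where "s + ennreal (1 / Suc n) < u x"
      by (meson eventually_sequentially order_refl)
    then show "x \<in> (\<Union>n. A n)" using x by (auto simp: A_def)
  next
    fix x assume "x \<in> (\<Union>n. A n)"
    then obtain n where n: "x \<in> A n" by auto
    have "s \<le> s + ennreal (1 / Suc n)" by simp
    then show "x \<in> {x \<in> space M. s < u x}" using n unfolding A_def using le_less_trans by blast
  qed
  then have "distribution_function M u s = (SUP n. emeasure M (A n))"
    unfolding distribution_function_def by (subst SUP_emeasure_incseq) (auto simp: inc)
  with t obtain n where n: "ennreal t < emeasure M (A n)" by (auto simp: less_SUP_iff)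
  have "s + ennreal (1 / Suc n) \<le> decreasing_rearrangement M u t"
    unfolding decreasing_rearrangement_def
  proof (rule Inf_greatest)
    fix \<sigma> assume "\<sigma> \<in> {s. distribution_function M u s \<le> ennreal t}"
    then have "distribution_function M u \<sigma> < emeasure M (A n)" using n by auto
    also have "emeasure M (A n) = distribution_function M u (s + ennreal (1 / Suc n))"
      by (simp add: A_def distribution_function_def)
    finally have "\<not> \<sigma> \<le> s + ennreal (1 / Suc n)"
      using distribution_function_mono[OF assms] by (meson leD)
    then show "s + ennreal (1 / Suc n) \<le> \<sigma>" by simp
  qed
  moreover have "s + 0 < s + ennreal (1 / Suc n)"
    using s by (subst ennreal_add_left_cancel_less) auto
  ultimately show "s < decreasing_rearrangement M u t" by (metis add.right_neutral less_le_trans)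
qed

lemma space_half_line: "space half_line = {0<..}"
  by (simp add: space_restrict_space)

lemma decreasing_rearrangement_antimono:
  "t \<le> t' \<Longrightarrow> decreasing_rearrangement M u t' \<le> decreasing_rearrangement M u t"
  unfolding decreasing_rearrangement_def
  by (intro Inf_superset_mono) (auto intro: order_trans[OF _ ennreal_leI])

lemma emeasure_half_line_less:
  "{t \<in> {0<..}. ennreal t < m} \<in> sets half_line"
  "emeasure half_line {t \<in> {0<..}. ennreal t < m} = m"
proof -
  show 1: "{t \<in> {0<..}. ennreal t < m} \<in> sets half_line"
    by (auto simp: sets_restrict_space_iff)
  have "emeasure half_line {t \<in> {0<..}. ennreal t < m} = emeasure lebesgue {t \<in> {0<..}. ennreal t < m}"
    using 1 by (subst emeasure_restrict_space) auto
  also have "\<dots> = m"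
  proof (cases m)
    case (real r)
    then have "{t \<in> {0<..}. ennreal t < m} = {0<..<r}"
      by (auto simp: ennreal_less_iff)
    then show ?thesis using real by simp
  next
    case top
    then have *: "{t \<in> {0<..}. ennreal t < m} = {0<..}" by (auto simp: ennreal_less_top)
    have "emeasure lebesgue {0::real<..} = \<infinity>"
    proof (rule ccontr)
      assume "emeasure lebesgue {0::real<..} \<noteq> \<infinity>"
      then obtain r where r: "r \<ge> 0" "emeasure lebesgue {0::real<..} = ennreal r" 
        by (cases "emeasure lebesgue {0::real<..}") auto
      have "emeasure lebesgue {0<..<r+1} \<le> emeasure lebesgue {0::real<..}"
        by (intro emeasure_mono) auto
      then show False using r by (simp add: ennreal_le_iff)
    qed
    then show ?thesis using top * by simp
  qed
  finally show "emeasure half_line {t \<in> {0<..}. ennreal t < m} = m" .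
qed

lemma
  assumes "u \<in> borel_measurable M"
  shows decreasing_rearrangement_measurable: "decreasing_rearrangement M u \<in> borel_measurable half_line"
    and distribution_decreasing_rearrangement:
      "distribution_function half_line (decreasing_rearrangement M u) = distribution_function M u"
proof -
  have *: "{t \<in> space half_line. s < decreasing_rearrangement M u t} = {t \<in> {0<..}. ennreal t < distribution_function M u s}" for s
    by (simp add: less_decreasing_rearrangement_iff[OF assms] space_half_line)
  show "decreasing_rearrangement M u \<in> borel_measurable half_line"
    by (rule borel_measurableI_greater) (simp only: * emeasure_half_line_less)
  show "distribution_function half_line (decreasing_rearrangement M u) = distribution_function M u"
    by (rule ext) (simp only: * emeasure_half_line_less distribution_function_def[of half_line])
qed

text \<open>
  Together with the previous lemma this makes u and the radial function u*(T x) equimeasurable, so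
  that rearrangement invariant norms on the space and on the half-line determine each other.
\<close>

lemma distribution_radial_volume:
  fixes g :: "real \<Rightarrow> ennreal"
  assumes [measurable]: "g \<in> borel_measurable half_line"
  shows "distribution_function (lebesgue :: 'a::euclidean_space measure) (\<lambda>x. g (radial_volume x))
     = distribution_function half_line g"
proof (rule ext)
  fix s
  have "distribution_function half_line g s
      = emeasure (distr (lebesgue :: 'a measure) half_line radial_volume) {y \<in> space half_line. s < g y}"
    by (simp add: distribution_function_def distr_radial_volume)
  also have "\<dots> = emeasure lebesgue (radial_volume -` {y \<in> space half_line. s < g y} \<inter> space (lebesgue :: 'a measure))"
    by (intro emeasure_distr) measurable
  also have "radial_volume -` {y \<in> space half_line. s < g y} \<inter> space (lebesgue :: 'a measure)
     = {x \<in> space lebesgue. s < g (radial_volume x)}"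
    using radial_volume_pos by (auto simp: space_half_line)
  finally show "distribution_function (lebesgue :: 'a measure) (\<lambda>x. g (radial_volume x)) s
     = distribution_function half_line g s" by (simp add: distribution_function_def)
qed

section \<open>Function norms and the Luxemburg representation\<close>

locale function_norm =
  fixes M :: "'a measure" and \<rho> :: "('a \<Rightarrow> ennreal) \<Rightarrow> ennreal"
  assumes norm: "banach_function_norm M \<rho>"
begin

lemma zero_iff: "f \<in> borel_measurable M \<Longrightarrow> \<rho> f = 0 \<longleftrightarrow> (AE x in M. f x = 0)"
  using norm unfolding banach_function_norm_def by blast

lemma cmult: "f \<in> borel_measurable M \<Longrightarrow> 0 \<le> c \<Longrightarrow> \<rho> (\<lambda>x. ennreal c * f x) = ennreal c * \<rho> f"
  using norm unfolding banach_function_norm_def by blast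

lemma add: "f \<in> borel_measurable M \<Longrightarrow> g \<in> borel_measurable M \<Longrightarrow> \<rho> (\<lambda>x. f x + g x) \<le> \<rho> f + \<rho> g"
  using norm unfolding banach_function_norm_def by blast

lemma mono: "f \<in> borel_measurable M \<Longrightarrow> g \<in> borel_measurable M \<Longrightarrow> (AE x in M. g x \<le> f x) \<Longrightarrow> \<rho> g \<le> \<rho> f"
  using norm unfolding banach_function_norm_def by blast

lemma cong: 
  assumes "f \<in> borel_measurable M" "g \<in> borel_measurable M" "AE x in M. g x = f x" 
  shows "\<rho> g = \<rho> f"
proof (rule antisym)
  show "\<rho> g \<le> \<rho> f" using assms by (intro mono) auto
  have "AE x in M. f x \<le> g x" using assms(3) by eventually_elim simp
  then show "\<rho> f \<le> \<rho> g" using assms by (intro mono) auto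
qed

lemma monotone_limit:
  fixes F :: "nat \<Rightarrow> 'a \<Rightarrow> ennreal"
  assumes "\<And>k. F k \<in> borel_measurable M" "f \<in> borel_measurable M"
    "AE x in M. incseq (\<lambda>k. F k x) \<and> (\<lambda>k. F k x) \<longlonglongrightarrow> f x"
  shows "(\<lambda>k. \<rho> (F k)) \<longlonglongrightarrow> \<rho> f"
  by (rule norm[unfolded banach_function_norm_def, THEN conjunct2, THEN conjunct2, THEN conjunct2,
      THEN conjunct2, THEN conjunct1, rule_format, THEN conjunct2]) (fact assms)+

lemma local_bound:
  assumes "E \<in> sets M" "emeasure M E < \<infinity>"
  obtains C where "0 \<le> C" "\<And>f. f \<in> borel_measurable M \<Longrightarrow> (\<integral>\<^sup>+x\<in>E. f x \<partial>M) \<le> ennreal C * \<rho> f"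
proof -
  obtain C where C: "\<forall>f\<in>borel_measurable M. (\<integral>\<^sup>+x\<in>E. f x \<partial>M) \<le> ennreal C * \<rho> f"
    using norm[unfolded banach_function_norm_def, THEN conjunct2, THEN conjunct2, THEN conjunct2,
        THEN conjunct2, THEN conjunct2, THEN conjunct2] assms by blast
  show thesis
  proof (rule that)
    show "0 \<le> max 0 C" by simp
    fix f :: "'a \<Rightarrow> ennreal" assume "f \<in> borel_measurable M"
    then have "(\<integral>\<^sup>+x\<in>E. f x \<partial>M) \<le> ennreal C * \<rho> f" using C by blast
    also have "\<dots> \<le> ennreal (max 0 C) * \<rho> f" by (intro mult_right_mono ennreal_leI) auto
    finally show "(\<integral>\<^sup>+x\<in>E. f x \<partial>M) \<le> ennreal (max 0 C) * \<rho> f" .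
  qed
qed

lemma countably_subadditive:
  fixes F :: "nat \<Rightarrow> 'a \<Rightarrow> ennreal"
  assumes [measurable]: "\<And>k. F k \<in> borel_measurable M"
  shows "\<rho> (\<lambda>x. \<Sum>k. F k x) \<le> (\<Sum>k. \<rho> (F k))"
proof -
  have "(\<lambda>k. \<rho> (\<lambda>x. \<Sum>i<k. F i x)) \<longlonglongrightarrow> \<rho> (\<lambda>x. \<Sum>k. F k x)"
  proof (rule monotone_limit)
    show "AE x in M. incseq (\<lambda>k. \<Sum>i<k. F i x) \<and> (\<lambda>k. \<Sum>i<k. F i x) \<longlonglongrightarrow> (\<Sum>k. F k x)"
      by (auto intro!: AE_I2 incseq_SucI summable_LIMSEQ simp: summableI)
  qed auto
  moreover have "\<rho> (\<lambda>x. \<Sum>i<k. F i x) \<le> (\<Sum>k. \<rho> (F k))" for k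
  proof -
    have "\<rho> (\<lambda>x. \<Sum>i<k. F i x) \<le> (\<Sum>i<k. \<rho> (F i))"
    proof (induction k)
      case 0
      then show ?case by (simp add: zero_iff)
    next
      case (Suc k)
      have "\<rho> (\<lambda>x. (\<Sum>i<k. F i x) + F k x) \<le> \<rho> (\<lambda>x. \<Sum>i<k. F i x) + \<rho> (F k)"
        by (intro add) measurable
      also have "\<dots> \<le> (\<Sum>i<k. \<rho> (F i)) + \<rho> (F k)"
        by (intro add_right_mono Suc)
      finally show ?case by simp
    qed
    also have "\<dots> \<le> (\<Sum>k. \<rho> (F k))" by (intro sum_le_suminf) auto
    finally show ?thesis .
  qed
  ultimately show ?thesis by (intro LIMSEQ_le_const2) auto
qed

lemma finite_AE:
  assumes "sigma_finite_measure M" and [measurable]: "f \<in> borel_measurable M" and fin: "\<rho> f < \<infinity>"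
  shows "AE x in M. f x \<noteq> \<infinity>"
proof -
  interpret sigma_finite_measure M by fact
  obtain A :: "nat \<Rightarrow> 'a set" where A: "range A \<subseteq> sets M" "(\<Union>i. A i) = space M" "\<And>i. emeasure M (A i) \<noteq> \<infinity>"
    using sigma_finite by blast
  have "AE x in M. x \<in> A i \<longrightarrow> f x \<noteq> \<infinity>" for i
  proof -
    have [measurable]: "A i \<in> sets M" using A by auto
    obtain C where "(\<integral>\<^sup>+x\<in>A i. f x \<partial>M) \<le> ennreal C * \<rho> f"
      using local_bound[of "A i"] A(3)[of i] by (metis \<open>A i \<in> sets M\<close> assms(2) infinity_ennreal_def less_top)
    also have "\<dots> < \<infinity>" using fin by (simp add: ennreal_mult_less_top)
    finally have "(\<integral>\<^sup>+x. f x * indicator (A i) x \<partial>M) \<noteq> \<infinity>" by simp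
    then have "AE x in M. f x * indicator (A i) x \<noteq> \<infinity>"
      by (intro nn_integral_PInf_AE) auto
    then show ?thesis by eventually_elim auto
  qed
  then have "AE x in M. \<forall>i. x \<in> A i \<longrightarrow> f x \<noteq> \<infinity>" by (subst AE_all_countable) blast
  then show ?thesis by (rule AE_mp) (use A(2) in \<open>auto intro!: AE_I2\<close>)
qed

end

locale ri_function_norm = function_norm +
  assumes ri: "rearrangement_invariant M \<rho>"
begin

lemma equimeasurable_eq:
  "f \<in> borel_measurable M \<Longrightarrow> g \<in> borel_measurable M \<Longrightarrow>
   distribution_function M f = distribution_function M g \<Longrightarrow> \<rho> f = \<rho> g"
  using ri unfolding rearrangement_invariant_def equimeasurable_def by blast

end

text \<open>
  Composition with the measure preserving map T carries every axiom of a function norm over to the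
  half-line, and u is equimeasurable with the composition of u* and T.
\<close>

lemma is_luxemburg_representation_radial:
  fixes \<rho> :: "('a::euclidean_space \<Rightarrow> ennreal) \<Rightarrow> ennreal"
  assumes "banach_function_norm lebesgue \<rho>" "rearrangement_invariant lebesgue \<rho>"
  shows "is_luxemburg_representation lebesgue \<rho> (\<lambda>g. \<rho> (\<lambda>x. g (radial_volume x)))"
proof -
  interpret ri_function_norm lebesgue \<rho> by standard (use assms in auto)
  let ?T = "radial_volume :: 'a \<Rightarrow> real"
  have m[measurable]: "(\<lambda>x. g (?T x)) \<in> borel_measurable lebesgue" if "g \<in> borel_measurable half_line" for g :: "real \<Rightarrow> ennreal"
    using measurable_compose[OF radial_volume_measurable that] .
  have AE: "AE x in lebesgue. P (?T x)" if "AE y in half_line. P y" for P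
  proof -
    have "AE y in distr (lebesgue :: 'a measure) half_line ?T. P y"
      using that by (simp only: distr_radial_volume)
    then show ?thesis by (rule AE_distrD[OF radial_volume_measurable])
  qed
  have em: "emeasure lebesgue (?T -` E) = emeasure half_line E" "?T -` E \<in> sets lebesgue" if "E \<in> sets half_line" for E
  proof -
    show "emeasure lebesgue (?T -` E) = emeasure half_line E"
      using emeasure_distr[OF radial_volume_measurable that, symmetric] by (simp add: distr_radial_volume)
    show "?T -` E \<in> sets lebesgue"
      using measurable_sets[OF radial_volume_measurable that] by simp
  qed
  have "banach_function_norm half_line (\<lambda>g. \<rho> (\<lambda>x. g (radial_volume x)))"
    unfolding banach_function_norm_def
  proof (intro conjI ballI allI impI)
    fix f :: "real \<Rightarrow> ennreal" assume [measurable]: "f \<in> borel_measurable half_line"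
    have "(AE x in lebesgue. f (?T x) = 0) \<longleftrightarrow> (AE y in distr (lebesgue :: 'a measure) half_line ?T. f y = 0)"
      by (rule AE_distr_iff[symmetric]) measurable
    then show "(\<rho> (\<lambda>x. f (?T x)) = 0) = (AE x in half_line. f x = 0)"
      unfolding distr_radial_volume by (simp add: zero_iff)
  next
    fix f :: "real \<Rightarrow> ennreal" and c :: real assume [measurable]: "f \<in> borel_measurable half_line" and "0 \<le> c"
    then show "\<rho> (\<lambda>x. ennreal c * f (?T x)) = ennreal c * \<rho> (\<lambda>x. f (?T x))"
      by (intro cmult) auto
  next
    fix f g :: "real \<Rightarrow> ennreal" assume [measurable]: "f \<in> borel_measurable half_line" "g \<in> borel_measurable half_line"
    show "\<rho> (\<lambda>x. f (?T x) + g (?T x)) \<le> \<rho> (\<lambda>x. f (?T x)) + \<rho> (\<lambda>x. g (?T x))"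
      by (intro add) auto
  next
    fix f g :: "real \<Rightarrow> ennreal" assume [measurable]: "f \<in> borel_measurable half_line" "g \<in> borel_measurable half_line"
      and "AE x in half_line. g x \<le> f x"
    then show "\<rho> (\<lambda>x. g (?T x)) \<le> \<rho> (\<lambda>x. f (?T x))"
      by (intro mono AE) auto
  next
    fix F :: "nat \<Rightarrow> real \<Rightarrow> ennreal" and f :: "real \<Rightarrow> ennreal"
    assume *: "\<forall>k. F k \<in> borel_measurable half_line" "f \<in> borel_measurable half_line"
      "AE x in half_line. incseq (\<lambda>k. F k x) \<and> (\<lambda>k. F k x) \<longlonglongrightarrow> f x"
    have **: "AE x in lebesgue. incseq (\<lambda>k. F k (?T x)) \<and> (\<lambda>k. F k (?T x)) \<longlonglongrightarrow> f (?T x)"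
      using *(3) by (rule AE)
    then show "(\<lambda>k. \<rho> (\<lambda>x. F k (?T x))) \<longlonglongrightarrow> \<rho> (\<lambda>x. f (?T x))"
      using * by (intro monotone_limit m) blast+
    show "incseq (\<lambda>k. \<rho> (\<lambda>x. F k (?T x)))"
    proof (rule incseq_SucI)
      fix k
      show "\<rho> (\<lambda>x. F k (?T x)) \<le> \<rho> (\<lambda>x. F (Suc k) (?T x))"
        using * eventually_mono[OF **, of "\<lambda>x. F k (?T x) \<le> F (Suc k) (?T x)"]
        by (intro mono m) (auto simp: incseq_Suc_iff)
    qed
  next
    fix E assume E: "E \<in> sets half_line" "emeasure half_line E < \<infinity>"
    have eq: "indicator E (?T x) = indicator (?T -` E) x" for x by (simp add: indicator_def)
    show "\<rho> (\<lambda>x. indicator E (?T x)) < \<infinity>"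
      unfolding eq using em[OF E(1)] E(2) norm unfolding banach_function_norm_def by auto
    obtain C where C: "0 \<le> C" "\<And>f. f \<in> borel_measurable lebesgue \<Longrightarrow> (\<integral>\<^sup>+x\<in>?T -` E. f x \<partial>lebesgue) \<le> ennreal C * \<rho> f"
      using local_bound[of "?T -` E"] em[OF E(1)] E(2) by auto
    show "\<exists>C. \<forall>f\<in>borel_measurable half_line. (\<integral>\<^sup>+x\<in>E. f x \<partial>half_line) \<le> ennreal C * \<rho> (\<lambda>x. f (?T x))"
    proof (intro exI ballI)
      fix f :: "real \<Rightarrow> ennreal" assume [measurable]: "f \<in> borel_measurable half_line"
      note E(1)[measurable]
      have "(\<integral>\<^sup>+x\<in>E. f x \<partial>half_line) = (\<integral>\<^sup>+x. f x * indicator E x \<partial>distr (lebesgue :: 'a measure) half_line ?T)"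
        by (simp add: distr_radial_volume)
      also have "\<dots> = (\<integral>\<^sup>+x. f (?T x) * indicator E (?T x) \<partial>lebesgue)"
        by (intro nn_integral_distr) measurable
      also have "\<dots> \<le> ennreal C * \<rho> (\<lambda>x. f (?T x))"
        unfolding eq by (intro C) auto
      finally show "(\<integral>\<^sup>+x\<in>E. f x \<partial>half_line) \<le> ennreal C * \<rho> (\<lambda>x. f (?T x))" .
    qed
  qed
  moreover have "rearrangement_invariant half_line (\<lambda>g. \<rho> (\<lambda>x. g (radial_volume x)))"
    unfolding rearrangement_invariant_def equimeasurable_def
    by (auto intro!: equimeasurable_eq simp: distribution_radial_volume)
  moreover have "\<rho> f = \<rho> (\<lambda>x. decreasing_rearrangement lebesgue f (radial_volume x))"
    if "f \<in> borel_measurable lebesgue" for f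
    using that decreasing_rearrangement_measurable[OF that]
    by (intro equimeasurable_eq m) (auto simp: distribution_radial_volume distribution_decreasing_rearrangement)
  ultimately show ?thesis by (simp add: is_luxemburg_representation_def)
qed

section \<open>Dilations and the upper Boyd index\<close>

lemma dilation_measurable:
  fixes g :: "real \<Rightarrow> ennreal"
  assumes g: "g \<in> borel_measurable half_line" and t: "0 < t"
  shows "(\<lambda>s. g (s / t)) \<in> borel_measurable half_line"
proof -
  have "(\<lambda>s. inverse t *\<^sub>R s) \<in> lebesgue \<rightarrow>\<^sub>M (lebesgue :: real measure)"
    by (rule lebesgue_measurable_scaling)
  then have "(\<lambda>s. inverse t *\<^sub>R s) \<in> half_line \<rightarrow>\<^sub>M half_line"
    by (rule measurable_restrict_space3) (use t in auto)
  then have "(\<lambda>s. g (inverse t *\<^sub>R s)) \<in> borel_measurable half_line"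
    using g by (rule measurable_compose)
  then show ?thesis by (simp add: divide_inverse mult.commute)
qed

lemma distribution_dilation:
  fixes g :: "real \<Rightarrow> ennreal"
  assumes [measurable]: "g \<in> borel_measurable half_line" and t: "0 < t"
  shows "distribution_function half_line (\<lambda>s. g (s / t)) \<sigma> = ennreal t * distribution_function half_line g \<sigma>"
proof -
  have m1: "{s \<in> space half_line. \<sigma> < g s} \<in> sets half_line" by measurable
  have m2: "{s \<in> space half_line. \<sigma> < g (s / t)} \<in> sets half_line"
    using dilation_measurable[OF assms] by measurable
  have eq: "(\<lambda>s. t *\<^sub>R s + 0) ` {s \<in> space half_line. \<sigma> < g s} = {s \<in> space half_line. \<sigma> < g (s / t)}"
  proof (intro equalityI subsetI)
    fix s assume "s \<in> {s \<in> space half_line. \<sigma> < g (s / t)}"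
    then have "s / t \<in> {s \<in> space half_line. \<sigma> < g s}" "s = t *\<^sub>R (s / t) + 0"
      using t by (auto simp: space_half_line)
    then show "s \<in> (\<lambda>s. t *\<^sub>R s + 0) ` {s \<in> space half_line. \<sigma> < g s}" by blast
  qed (use t in \<open>auto simp: space_half_line\<close>)
  have "distribution_function half_line (\<lambda>s. g (s / t)) \<sigma> = emeasure lebesgue {s \<in> space half_line. \<sigma> < g (s / t)}"
    unfolding distribution_function_def using m2
    by (intro emeasure_restrict_space) (auto simp: space_half_line)
  also have "\<dots> = ennreal t * emeasure lebesgue {s \<in> space half_line. \<sigma> < g s}"
    using emeasure_lebesgue_affine[of t 0 "{s \<in> space half_line. \<sigma> < g s}"] t
    unfolding eq by simp
  also have "emeasure lebesgue {s \<in> space half_line. \<sigma> < g s} = distribution_function half_line g \<sigma>"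
    unfolding distribution_function_def using m1
    by (intro emeasure_restrict_space[symmetric]) (auto simp: space_half_line)
  finally show ?thesis .
qed

lemma distribution_cong_AE:
  assumes [measurable]: "f \<in> borel_measurable M" "g \<in> borel_measurable M" and "AE x in M. f x = g x"
  shows "distribution_function M f = distribution_function M g"
  unfolding distribution_function_def
  by (intro ext emeasure_eq_AE) (use assms(3) in \<open>auto elim: eventually_mono\<close>)

lemma sigma_finite_lebesgue: "sigma_finite_measure (lebesgue :: 'a::euclidean_space measure)"
proof
  obtain A :: "'a set set" where "countable A \<and> A \<subseteq> sets lborel \<and> \<Union>A = space lborel \<and>
      (\<forall>a\<in>A. emeasure lborel a \<noteq> \<infinity>)"
    using lborel.sigma_finite_countable ..
  then have A: "countable A" "A \<subseteq> sets lborel" "\<Union>A = space lborel"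
      "\<And>a. a \<in> A \<Longrightarrow> emeasure lborel a \<noteq> \<infinity>" by (elim conjE; blast)+
  have fin: "emeasure lebesgue a \<noteq> \<infinity>" if "a \<in> A" for a
  proof -
    have "a \<in> sets lborel" using that A(2) by blast
    then have "emeasure lebesgue a = emeasure lborel a" by simp
    then show ?thesis using A(4)[OF that] by metis
  qed
  have "A \<subseteq> sets lebesgue" using A(2) by (metis sets_completionI_sets subset_iff)
  with A fin show "\<exists>A::'a set set. countable A \<and> A \<subseteq> sets lebesgue \<and> \<Union>A = space lebesgue \<and> (\<forall>a\<in>A. emeasure lebesgue a \<noteq> \<infinity>)"
    by (metis space_completion)
qed

locale half_line_norm = ri_function_norm half_line \<rho>' for \<rho>' :: "(real \<Rightarrow> ennreal) \<Rightarrow> ennreal"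
begin

lemma dilation_eq:
  assumes "f \<in> borel_measurable half_line" "g \<in> borel_measurable half_line" "0 < t"
    "distribution_function half_line f = distribution_function half_line g"
  shows "\<rho>' (\<lambda>s. f (s / t)) = \<rho>' (\<lambda>s. g (s / t))"
  using assms by (intro equimeasurable_eq dilation_measurable) (auto simp: distribution_dilation)

text \<open>
  The operator norm is a supremum over real-valued functions. A function of finite norm is finite
  almost everywhere, hence, unless its norm is 0, equimeasurable with a multiple of a real-valued
  function of norm 1, and dilations preserve equimeasurability.
\<close>

lemma dilation_le_dilation_norm:
  assumes g[measurable]: "g \<in> borel_measurable half_line" and t: "0 < t" and fin: "\<rho>' g < \<infinity>"
  shows "\<rho>' (\<lambda>s. g (s / t)) \<le> dilation_norm \<rho>' t * \<rho>' g"
proof (cases "\<rho>' g = 0")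
  case True
  then have "AE s in half_line. g s = (\<lambda>_. 0) s" by (simp add: zero_iff)
  then have "distribution_function half_line g = distribution_function half_line (\<lambda>_. 0)"
    by (intro distribution_cong_AE) auto
  then have "\<rho>' (\<lambda>s. g (s / t)) = \<rho>' (\<lambda>_. 0)"
    using dilation_eq[OF g _ t, of "\<lambda>_. 0"] by simp
  also have "\<dots> = 0" by (subst zero_iff) auto
  finally show ?thesis by simp
next
  case False
  define r where "r = enn2real (\<rho>' g)"
  have r: "r > 0" "\<rho>' g = ennreal r"
    using False fin by (auto simp: r_def enn2real_positive_iff zero_less_iff_neq_zero)
  have "sigma_finite_measure half_line"
    by (intro sigma_finite_measure_restrict_space) (auto intro: sigma_finite_lebesgue)
  then have AE: "AE s in half_line. g s \<noteq> \<infinity>"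
    by (rule finite_AE[OF _ g fin])
  define f where "f s = enn2real (g s) / r" for s
  have [measurable]: "f \<in> borel_measurable half_line" unfolding f_def by measurable
  have fg: "AE s in half_line. ennreal r * ennreal \<bar>f s\<bar> = g s"
    using AE by eventually_elim (use r in \<open>simp add: f_def ennreal_mult'[symmetric] less_top[symmetric]\<close>)
  have "ennreal r * \<rho>' (\<lambda>s. ennreal \<bar>f s\<bar>) = \<rho>' (\<lambda>s. ennreal r * ennreal \<bar>f s\<bar>)"
    using r by (intro cmult[symmetric]) auto
  also have "\<dots> = \<rho>' g" using fg by (intro cong) auto
  finally have "ennreal r * \<rho>' (\<lambda>s. ennreal \<bar>f s\<bar>) = ennreal r * 1" using r by simp
  then have f1: "\<rho>' (\<lambda>s. ennreal \<bar>f s\<bar>) = 1"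
    using r by (subst (asm) ennreal_mult_cancel_left) auto
  have "distribution_function half_line (\<lambda>s. ennreal r * ennreal \<bar>f s\<bar>) = distribution_function half_line g"
    using fg by (intro distribution_cong_AE) auto
  then have "\<rho>' (\<lambda>s. g (s / t)) = \<rho>' (\<lambda>s. ennreal r * ennreal \<bar>f (s / t)\<bar>)"
    using t by (intro dilation_eq[symmetric]) auto
  also have "\<dots> = ennreal r * \<rho>' (\<lambda>s. ennreal \<bar>f (s / t)\<bar>)"
    using r t by (intro cmult dilation_measurable[of "\<lambda>s. ennreal \<bar>f s\<bar>"]) auto
  also have "\<dots> \<le> ennreal r * dilation_norm \<rho>' t"
    unfolding dilation_norm_def using f1
    by (intro mult_left_mono SUP_upper) (auto simp: function_space_def)
  finally show ?thesis using r by (simp add: mult.commute)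
qed

lemma dilation_norm_le:
  assumes "0 < t" "\<And>g. g \<in> borel_measurable half_line \<Longrightarrow> \<rho>' (\<lambda>s. g (s / t)) \<le> b * \<rho>' g"
  shows "dilation_norm \<rho>' t \<le> b"
  unfolding dilation_norm_def
proof (rule SUP_least)
  fix f assume "f \<in> {f \<in> function_space half_line \<rho>'. \<rho>' (\<lambda>s. ennreal \<bar>f s\<bar>) \<le> 1}"
  then have [measurable]: "f \<in> borel_measurable half_line" and 1: "\<rho>' (\<lambda>s. ennreal \<bar>f s\<bar>) \<le> 1"
    by (auto simp: function_space_def)
  have "\<rho>' (\<lambda>s. ennreal \<bar>f (s / t)\<bar>) \<le> b * \<rho>' (\<lambda>s. ennreal \<bar>f s\<bar>)"
    by (intro assms(2)) measurable
  also have "\<dots> \<le> b * 1" using 1 by (intro mult_left_mono) auto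
  finally show "\<rho>' (\<lambda>s. ennreal \<bar>f (s / t)\<bar>) \<le> b" by simp
qed

text \<open>
  For the decreasing rearrangement in place of g the inequality holds pointwise.
\<close>

lemma dilation_mono:
  assumes g: "g \<in> borel_measurable half_line" and t: "0 < t" "t \<le> t'"
  shows "\<rho>' (\<lambda>s. g (s / t)) \<le> \<rho>' (\<lambda>s. g (s / t'))"
proof -
  let ?r = "decreasing_rearrangement half_line g"
  have r: "?r \<in> borel_measurable half_line" by (rule decreasing_rearrangement_measurable[OF g])
  have d: "distribution_function half_line g = distribution_function half_line ?r"
    by (rule distribution_decreasing_rearrangement[OF g, symmetric])
  have "\<rho>' (\<lambda>s. g (s / t)) = \<rho>' (\<lambda>s. ?r (s / t))"
    using t by (intro dilation_eq g r d)
  also have "\<dots> \<le> \<rho>' (\<lambda>s. ?r (s / t'))"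
    using t by (intro mono dilation_measurable r AE_I2 decreasing_rearrangement_antimono)
      (auto simp: space_half_line frac_le)
  also have "\<dots> = \<rho>' (\<lambda>s. g (s / t'))"
    using t by (intro dilation_eq g r d[symmetric]) auto
  finally show ?thesis .
qed

end

text \<open>
  A norm together with a representation of it. Only these properties of the representation chosen in
  the definition of the Boyd index are known.
\<close>

locale luxemburg_pair = ri_function_norm lebesgue \<rho> + half: half_line_norm \<rho>'
  for \<rho> :: "('a::euclidean_space \<Rightarrow> ennreal) \<Rightarrow> ennreal" and \<rho>' +
  assumes rearrange: "f \<in> borel_measurable lebesgue \<Longrightarrow> \<rho> f = \<rho>' (decreasing_rearrangement lebesgue f)"
begin

lemma radial_eq:
  assumes g: "g \<in> borel_measurable half_line"
  shows "\<rho> (\<lambda>x. g (radial_volume x)) = \<rho>' g"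
proof -
  have m: "(\<lambda>x. g (radial_volume x)) \<in> borel_measurable (lebesgue :: 'a measure)"
    using measurable_compose[OF radial_volume_measurable g] .
  show ?thesis
    unfolding rearrange[OF m]
    by (intro half.equimeasurable_eq decreasing_rearrangement_measurable g m)
      (simp add: distribution_decreasing_rearrangement[OF m] distribution_radial_volume[OF g])
qed

end

text \<open>
  Lets an estimate for dilations by powers of 2 serve for all dilations, at the price of a factor 2.
\<close>

lemma power_of_two_between:
  fixes t :: real
  assumes "1 \<le> t"
  obtains k :: nat where "t \<le> 2 ^ k" "2 ^ k \<le> 2 * t"
proof -
  define k where "k = nat \<lceil>log 2 t\<rceil>"
  have 0: "0 \<le> log 2 t" using assms by simp
  then have k: "log 2 t \<le> real k" "real k \<le> log 2 t + 1" by (auto simp: k_def)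
  have "t = 2 powr (log 2 t)" using assms by simp
  also have "\<dots> \<le> 2 powr (real k)" using k by (intro powr_mono) auto
  finally have 1: "t \<le> 2 ^ k" by (simp add: powr_realpow)
  have "2 powr (real k) \<le> 2 powr (log 2 t + 1)" using k by (intro powr_mono) auto
  also have "\<dots> = 2 * t" using assms by (simp add: powr_add)
  finally have "2 ^ k \<le> 2 * t" by (simp add: powr_realpow)
  with 1 that show thesis by blast
qed

context luxemburg_pair
begin

text \<open>
  Doubling the measure of all level sets at most doubles the norm. On the space, the radial function
  v = g(T x / 2) is even and splits into its restrictions to two opposite open half-spaces, and each of
  these has the same distribution as g, because the distribution of v is twice that of g.
\<close>

lemma dilation_two:
  assumes g: "g \<in> borel_measurable half_line"
  shows "\<rho>' (\<lambda>s. g (s / 2)) \<le> 2 * \<rho>' g"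
proof -
  define v where "v x = g (radial_volume x / 2)" for x :: 'a
  have g2: "(\<lambda>s. g (s / 2)) \<in> borel_measurable half_line" using dilation_measurable[OF g] by simp
  have v[measurable]: "v \<in> borel_measurable lebesgue"
    using measurable_compose[OF radial_volume_measurable g2] by (simp add: v_def[abs_def])
  obtain b :: 'a where b: "b \<in> Basis" using nonempty_Basis by blast
  define P where "P = {x :: 'a. 0 < x \<bullet> b}"
  define N where "N = {x :: 'a. x \<bullet> b < 0}"
  have "b \<noteq> 0" using b by auto
  then have "{x. b \<bullet> x = 0} \<in> null_sets lebesgue"
    using negligible_hyperplane[of b 0] by (simp add: negligible_iff_null_sets)
  then have AE: "AE x in lebesgue. b \<bullet> x \<noteq> 0" using AE_not_in by fastforce
  have "open P" "open N" unfolding P_def N_def by (auto intro!: open_Collect_less continuous_intros)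
  then have [measurable]: "P \<in> sets lebesgue" "N \<in> sets lebesgue" by auto
  have dist: "distribution_function lebesgue (\<lambda>x. v x * indicator P x) = distribution_function half_line g"
    "distribution_function lebesgue (\<lambda>x. v x * indicator N x) = distribution_function half_line g"
  proof -
    have *: "emeasure lebesgue ({x. s < v x} \<inter> P) = distribution_function half_line g s \<and>
        emeasure lebesgue ({x. s < v x} \<inter> N) = distribution_function half_line g s" for s
    proof -
      have A[measurable]: "{x. s < v x} \<in> sets lebesgue" using measurable_sets[OF v, of "{s<..}"]
        by (simp add: vimage_def)
      have vm: "v (- x) = v x" for x by (simp add: v_def radial_volume_def)
      \<comment> \<open>The reflection at 0 maps one half onto the other and preserves Lebesgue measure.\<close>
      have "(\<lambda>x. (-1) *\<^sub>R x + 0) ` ({x. s < v x} \<inter> P) = {x. s < v x} \<inter> N"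
      proof (intro equalityI subsetI)
        fix x assume "x \<in> {x. s < v x} \<inter> N"
        then have "- x \<in> {x. s < v x} \<inter> P" "x = (-1) *\<^sub>R (- x) + 0"
          by (auto simp: vm P_def N_def)
        then show "x \<in> (\<lambda>x. (-1) *\<^sub>R x + 0) ` ({x. s < v x} \<inter> P)" by (rule rev_image_eqI)
      qed (auto simp: vm P_def N_def)
      then have PN: "emeasure lebesgue ({x. s < v x} \<inter> N) = emeasure lebesgue ({x. s < v x} \<inter> P)"
        using emeasure_lebesgue_affine[of "-1" "0::'a" "{x. s < v x} \<inter> P"] by simp
      then have "emeasure lebesgue {x. s < v x} = emeasure lebesgue ({x. s < v x} \<inter> P \<union> {x. s < v x} \<inter> N)"
      proof (intro emeasure_eq_AE)
        show "AE x in lebesgue. x \<in> {x. s < v x} \<longleftrightarrow> x \<in> {x. s < v x} \<inter> P \<union> {x. s < v x} \<inter> N"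
          using AE
          by eventually_elim (auto simp: P_def N_def inner_commute)
      qed auto
      also have "\<dots> = emeasure lebesgue ({x. s < v x} \<inter> P) + emeasure lebesgue ({x. s < v x} \<inter> N)"
        by (intro plus_emeasure[symmetric]) (auto simp: P_def N_def)
      also have "\<dots> = 2 * emeasure lebesgue ({x. s < v x} \<inter> P)"
        by (simp add: PN mult_2)
      finally have "2 * emeasure lebesgue ({x. s < v x} \<inter> P) = emeasure lebesgue {x. s < v x}" ..
      also have "\<dots> = distribution_function half_line (\<lambda>s. g (s / 2)) s"
        using distribution_radial_volume[OF g2, where 'a='a, THEN fun_cong, of s]
        by (simp add: distribution_function_def v_def[abs_def])
      also have "\<dots> = 2 * distribution_function half_line g s"
        using distribution_dilation[OF g, of 2] by simp
      finally have "emeasure lebesgue ({x. s < v x} \<inter> P) = distribution_function half_line g s"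
        by (subst (asm) ennreal_mult_cancel_left) auto
      with PN show ?thesis by simp
    qed
    have "{x \<in> space lebesgue. s < v x * indicator P x} = {x. s < v x} \<inter> P"
        "{x \<in> space lebesgue. s < v x * indicator N x} = {x. s < v x} \<inter> N" for s
      by (auto simp: indicator_def split: if_splits)
    then show "distribution_function lebesgue (\<lambda>x. v x * indicator P x) = distribution_function half_line g"
        "distribution_function lebesgue (\<lambda>x. v x * indicator N x) = distribution_function half_line g"
      using * by (auto simp: distribution_function_def)
  qed
  have gT: "(\<lambda>x::'a. g (radial_volume x)) \<in> borel_measurable lebesgue"
    using measurable_compose[OF radial_volume_measurable g] .
  have "\<rho> (\<lambda>x. v x * indicator P x) = \<rho> (\<lambda>x. g (radial_volume x))"
       "\<rho> (\<lambda>x. v x * indicator N x) = \<rho> (\<lambda>x. g (radial_volume x))"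
    by (intro equimeasurable_eq gT; simp add: dist distribution_radial_volume[OF g])+
  then have eq: "\<rho> (\<lambda>x. v x * indicator P x) = \<rho>' g" "\<rho> (\<lambda>x. v x * indicator N x) = \<rho>' g"
    by (simp_all add: radial_eq[OF g])
  have "\<rho>' (\<lambda>s. g (s / 2)) = \<rho> v"
    using radial_eq[OF g2] by (simp add: v_def[abs_def])
  also have "\<dots> \<le> \<rho> (\<lambda>x. v x * indicator P x + v x * indicator N x)"
  proof (intro mono)
    show "AE x in lebesgue. v x \<le> v x * indicator P x + v x * indicator N x"
      using AE by eventually_elim (auto simp: P_def N_def indicator_def inner_commute)
  qed auto
  also have "\<dots> \<le> \<rho> (\<lambda>x. v x * indicator P x) + \<rho> (\<lambda>x. v x * indicator N x)"
    by (intro add) auto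
  also have "\<dots> = 2 * \<rho>' g" by (simp add: eq mult_2)
  finally show ?thesis .
qed

lemma dilation_two_power:
  assumes g: "g \<in> borel_measurable half_line"
  shows "\<rho>' (\<lambda>s. g (s / 2 ^ k)) \<le> 2 ^ k * \<rho>' g"
proof (induction k)
  case (Suc k)
  have "\<rho>' (\<lambda>s. g (s / 2 ^ Suc k)) = \<rho>' (\<lambda>s. (\<lambda>s. g (s / 2 ^ k)) (s / 2))"
    by (simp add: field_simps)
  also have "\<dots> \<le> 2 * \<rho>' (\<lambda>s. g (s / 2 ^ k))"
    by (intro dilation_two dilation_measurable g) auto
  also have "\<dots> \<le> 2 * (2 ^ k * \<rho>' g)"
    by (intro mult_left_mono Suc) auto
  finally show ?case by (simp add: mult_ac)
qed simp

lemma dilation_norm_le_double: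
  assumes t: "1 \<le> t"
  shows "dilation_norm \<rho>' t \<le> ennreal (2 * t)"
proof (rule half.dilation_norm_le)
  fix g :: "real \<Rightarrow> ennreal" assume g: "g \<in> borel_measurable half_line"
  obtain k :: nat where k: "t \<le> 2 ^ k" "2 ^ k \<le> 2 * t" using power_of_two_between[OF t] .
  have "\<rho>' (\<lambda>s. g (s / t)) \<le> \<rho>' (\<lambda>s. g (s / 2 ^ k))"
    using t k by (intro half.dilation_mono g) auto
  also have "\<dots> \<le> 2 ^ k * \<rho>' g" by (rule dilation_two_power[OF g])
  also have "(2::ennreal) ^ k = ennreal (2 ^ k)"
    by (subst ennreal_power[symmetric]) auto
  also have "\<dots> * \<rho>' g \<le> ennreal (2 * t) * \<rho>' g"
    by (intro mult_right_mono ennreal_leI k) auto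
  finally show "\<rho>' (\<lambda>s. g (s / t)) \<le> ennreal (2 * t) * \<rho>' g" .
qed (use t in auto)

text \<open>
  The sandwich t \<le> h(t) \<le> 2 t forces the quotient of logarithms to 1.
\<close>

lemma log_dilation_norm_tendsto_1:
  assumes "\<And>t. 1 < t \<Longrightarrow> ennreal t \<le> dilation_norm \<rho>' t"
  shows "((\<lambda>t. ln (enn2real (dilation_norm \<rho>' t)) / ln t) \<longlongrightarrow> 1) at_top"
proof (rule tendsto_sandwich)
  have *: "t \<le> enn2real (dilation_norm \<rho>' t) \<and> enn2real (dilation_norm \<rho>' t) \<le> 2 * t" if "1 < t" for t
  proof -
    have le: "dilation_norm \<rho>' t \<le> ennreal (2 * t)" using that by (intro dilation_norm_le_double) auto
    then have fin: "dilation_norm \<rho>' t < \<infinity>" using le_less_trans[OF _ ennreal_less_top] by auto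
    have "enn2real (ennreal t) \<le> enn2real (dilation_norm \<rho>' t)"
      using assms[OF that] fin by (intro enn2real_mono) auto
    moreover have "enn2real (dilation_norm \<rho>' t) \<le> enn2real (ennreal (2 * t))"
      using le by (intro enn2real_mono) auto
    ultimately show ?thesis using that by simp
  qed
  show "\<forall>\<^sub>F t in at_top. 1 \<le> ln (enn2real (dilation_norm \<rho>' t)) / ln t"
    using eventually_gt_at_top[of 1]
  proof eventually_elim
    case (elim t)
    then show ?case using *[OF elim] by (simp add: le_divide_eq)
  qed
  show "\<forall>\<^sub>F t in at_top. ln (enn2real (dilation_norm \<rho>' t)) / ln t \<le> ln 2 / ln t + 1"
    using eventually_gt_at_top[of 1]
  proof eventually_elim
    case (elim t)
    have "ln (enn2real (dilation_norm \<rho>' t)) \<le> ln (2 * t)" using *[OF elim] elim by simp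
    also have "\<dots> = ln 2 + ln t" using elim by (simp add: ln_mult)
    finally show ?case using elim by (simp add: field_simps)
  qed
  have "((\<lambda>t::real. ln 2 / ln t) \<longlongrightarrow> 0) at_top"
    by (intro tendsto_divide_0[OF tendsto_const] filterlim_at_top_imp_at_infinity ln_at_top)
  then show "((\<lambda>t::real. ln 2 / ln t + 1) \<longlongrightarrow> 1) at_top"
    using tendsto_add[OF _ tendsto_const[of 1]] by fastforce
qed auto

text \<open>
  If no such N existed, the previous lemma would give the index the value 1.
\<close>

lemma ex_dilation_norm_less:
  assumes "Lim at_top (\<lambda>t. ln (enn2real (dilation_norm \<rho>' t)) / ln t) < 1"
  obtains N where "1 < N" "dilation_norm \<rho>' N < ennreal N"
proof (rule ccontr)
  assume "\<not> thesis"
  then have "\<And>t. 1 < t \<Longrightarrow> ennreal t \<le> dilation_norm \<rho>' t"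
    using that by (meson linorder_not_le)
  then have "Lim at_top (\<lambda>t. ln (enn2real (dilation_norm \<rho>' t)) / ln t) = 1"
    by (intro tendsto_Lim log_dilation_norm_tendsto_1) (auto simp: trivial_limit_at_top_linorder)
  then show False using assms by simp
qed

end

lemma luxemburg_pair_luxemburg_representation:
  fixes \<rho> :: "('a::euclidean_space \<Rightarrow> ennreal) \<Rightarrow> ennreal"
  assumes "banach_function_norm lebesgue \<rho>" "rearrangement_invariant lebesgue \<rho>"
  shows "luxemburg_pair \<rho> (luxemburg_representation lebesgue \<rho>)"
proof -
  have "is_luxemburg_representation lebesgue \<rho> (luxemburg_representation lebesgue \<rho>)"
    unfolding luxemburg_representation_def
    by (rule someI[where P="is_luxemburg_representation lebesgue \<rho>", OF is_luxemburg_representation_radial[OF assms]])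
  then show ?thesis
    using assms unfolding is_luxemburg_representation_def
    by unfold_locales auto
qed

section \<open>The maximal function\<close>

lemma cball_lebesgue [measurable]: "cball (x::'a::euclidean_space) r \<in> sets lebesgue"
  using lmeasurable_cball by (rule fmeasurableD)

text \<open>
  Averages over closed balls, normalised by the power of the radius instead of the volume; the
  two versions differ by the constant factor \<open>unit_ball_vol\<close>.
\<close>

definition maximal_function :: "('a::euclidean_space \<Rightarrow> ennreal) \<Rightarrow> 'a \<Rightarrow> ennreal" where
  "maximal_function u x =
     (SUP r\<in>{0<..}. ennreal (1 / r ^ DIM('a)) * (\<integral>\<^sup>+z\<in>cball x r. u z \<partial>lebesgue))"

lemma maximal_function_upper:
  fixes x :: "'a::euclidean_space"
  shows "0 < r \<Longrightarrow> ennreal (1 / r ^ DIM('a)) * (\<integral>\<^sup>+z\<in>cball x r. u z \<partial>lebesgue) \<le> maximal_function u x"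
  unfolding maximal_function_def by (rule SUP_upper) simp

text \<open>
  If the average over the ball of radius r around x exceeds a, then so does the one over a slightly
  larger radius r', and the ball of radius r' around any x' near x still contains the original ball.
\<close>

lemma open_superlevel_maximal_function:
  fixes u :: "'a::euclidean_space \<Rightarrow> ennreal"
  shows "open {x. a < maximal_function u x}"
proof (rule openI)
  fix x assume "x \<in> {x. a < maximal_function u x}"
  then obtain r where r: "0 < r" and a: "a < ennreal (1 / r ^ DIM('a)) * (\<integral>\<^sup>+z\<in>cball x r. u z \<partial>lebesgue)"
    by (auto simp: maximal_function_def less_SUP_iff)
  define c where "c = (\<integral>\<^sup>+z\<in>cball x r. u z \<partial>lebesgue)"
  have "\<exists>r'>r. a < ennreal (1 / r' ^ DIM('a)) * c"
  proof (cases c)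
    case (real C)
    from a have a': "a < ennreal (1 / r ^ DIM('a) * C)"
      using real r by (subst ennreal_mult) (auto simp: c_def[symmetric])
    then obtain \<alpha> where \<alpha>: "0 \<le> \<alpha>" "a = ennreal \<alpha>" by (cases a) auto
    have lt: "\<alpha> < 1 / r ^ DIM('a) * C"
      using a' \<alpha> by (simp add: ennreal_less_iff)
    have "((\<lambda>s. 1 / s ^ DIM('a) * C) \<longlongrightarrow> 1 / r ^ DIM('a) * C) (at_right r)"
      using r by (intro tendsto_intros) auto
    then have "\<forall>\<^sub>F s in at_right r. \<alpha> < 1 / s ^ DIM('a) * C"
      using lt by (rule order_tendstoD(1))
    then have "\<forall>\<^sub>F s in at_right r. \<alpha> < 1 / s ^ DIM('a) * C \<and> r < s"
      using eventually_at_right_less[of r] by (rule eventually_conj)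
    then obtain s where "\<alpha> < 1 / s ^ DIM('a) * C" "r < s"
      using eventually_happens'[of "at_right r"] by (metis (mono_tags, lifting) trivial_limit_at_right_real)
    then show ?thesis using \<alpha> r real
      by (intro exI[of _ s]) (auto simp: ennreal_less_iff simp flip: ennreal_mult)
  next
    case top
    have "a < top" using a by (auto simp: less_top[symmetric])
    then show ?thesis using top r
      by (intro exI[of _ "r + 1"]) (auto simp: ennreal_mult_top)
  qed
  then obtain r' where r': "r < r'" "a < ennreal (1 / r' ^ DIM('a)) * c" by blast
  have "x' \<in> {x. a < maximal_function u x}" if "x' \<in> ball x (r' - r)" for x'
  proof -
    have "cball x r \<subseteq> cball x' r'"
    proof
      fix z assume "z \<in> cball x r"
      then show "z \<in> cball x' r'" using that dist_triangle[of x' z x] by (auto simp: dist_commute)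
    qed
    then have "c \<le> (\<integral>\<^sup>+z\<in>cball x' r'. u z \<partial>lebesgue)"
      unfolding c_def by (intro nn_integral_mono) (auto simp: indicator_def)
    then have "a < ennreal (1 / r' ^ DIM('a)) * (\<integral>\<^sup>+z\<in>cball x' r'. u z \<partial>lebesgue)"
      using r'(2) by (meson less_le_trans mult_left_mono zero_le)
    also have "\<dots> \<le> maximal_function u x'"
      using r r' by (intro maximal_function_upper) auto
    finally show ?thesis by simp
  qed
  then show "\<exists>e>0. ball x e \<subseteq> {x. a < maximal_function u x}"
    using r' by (intro exI[of _ "r' - r"]) auto
qed

lemma maximal_function_measurable [measurable]:
  "maximal_function u \<in> borel_measurable lebesgue"
proof (rule borel_measurableI_greater)
  fix y
  have "open {x. y < maximal_function u x}" by (rule open_superlevel_maximal_function)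
  then show "{x \<in> space lebesgue. y < maximal_function u x} \<in> sets lebesgue"
    by (simp add: borel_open)
qed

text \<open>
  Each point of the superlevel set is the centre of a ball on which u has a large integral. The radii
  of these balls are bounded because u is integrable, so the Vitali covering lemma selects disjoint ones
  whose fivefold enlargements cover the superlevel set.
\<close>

lemma maximal_function_weak_type:
  fixes u :: "'a::euclidean_space \<Rightarrow> ennreal"
  assumes u[measurable]: "u \<in> borel_measurable lebesgue" and a: "0 < a"
  shows "ennreal a * emeasure lebesgue {x. ennreal a < maximal_function u x}
    \<le> ennreal (5 ^ DIM('a) * unit_ball_vol DIM('a)) * (\<integral>\<^sup>+z. u z \<partial>lebesgue)"
proof (cases "(\<integral>\<^sup>+z. u z \<partial>lebesgue) = \<infinity>")
  case True
  then show ?thesis using unit_ball_vol_pos[of "real DIM('a)"] by (simp add: ennreal_mult_top del: unit_ball_vol_pos)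
next
  case False
  define v where "v = unit_ball_vol DIM('a)"
  have v: "0 < v" by (simp add: v_def)
  define n where "n = DIM('a)"
  have n: "n \<ge> 1" by (simp add: n_def Suc_leI)
  obtain I where I: "0 \<le> I" "(\<integral>\<^sup>+z. u z \<partial>lebesgue) = ennreal I"
    using False by (cases "\<integral>\<^sup>+z. u z \<partial>lebesgue") auto
  define S where "S = {x. ennreal a < maximal_function u x}"
  have S: "S \<in> sets lebesgue" unfolding S_def
    using open_superlevel_maximal_function[of "ennreal a" u] by (simp add: borel_open)
  have "\<exists>r>0. ennreal (a * r ^ n) < (\<integral>\<^sup>+z\<in>cball x r. u z \<partial>lebesgue)" if x: "x \<in> S" for x
  proof -
    obtain r where r: "0 < r" and *: "ennreal a < ennreal (1 / r ^ n) * (\<integral>\<^sup>+z\<in>cball x r. u z \<partial>lebesgue)"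
      using x by (auto simp: S_def maximal_function_def less_SUP_iff n_def)
    have "ennreal (r ^ n) * ennreal a < ennreal (r ^ n) * (ennreal (1 / r ^ n) * (\<integral>\<^sup>+z\<in>cball x r. u z \<partial>lebesgue))"
      using r * by (intro ennreal_mult_strict_left_mono) auto
    also have "\<dots> = ennreal (r ^ n * (1 / r ^ n)) * (\<integral>\<^sup>+z\<in>cball x r. u z \<partial>lebesgue)"
      using r by (subst ennreal_mult) (auto simp: mult.assoc)
    also have "r ^ n * (1 / r ^ n) = 1" using r by simp
    finally show ?thesis using r a by (intro exI[of _ r]) (auto simp: ennreal_mult mult.commute)
  qed
  then obtain r where r: "\<And>x. x \<in> S \<Longrightarrow> 0 < r x"
    "\<And>x. x \<in> S \<Longrightarrow> ennreal (a * r x ^ n) < (\<integral>\<^sup>+z\<in>cball x (r x). u z \<partial>lebesgue)" by metis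
  have rB: "0 < r x \<and> r x \<le> max 1 (I / a)" if x: "x \<in> S" for x
  proof (cases "r x \<le> 1")
    case False
    have "ennreal (a * r x ^ n) \<le> (\<integral>\<^sup>+z\<in>cball x (r x). u z \<partial>lebesgue)"
      using r(2)[OF x] by simp
    also have "\<dots> \<le> (\<integral>\<^sup>+z. u z \<partial>lebesgue)"
      by (intro nn_integral_mono) (auto simp: indicator_def)
    finally have "a * r x ^ n \<le> I" using I by simp
    then have "r x ^ n \<le> I / a" using a by (simp add: field_simps)
    moreover have "r x ^ 1 \<le> r x ^ n" using False n by (intro power_increasing) auto
    ultimately show ?thesis using r(1)[OF x] by auto
  qed (use r(1)[OF x] in auto)
  have SU: "S \<subseteq> (\<Union>i\<in>S. cball i (r i))" using r(1) by force
  obtain C where C: "countable C" "C \<subseteq> S"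
    "pairwise (\<lambda>i j. disjnt (cball i (r i)) (cball j (r j))) C"
    "S \<subseteq> (\<Union>i\<in>C. cball i (5 * r i))"
    using Vitali_covering_lemma_cballs[OF SU rB] .
  \<comment> \<open>The selected balls are enumerated by natural numbers, with empty sets at the unused indices, so
    that countable additivity and subadditivity for sequences apply.\<close>
  define D where "D = to_nat_on C ` C"
  define e where "e = from_nat_into C"
  have e: "e i \<in> C" if "i \<in> D" for i using that C(1) by (auto simp: D_def e_def)
  have e_inj: "e i \<noteq> e j" if "i \<in> D" "j \<in> D" "i \<noteq> j" for i j
    using that C(1) by (auto simp: D_def e_def)
  define B where "B i = (if i \<in> D then cball (e i) (r (e i)) else {})" for i
  define B5 where "B5 i = (if i \<in> D then cball (e i) (5 * r (e i)) else {})" for i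
  have [measurable]: "B i \<in> sets lebesgue" "B5 i \<in> sets lebesgue" for i by (auto simp: B_def B5_def)
  have "S \<subseteq> (\<Union>i. B5 i)"
  proof
    fix x assume "x \<in> S"
    then obtain y where y: "y \<in> C" "x \<in> cball y (5 * r y)" using C(4) by blast
    then have "x \<in> B5 (to_nat_on C y)" using C(1) by (auto simp: B5_def D_def e_def)
    then show "x \<in> (\<Union>i. B5 i)" by blast
  qed
  then have "emeasure lebesgue S \<le> emeasure lebesgue (\<Union>i. B5 i)"
    by (intro emeasure_mono) auto
  also have "\<dots> \<le> (\<Sum>i. emeasure lebesgue (B5 i))"
    by (intro emeasure_subadditive_countably) auto
  finally have "ennreal a * emeasure lebesgue S \<le> ennreal a * (\<Sum>i. emeasure lebesgue (B5 i))"
    by (intro mult_left_mono) auto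
  also have "\<dots> = (\<Sum>i. ennreal a * emeasure lebesgue (B5 i))" by simp
  also have "\<dots> \<le> (\<Sum>i. ennreal (5 ^ n * v) * (\<integral>\<^sup>+z\<in>B i. u z \<partial>lebesgue))"
  proof (intro suminf_le summableI)
    fix i
    show "ennreal a * emeasure lebesgue (B5 i) \<le> ennreal (5 ^ n * v) * (\<integral>\<^sup>+z\<in>B i. u z \<partial>lebesgue)"
    proof (cases "i \<in> D")
      case True
      then have eS: "e i \<in> S" using e C by auto
      have "ennreal a * emeasure lebesgue (B5 i) = ennreal a * ennreal (v * (5 * r (e i)) ^ n)"
        using True r(1)[OF eS] by (simp add: B5_def emeasure_cball v_def n_def)
      also have "\<dots> = ennreal (5 ^ n * v) * ennreal (a * r (e i) ^ n)"
        using a v r(1)[OF eS] by (simp add: ennreal_mult[symmetric] power_mult_distrib mult_ac)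
      also have "\<dots> \<le> ennreal (5 ^ n * v) * (\<integral>\<^sup>+z\<in>B i. u z \<partial>lebesgue)"
        using True r(2)[OF eS] by (intro mult_left_mono) (auto simp: B_def)
      finally show ?thesis .
    qed (simp add: B5_def)
  qed
  also have "\<dots> = ennreal (5 ^ n * v) * (\<Sum>i. \<integral>\<^sup>+z\<in>B i. u z \<partial>lebesgue)" by simp
  also have "(\<Sum>i. \<integral>\<^sup>+z\<in>B i. u z \<partial>lebesgue) = (\<integral>\<^sup>+z\<in>(\<Union>i. B i). u z \<partial>lebesgue)"
  proof (rule nn_integral_disjoint_family[symmetric])
    show "disjoint_family B"
      using C(3) e e_inj by (fastforce simp: disjoint_family_on_def B_def pairwise_def disjnt_def)
  qed auto
  also have "ennreal (5 ^ n * v) * (\<integral>\<^sup>+z\<in>(\<Union>i. B i). u z \<partial>lebesgue) \<le> ennreal (5 ^ n * v) * (\<integral>\<^sup>+z. u z \<partial>lebesgue)"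
    by (intro mult_left_mono nn_integral_mono) (auto simp: indicator_def)
  finally show ?thesis by (simp add: S_def v_def n_def)
qed

text \<open>
  The part of u below the level s contributes at most s times the volume of the unit ball to each
  average.
\<close>

lemma maximal_function_le_truncated:
  fixes u :: "'a::euclidean_space \<Rightarrow> ennreal"
  assumes u[measurable]: "u \<in> borel_measurable lebesgue"
  shows "maximal_function u x \<le> ennreal (unit_ball_vol DIM('a)) * s + maximal_function (\<lambda>z. u z - s) x"
  unfolding maximal_function_def[of u]
proof (rule SUP_least)
  fix r :: real assume "r \<in> {0<..}"
  then have r: "0 < r" by simp
  define c where "c = ennreal (1 / r ^ DIM('a))"
  have "(\<integral>\<^sup>+z\<in>cball x r. u z \<partial>lebesgue)
      \<le> (\<integral>\<^sup>+z. s * indicator (cball x r) z + (u z - s) * indicator (cball x r) z \<partial>lebesgue)"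
    by (intro nn_integral_mono)
      (auto simp: indicator_def intro: ennreal_minus_le_iff[THEN iffD1, OF order_refl, THEN conjunct1])
  also have "\<dots> = s * emeasure lebesgue (cball x r) + (\<integral>\<^sup>+z\<in>cball x r. (u z - s) \<partial>lebesgue)"
    by (subst nn_integral_add) (auto simp: nn_integral_cmult_indicator)
  finally have "c * (\<integral>\<^sup>+z\<in>cball x r. u z \<partial>lebesgue)
      \<le> c * (s * emeasure lebesgue (cball x r) + (\<integral>\<^sup>+z\<in>cball x r. (u z - s) \<partial>lebesgue))"
    by (intro mult_left_mono) auto
  also have "\<dots> = (c * emeasure lebesgue (cball x r)) * s + c * (\<integral>\<^sup>+z\<in>cball x r. (u z - s) \<partial>lebesgue)"
    by (simp add: algebra_simps)
  also have "c * emeasure lebesgue (cball x r) = ennreal (unit_ball_vol DIM('a))"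
    using r by (simp add: c_def emeasure_cball ennreal_mult[symmetric])
  also have "c * (\<integral>\<^sup>+z\<in>cball x r. (u z - s) \<partial>lebesgue) \<le> maximal_function (\<lambda>z. u z - s) x"
    unfolding c_def by (rule maximal_function_upper[OF r])
  finally show "ennreal (1 / r ^ DIM('a)) * (\<integral>\<^sup>+z\<in>cball x r. u z \<partial>lebesgue)
      \<le> ennreal (unit_ball_vol DIM('a)) * s + maximal_function (\<lambda>z. u z - s) x"
    by (simp add: c_def add_left_mono)
qed

lemma maximal_function_AE_0:
  fixes u :: "'a::euclidean_space \<Rightarrow> ennreal"
  assumes [measurable]: "u \<in> borel_measurable lebesgue" and "AE x in lebesgue. u x = 0"
  shows "maximal_function u x = 0"
proof -
  have "(\<integral>\<^sup>+z\<in>cball x r. u z \<partial>lebesgue) = 0" for r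
    using assms(2) by (subst nn_integral_0_iff_AE) (measurable, auto elim: eventually_mono)
  then show ?thesis by (simp add: maximal_function_def)
qed

section \<open>Boundedness of the maximal operator\<close>

text \<open>
  For decreasing r this dominates the average of r over the interval (0, t), as one sees by
  cutting the interval at the points t / N^k. It replaces that average because its norm can be estimated term by term.
\<close>

definition dilation_average :: "real \<Rightarrow> (real \<Rightarrow> ennreal) \<Rightarrow> real \<Rightarrow> ennreal" where
  "dilation_average N r t = (\<Sum>k. ennreal (1 / N ^ k) * r (t / N ^ Suc k))"

lemma dilation_average_measurable:
  assumes "r \<in> borel_measurable half_line" "0 < N"
  shows "dilation_average N r \<in> borel_measurable half_line"
proof -
  have [measurable]: "(\<lambda>t. r (t / N ^ Suc k)) \<in> borel_measurable half_line" for k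
    using assms by (intro dilation_measurable) auto
  show ?thesis unfolding dilation_average_def[abs_def] by measurable
qed

text \<open>
  Cut the set where u exceeds u*(t) along the levels u*(t / N^k). The k-th level set has measure
  at most t / N^k, and outside the next one u is at most u*(t / N^(k+1)). The intersection of all level
  sets is a null set. The assumption that u*(t) is finite matters for the subtraction: \<infinity> - \<infinity> is \<infinity> in the
  extended nonnegative reals.
\<close>

lemma nn_integral_truncated_le_dilation_average:
  fixes u :: "'a \<Rightarrow> ennreal"
  assumes u[measurable]: "u \<in> borel_measurable M" and N: "1 < N" and t: "0 < t"
  defines "r \<equiv> decreasing_rearrangement M u"
  assumes fin: "r t < \<infinity>"
  shows "(\<integral>\<^sup>+x. (u x - r t) \<partial>M) \<le> ennreal t * dilation_average N r t"
proof -
  define E where "E k = {x \<in> space M. r (t / N ^ k) < u x}" for k :: nat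
  have [measurable]: "E k \<in> sets M" for k unfolding E_def by measurable
  have E_le: "emeasure M (E k) \<le> ennreal (t / N ^ k)" for k
  proof -
    have "\<not> r (t / N ^ k) < decreasing_rearrangement M u (t / N ^ k)" by (simp add: r_def)
    then show ?thesis
      unfolding less_decreasing_rearrangement_iff[OF u] by (simp add: E_def distribution_function_def)
  qed
  have "(\<lambda>k. ennreal (t / N ^ k)) \<longlonglongrightarrow> ennreal 0"
    using N by (intro tendsto_ennrealI LIMSEQ_divide_realpow_zero)
  moreover have "emeasure M (\<Inter>k. E k) \<le> ennreal (t / N ^ k)" for k
    by (rule order_trans[OF emeasure_mono E_le[of k]]) auto
  ultimately have "emeasure M (\<Inter>k. E k) \<le> 0"
    using LIMSEQ_le_const[of _ "ennreal 0" "emeasure M (\<Inter>k. E k)"] by auto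
  then have "(\<Inter>k. E k) \<in> null_sets M" by (intro null_setsI) auto
  then have "AE x in M. x \<notin> (\<Inter>k. E k)" by (rule AE_not_in)
  then have "AE x in M. u x - r t \<le> (\<Sum>k. r (t / N ^ Suc k) * indicator (E k) x)"
  proof (rule AE_mp, intro AE_I2 impI)
    fix x assume x: "x \<in> space M" "x \<notin> (\<Inter>k. E k)"
    show "u x - r t \<le> (\<Sum>k. r (t / N ^ Suc k) * indicator (E k) x)"
    proof (cases "x \<in> E 0")
      case False
      then have "u x \<le> r t" using x by (simp add: E_def)
      then have "u x - r t = 0" using fin by (intro diff_eq_0_ennreal) auto
      then show ?thesis by simp
    next
      case True
      obtain k where "x \<notin> E k" using x by auto
      then have "\<exists>j. x \<in> E j \<and> x \<notin> E (Suc j)" using True by (induction k) auto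
      then obtain j where j: "x \<in> E j" "x \<notin> E (Suc j)" by blast
      have "u x - r t \<le> u x" by (rule diff_le_self_ennreal)
      also have "\<dots> \<le> r (t / N ^ Suc j) * indicator (E j) x"
        using j x by (simp add: E_def)
      \<comment> \<open>The single summand with index j already dominates u x.\<close>
      also have "\<dots> = (\<Sum>k\<in>{j}. r (t / N ^ Suc k) * indicator (E k) x)"
        by (subst sum.insert) (simp_all only: finite.emptyI empty_iff not_False_eq_True sum.empty add_0_right)
      also have "\<dots> \<le> (\<Sum>k. r (t / N ^ Suc k) * indicator (E k) x)"
        by (intro sum_le_suminf) auto
      finally show ?thesis .
    qed
  qed
  then have "(\<integral>\<^sup>+x. (u x - r t) \<partial>M) \<le> (\<integral>\<^sup>+x. (\<Sum>k. r (t / N ^ Suc k) * indicator (E k) x) \<partial>M)"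
    by (rule nn_integral_mono_AE)
  also have "\<dots> = (\<Sum>k. r (t / N ^ Suc k) * emeasure M (E k))"
    by (subst nn_integral_suminf) (auto simp: nn_integral_cmult_indicator)
  also have "\<dots> \<le> (\<Sum>k. ennreal t * (ennreal (1 / N ^ k) * r (t / N ^ Suc k)))"
  proof (intro suminf_le summableI)
    fix k
    have "r (t / N ^ Suc k) * emeasure M (E k) \<le> r (t / N ^ Suc k) * ennreal (t * (1 / N ^ k))"
      using E_le[of k] by (intro mult_left_mono) auto
    also have "\<dots> = ennreal t * (ennreal (1 / N ^ k) * r (t / N ^ Suc k))"
      using t N by (subst ennreal_mult) (auto simp: mult_ac)
    finally show "r (t / N ^ Suc k) * emeasure M (E k) \<le> ennreal t * (ennreal (1 / N ^ k) * r (t / N ^ Suc k))" .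
  qed
  also have "\<dots> = ennreal t * dilation_average N r t"
    unfolding dilation_average_def by (rule ennreal_suminf_cmult)
  finally show ?thesis .
qed

text \<open>
  Apply the weak type estimate to the part of u above the level u*(t), whose integral is at most
  t times the dilation average; the part below the level is bounded by u*(t), which is itself below the
  dilation average.
\<close>

lemma rearrangement_maximal_function_le:
  fixes u :: "'a::euclidean_space \<Rightarrow> ennreal"
  assumes u[measurable]: "u \<in> borel_measurable lebesgue" and N: "1 < N" and t: "0 < t"
  defines "r \<equiv> decreasing_rearrangement lebesgue u"
  shows "decreasing_rearrangement lebesgue (maximal_function u) t
    \<le> ennreal ((1 + 5 ^ DIM('a)) * unit_ball_vol DIM('a)) * dilation_average N r t"
proof -
  define v where "v = unit_ball_vol DIM('a)"
  have v: "0 < v" by (simp add: v_def)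
  define C where "C = 5 ^ DIM('a) * v"
  have C: "0 < C" using v by (simp add: C_def)
  define \<Phi> where "\<Phi> = dilation_average N r t"
  have Ceq: "(1 + 5 ^ DIM('a)) * unit_ball_vol DIM('a) = v + C" by (simp add: C_def v_def algebra_simps)
  have "distribution_function lebesgue (maximal_function u) (ennreal (v + C) * \<Phi>) \<le> ennreal t"
  proof (cases \<Phi>)
    case top
    then show ?thesis using v C by (simp add: ennreal_mult_top distribution_function_def)
  next
    case (real p)
    \<comment> \<open>The summand with index 0 of the dilation average is the value at t / N.\<close>
    have r\<Phi>: "r t \<le> \<Phi>"
    proof -
      have "r t \<le> r (t / N)"
        using t N unfolding r_def by (intro decreasing_rearrangement_antimono) (simp add: field_simps)
      also have "\<dots> = (\<Sum>k\<in>{0}. ennreal (1 / N ^ k) * r (t / N ^ Suc k))" by simp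
      also have "\<dots> \<le> \<Phi>" unfolding \<Phi>_def dilation_average_def
        by (intro sum_le_suminf) auto
      finally show ?thesis .
    qed
    let ?w = "\<lambda>x. u x - r t"
    have w[measurable]: "?w \<in> borel_measurable lebesgue" by measurable
    have int: "(\<integral>\<^sup>+x. ?w x \<partial>lebesgue) \<le> ennreal t * \<Phi>"
      unfolding \<Phi>_def r_def
      using r\<Phi> real by (intro nn_integral_truncated_le_dilation_average[OF u N t])
        (auto simp: r_def intro: le_less_trans)
    have sub: "ennreal (C * p) < maximal_function ?w x" if "ennreal (v + C) * \<Phi> < maximal_function u x" for x
    proof -
      have "ennreal (v * p) + ennreal (C * p) = ennreal (v + C) * \<Phi>"
        using v C real by (simp add: ennreal_plus[symmetric] ennreal_mult[symmetric] algebra_simps del: ennreal_plus)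
      also have "\<dots> < maximal_function u x" by fact
      also have "\<dots> \<le> ennreal v * r t + maximal_function ?w x"
        unfolding v_def by (rule maximal_function_le_truncated[OF u])
      also have "\<dots> \<le> ennreal v * \<Phi> + maximal_function ?w x"
        using r\<Phi> by (intro add_right_mono mult_left_mono) auto
      also have "ennreal v * \<Phi> = ennreal (v * p)" using v real by (simp add: ennreal_mult)
      finally show ?thesis by (simp add: ennreal_add_left_cancel_less)
    qed
    show ?thesis
    proof (cases "p = 0")
      case True
      then have "(\<integral>\<^sup>+x. ?w x \<partial>lebesgue) = 0" using int real by simp
      then have "AE x in lebesgue. ?w x = 0" by (subst (asm) nn_integral_0_iff_AE) auto
      then have "maximal_function ?w x = 0" for x by (intro maximal_function_AE_0 w)
      then have "{x \<in> space lebesgue. ennreal (v + C) * \<Phi> < maximal_function u x} = {}"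
        using sub by auto
      then show ?thesis by (simp only: distribution_function_def emeasure_empty zero_le)
    next
      case False
      then have p: "0 < p" using real by simp
      let ?d = "distribution_function lebesgue (maximal_function u) (ennreal (v + C) * \<Phi>)"
      have "open {x. ennreal (C * p) < maximal_function ?w x}" by (rule open_superlevel_maximal_function)
      then have "?d \<le> emeasure lebesgue {x. ennreal (C * p) < maximal_function ?w x}"
        unfolding distribution_function_def using sub
        by (intro emeasure_mono) (auto simp: borel_open)
      then have "ennreal (C * p) * ?d \<le> ennreal (C * p) * emeasure lebesgue {x. ennreal (C * p) < maximal_function ?w x}"
        by (intro mult_left_mono) auto
      also have "\<dots> \<le> ennreal C * (\<integral>\<^sup>+x. ?w x \<partial>lebesgue)"
        unfolding C_def v_def using C p 
        by (intro maximal_function_weak_type w) (auto simp: C_def v_def)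
      also have "\<dots> \<le> ennreal C * (ennreal t * ennreal p)"
        using int real by (intro mult_left_mono) auto
      also have "\<dots> = ennreal (C * p) * ennreal t"
        using C p t by (simp add: ennreal_mult mult_ac)
      finally show ?thesis
        using C p by (subst (asm) ennreal_mult_le_mult_iff) auto
    qed
  qed
  then show ?thesis
    unfolding decreasing_rearrangement_def[of _ "maximal_function u"] Ceq \<Phi>_def
    by (intro Inf_lower) simp
qed

context luxemburg_pair
begin

lemma dilation_iterate:
  assumes r: "r \<in> borel_measurable half_line" and fin: "\<rho>' r < \<infinity>" and N: "0 < N"
    and h: "dilation_norm \<rho>' N \<le> ennreal \<eta>"
  shows "\<rho>' (\<lambda>s. r (s / N ^ k)) \<le> ennreal \<eta> ^ k * \<rho>' r"
proof (induction k)
  case (Suc k)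
  have "\<rho>' (\<lambda>s. r (s / N ^ Suc k)) = \<rho>' (\<lambda>s. (\<lambda>s. r (s / N ^ k)) (s / N))"
    by (simp add: field_simps)
  also have "\<dots> \<le> dilation_norm \<rho>' N * \<rho>' (\<lambda>s. r (s / N ^ k))"
  proof (intro half.dilation_le_dilation_norm dilation_measurable r)
    have "ennreal \<eta> ^ k * \<rho>' r < \<infinity>"
      using fin by (simp add: ennreal_mult_less_top power_less_top_ennreal)
    with Suc show "\<rho>' (\<lambda>s. r (s / N ^ k)) < \<infinity>" by (rule le_less_trans)
  qed (use N in auto)
  also have "\<dots> \<le> ennreal \<eta> * (ennreal \<eta> ^ k * \<rho>' r)"
    by (intro mult_mono Suc h) auto
  finally show ?case by (simp add: mult_ac)
qed simp

text \<open>
  The norms of the summands of the dilation average form a geometric series with ratio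
  h(N) / N < 1.
\<close>

lemma maximal_function_bounded:
  assumes N: "1 < N" "dilation_norm \<rho>' N < ennreal N"
    and u: "u \<in> borel_measurable lebesgue" and fin: "\<rho> u < \<infinity>"
  shows "\<rho> (maximal_function u) < \<infinity>"
proof -
  let ?r = "decreasing_rearrangement lebesgue u"
  have r: "?r \<in> borel_measurable half_line" by (rule decreasing_rearrangement_measurable[OF u])
  define C where "C = (1 + 5 ^ DIM('a)) * unit_ball_vol DIM('a)"
  have C: "0 \<le> C" by (simp add: C_def)
  define \<eta> where "\<eta> = enn2real (dilation_norm \<rho>' N)"
  have fin': "dilation_norm \<rho>' N < \<infinity>" using N(2) by (rule less_trans) simp
  have \<eta>: "0 \<le> \<eta>" "dilation_norm \<rho>' N = ennreal \<eta>" using fin' by (auto simp: \<eta>_def)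
  have \<eta>N: "\<eta> < N" using N \<eta> by (simp add: ennreal_less_iff)
  obtain R where R: "0 \<le> R" "\<rho>' ?r = ennreal R"
    using fin rearrange[OF u] by (cases "\<rho>' ?r") auto
  have m: "(\<lambda>t. ?r (t / N ^ Suc k)) \<in> borel_measurable half_line" for k
    using N by (intro dilation_measurable r) auto
  have "\<rho> (maximal_function u) = \<rho>' (decreasing_rearrangement lebesgue (maximal_function u))"
    by (intro rearrange) measurable
  also have "\<dots> \<le> \<rho>' (\<lambda>t. ennreal C * dilation_average N ?r t)"
  proof (intro half.mono decreasing_rearrangement_measurable AE_I2)
    show "(\<lambda>t. ennreal C * dilation_average N ?r t) \<in> borel_measurable half_line"
    proof -
      have [measurable]: "dilation_average N ?r \<in> borel_measurable half_line"
        using N by (intro dilation_average_measurable r) auto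
      show ?thesis by measurable
    qed
    show "decreasing_rearrangement lebesgue (maximal_function u) t \<le> ennreal C * dilation_average N ?r t"
      if "t \<in> space half_line" for t
      unfolding C_def using that by (intro rearrangement_maximal_function_le u N) (simp add: space_half_line)
  qed measurable
  also have "\<dots> = ennreal C * \<rho>' (dilation_average N ?r)"
    using C N by (intro half.cmult dilation_average_measurable r) auto
  finally have le: "\<rho> (maximal_function u) \<le> ennreal C * \<rho>' (dilation_average N ?r)" .
  have "\<rho>' (dilation_average N ?r) \<le> (\<Sum>k. \<rho>' (\<lambda>t. ennreal (1 / N ^ k) * ?r (t / N ^ Suc k)))"
    unfolding dilation_average_def[abs_def] using m
    by (intro half.countably_subadditive) measurable
  also have "\<dots> \<le> (\<Sum>k. ennreal (\<eta> * R * (\<eta> / N) ^ k))"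
  proof (intro suminf_le summableI)
    fix k
    have "\<rho>' (\<lambda>t. ennreal (1 / N ^ k) * ?r (t / N ^ Suc k)) = ennreal (1 / N ^ k) * \<rho>' (\<lambda>t. ?r (t / N ^ Suc k))"
      using N by (intro half.cmult m) auto
    also have "\<dots> \<le> ennreal (1 / N ^ k) * (ennreal \<eta> ^ Suc k * \<rho>' ?r)"
      using N R \<eta> by (intro mult_left_mono dilation_iterate r) auto
    also have "\<dots> = ennreal (1 / N ^ k * (\<eta> ^ Suc k * R))"
      using N R \<eta> by (simp add: ennreal_power flip: ennreal_mult)
    also have "1 / N ^ k * (\<eta> ^ Suc k * R) = \<eta> * R * (\<eta> / N) ^ k"
      by (simp add: power_divide)
    finally show "\<rho>' (\<lambda>t. ennreal (1 / N ^ k) * ?r (t / N ^ Suc k)) \<le> ennreal (\<eta> * R * (\<eta> / N) ^ k)" .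
  qed
  also have "\<dots> < \<infinity>"
  proof -
    have "summable (\<lambda>k. \<eta> * R * (\<eta> / N) ^ k)"
      using N \<eta> \<eta>N by (intro summable_mult summable_geometric) auto
    then show ?thesis
      using N \<eta> R by (subst suminf_ennreal2) auto
  qed
  finally have "ennreal C * \<rho>' (dilation_average N ?r) < \<infinity>"
    by (simp add: ennreal_mult_less_top)
  with le show ?thesis by (rule le_less_trans)
qed

end

section \<open>Lebesgue points\<close>

lemma borel_measurable_lebesgue_continuous:
  "continuous_on UNIV g \<Longrightarrow> g \<in> borel_measurable lebesgue"
  by (rule measurable_completion) (simp add: borel_measurable_continuous_onI)

text \<open>
  Truncate f, and approximate the truncation almost everywhere by continuous functions truncated at the
  same level; on a set of finite measure dominated convergence applies twice.
\<close>

lemma continuous_approximation_L1: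
  fixes f :: "'a::euclidean_space \<Rightarrow> real"
  assumes f[measurable]: "f \<in> borel_measurable lebesgue" and B[measurable]: "B \<in> sets lebesgue"
    and finB: "emeasure lebesgue B < \<infinity>"
    and int: "(\<integral>\<^sup>+x\<in>B. ennreal \<bar>f x\<bar> \<partial>lebesgue) < \<infinity>" and \<epsilon>: "0 < \<epsilon>"
  obtains g where "continuous_on UNIV g" "(\<integral>\<^sup>+x\<in>B. ennreal \<bar>f x - g x\<bar> \<partial>lebesgue) < ennreal \<epsilon>"
proof -
  define T where "T K y = max (- K) (min K y)" for K y :: real
  have T_meas[measurable]: "T K \<in> borel_measurable borel" for K unfolding T_def by measurable
  have T_le: "\<bar>T K y - T K z\<bar> \<le> 2 * K" if "0 \<le> K" for K y z using that by (auto simp: T_def)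
  have "(\<lambda>K. \<integral>\<^sup>+x. ennreal \<bar>f x - T (real K) (f x)\<bar> * indicator B x \<partial>lebesgue) \<longlonglongrightarrow> (\<integral>\<^sup>+x. 0 \<partial>(lebesgue::'a measure))"
  proof (rule nn_integral_dominated_convergence[where w="\<lambda>x. ennreal \<bar>f x\<bar> * indicator B x"])
    show "AE x in lebesgue. ennreal \<bar>f x - T (real K) (f x)\<bar> * indicator B x \<le> ennreal \<bar>f x\<bar> * indicator B x" for K
      by (intro AE_I2 mult_right_mono ennreal_leI) (auto simp: T_def)
    show "AE x in lebesgue. (\<lambda>K. ennreal \<bar>f x - T (real K) (f x)\<bar> * indicator B x) \<longlonglongrightarrow> 0"
    proof (rule AE_I2)
      fix x
      obtain n :: nat where n: "\<bar>f x\<bar> \<le> real n" using real_arch_simple by blast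
      have "f x - T (real K) (f x) = 0" if "n \<le> K" for K
      proof -
        have "\<bar>f x\<bar> \<le> real K" using n that by linarith
        then show ?thesis by (auto simp: T_def)
      qed
      then have "\<forall>\<^sub>F K in sequentially. ennreal \<bar>f x - T (real K) (f x)\<bar> * indicator B x = 0"
        by (intro eventually_sequentiallyI[of n]) simp
      then show "(\<lambda>K. ennreal \<bar>f x - T (real K) (f x)\<bar> * indicator B x) \<longlonglongrightarrow> 0"
        by (rule tendsto_eventually)
    qed
  qed (use int in auto)
  then have "\<forall>\<^sub>F K in sequentially. (\<integral>\<^sup>+x. ennreal \<bar>f x - T (real K) (f x)\<bar> * indicator B x \<partial>lebesgue) < ennreal (\<epsilon> / 2)"
    using \<epsilon> by (intro order_tendstoD(2)[where y=0]) auto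
  then obtain K :: nat where K: "(\<integral>\<^sup>+x. ennreal \<bar>f x - T (real K) (f x)\<bar> * indicator B x \<partial>lebesgue) < ennreal (\<epsilon> / 2)"
    by (meson eventually_sequentially order_refl)
  have "f measurable_on UNIV" by (rule lebesgue_measurable_imp_measurable_on) auto
  then obtain N g where N: "negligible N" and g: "\<And>n. continuous_on UNIV (g n)"
    and lim: "\<And>x. x \<notin> N \<Longrightarrow> (\<lambda>n. g n x) \<longlonglongrightarrow> f x"
    unfolding measurable_on_def by (simp only: UNIV_I if_True) metis
  have gT: "continuous_on UNIV (\<lambda>x. T (real K) (g n x))" for n
    unfolding T_def by (intro continuous_intros g)
  have [measurable]: "(\<lambda>x. T (real K) (g n x)) \<in> borel_measurable lebesgue" for n
    by (rule borel_measurable_lebesgue_continuous[OF gT])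
  have "(\<lambda>n. \<integral>\<^sup>+x. ennreal \<bar>T (real K) (f x) - T (real K) (g n x)\<bar> * indicator B x \<partial>lebesgue) \<longlonglongrightarrow> (\<integral>\<^sup>+x. 0 \<partial>(lebesgue::'a measure))"
  proof (rule nn_integral_dominated_convergence[where w="\<lambda>x. ennreal (2 * K) * indicator B x"])
    show "AE x in lebesgue. ennreal \<bar>T (real K) (f x) - T (real K) (g n x)\<bar> * indicator B x \<le> ennreal (2 * K) * indicator B x" for n
      by (intro AE_I2 mult_right_mono ennreal_leI) (simp_all add: T_le)
    show "(\<integral>\<^sup>+x. ennreal (2 * K) * indicator B x \<partial>lebesgue) < \<infinity>"
      using finB by (subst nn_integral_cmult_indicator) (auto simp: ennreal_mult_less_top)
    have "AE x in lebesgue. x \<notin> N" using N by (intro AE_not_in) (simp add: negligible_iff_null_sets)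
    then show "AE x in lebesgue. (\<lambda>n. ennreal \<bar>T (real K) (f x) - T (real K) (g n x)\<bar> * indicator B x) \<longlonglongrightarrow> 0"
    proof eventually_elim
      case (elim x)
      have "(\<lambda>n. ennreal \<bar>T (real K) (f x) - T (real K) (g n x)\<bar> * indicator B x) \<longlonglongrightarrow>
        ennreal \<bar>T (real K) (f x) - T (real K) (f x)\<bar> * indicator B x"
        unfolding T_def using lim[OF elim]
        by (intro tendsto_mult_ennreal tendsto_ennrealI tendsto_intros) (auto simp: indicator_def)
      then show ?case by simp
    qed
  qed measurable
  then have "\<forall>\<^sub>F n in sequentially. (\<integral>\<^sup>+x. ennreal \<bar>T (real K) (f x) - T (real K) (g n x)\<bar> * indicator B x \<partial>lebesgue) < ennreal (\<epsilon> / 2)"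
    using \<epsilon> by (intro order_tendstoD(2)[where y=0]) auto
  then obtain n where n: "(\<integral>\<^sup>+x. ennreal \<bar>T (real K) (f x) - T (real K) (g n x)\<bar> * indicator B x \<partial>lebesgue) < ennreal (\<epsilon> / 2)"
    by (meson eventually_sequentially order_refl)
  have "(\<integral>\<^sup>+x\<in>B. ennreal \<bar>f x - T (real K) (g n x)\<bar> \<partial>lebesgue)
    \<le> (\<integral>\<^sup>+x. ennreal \<bar>f x - T (real K) (f x)\<bar> * indicator B x + ennreal \<bar>T (real K) (f x) - T (real K) (g n x)\<bar> * indicator B x \<partial>lebesgue)"
    by (intro nn_integral_mono)
      (auto simp: indicator_def ennreal_plus[symmetric] simp del: ennreal_plus intro!: ennreal_leI)
  also have "\<dots> = (\<integral>\<^sup>+x. ennreal \<bar>f x - T (real K) (f x)\<bar> * indicator B x \<partial>lebesgue)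
    + (\<integral>\<^sup>+x. ennreal \<bar>T (real K) (f x) - T (real K) (g n x)\<bar> * indicator B x \<partial>lebesgue)"
    by (rule nn_integral_add) measurable
  also have "\<dots> < ennreal (\<epsilon> / 2) + ennreal (\<epsilon> / 2)"
    using K n by (rule add_strict_mono)
  also have "\<dots> = ennreal \<epsilon>" using \<epsilon> by (simp add: ennreal_plus[symmetric] del: ennreal_plus)
  finally show thesis using gT that by blast
qed

text \<open>
  Its convergence to 0 as r tends to 0 says that x is a Lebesgue point of f.
\<close>

definition mean_oscillation :: "('a::euclidean_space \<Rightarrow> real) \<Rightarrow> 'a \<Rightarrow> real \<Rightarrow> ennreal" where
  "mean_oscillation f x r = ennreal (1 / r ^ DIM('a)) * (\<integral>\<^sup>+z\<in>cball x r. ennreal \<bar>f z - f x\<bar> \<partial>lebesgue)"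

text \<open>
  Split f z - f x into (f - g) z, (g z - g x) and (g - f) x. The three averages are controlled by the
  maximal function, by the continuity of g, and by the value at x.
\<close>

lemma mean_oscillation_eventually_le:
  fixes f g :: "'a::euclidean_space \<Rightarrow> real"
  assumes f[measurable]: "f \<in> borel_measurable lebesgue" and g: "continuous_on UNIV g"
    and B[measurable]: "B \<in> sets lebesgue"
    and x: "x \<in> interior B" and a: "0 < a"
  defines "v \<equiv> \<lambda>z. ennreal \<bar>f z - g z\<bar> * indicator B z"
  assumes M: "maximal_function v x \<le> ennreal a" and vx: "ennreal (unit_ball_vol DIM('a)) * v x \<le> ennreal a"
  shows "\<forall>\<^sub>F r in at_right 0. mean_oscillation f x r \<le> ennreal (3 * a)"
proof -
  define V where "V = unit_ball_vol DIM('a)"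
  have V: "0 < V" by (simp add: V_def)
  obtain d where d: "0 < d" "cball x d \<subseteq> B" using x unfolding mem_interior_cball by blast
  have "isCont g x" using g by (simp add: continuous_on_eq_continuous_at)
  then obtain e where e: "0 < e" "\<And>z. dist z x < e \<Longrightarrow> dist (g z) (g x) < a / V"
    using a V unfolding continuous_at_eps_delta by (metis divide_pos_pos)
  have gm[measurable]: "g \<in> borel_measurable lebesgue"
    by (rule borel_measurable_lebesgue_continuous[OF g])
  have vm[measurable]: "v \<in> borel_measurable lebesgue" unfolding v_def by measurable
  have "\<forall>\<^sub>F r in at_right 0. 0 < r \<and> r < min d e"
    using d e unfolding eventually_at_right_field by (intro exI[of _ "min d e"]) auto
  then show ?thesis
  proof eventually_elim
    case (elim r)
    have xB: "x \<in> B" using d by (meson centre_in_cball less_imp_le subsetD)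
    define c where "c = ennreal (1 / r ^ DIM('a))"
    have cE: "c * emeasure lebesgue (cball x r) = ennreal V"
      using elim by (simp add: c_def V_def emeasure_cball ennreal_mult[symmetric])
    have "(\<integral>\<^sup>+z\<in>cball x r. ennreal \<bar>f z - f x\<bar> \<partial>lebesgue)
      \<le> (\<integral>\<^sup>+z. v z * indicator (cball x r) z + (ennreal (a / V) + v x) * indicator (cball x r) z \<partial>lebesgue)"
    proof (rule nn_integral_mono)
      fix z
      show "ennreal \<bar>f z - f x\<bar> * indicator (cball x r) z
        \<le> v z * indicator (cball x r) z + (ennreal (a / V) + v x) * indicator (cball x r) z"
      proof (cases "z \<in> cball x r")
        case True
        then have zB: "z \<in> B" using d elim by (meson less_imp_le min_less_iff_conj subset_cball subsetD)
        have "\<bar>g z - g x\<bar> < a / V"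
          using e(2)[of z] True elim by (auto simp: dist_real_def dist_commute)
        then have "\<bar>f z - f x\<bar> \<le> \<bar>f z - g z\<bar> + (a / V + \<bar>f x - g x\<bar>)" by linarith
        then have "ennreal \<bar>f z - f x\<bar> \<le> ennreal (\<bar>f z - g z\<bar> + (a / V + \<bar>f x - g x\<bar>))"
          by (rule ennreal_leI)
        also have "\<dots> = v z + (ennreal (a / V) + v x)"
          using a V zB xB by (simp add: v_def)
        finally show ?thesis using True by simp
      qed simp
    qed
    also have "\<dots> = (\<integral>\<^sup>+z\<in>cball x r. v z \<partial>lebesgue) + (ennreal (a / V) + v x) * emeasure lebesgue (cball x r)"
      by (subst nn_integral_add) (measurable, simp add: nn_integral_cmult_indicator)
    finally have "mean_oscillation f x r \<le> c * ((\<integral>\<^sup>+z\<in>cball x r. v z \<partial>lebesgue) + (ennreal (a / V) + v x) * emeasure lebesgue (cball x r))"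
      unfolding mean_oscillation_def c_def by (intro mult_left_mono) auto
    also have "\<dots> = c * (\<integral>\<^sup>+z\<in>cball x r. v z \<partial>lebesgue) + (ennreal (a / V) + v x) * (c * emeasure lebesgue (cball x r))"
      by (simp only: distrib_left mult.left_commute)
    also have "\<dots> \<le> ennreal a + (ennreal a + ennreal a)"
    proof (intro add_mono)
      show "c * (\<integral>\<^sup>+z\<in>cball x r. v z \<partial>lebesgue) \<le> ennreal a"
        using maximal_function_upper[where r=r and x=x and u=v] M elim unfolding c_def by auto
      have "(ennreal (a / V) + v x) * ennreal V = ennreal (a / V) * ennreal V + ennreal V * v x"
        by (simp add: distrib_left mult.commute)
      also have "ennreal (a / V) * ennreal V = ennreal a"
        using a V by (simp flip: ennreal_mult)
      also have "ennreal a + ennreal V * v x \<le> ennreal a + ennreal a"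
        using vx by (intro add_left_mono) (simp add: V_def)
      finally show "(ennreal (a / V) + v x) * (c * emeasure lebesgue (cball x r)) \<le> ennreal a + ennreal a"
        unfolding cE .
    qed
    also have "\<dots> = ennreal (3 * a)" using a by (simp flip: ennreal_plus)
    finally show ?case .
  qed
qed

text \<open>
  The exceptional set lies in the union of two superlevel sets of the error f - g of a continuous
  approximation, whose measure is at most a constant times the L1 norm of the error, by the weak type
  estimate and by Markov's inequality.
\<close>

lemma AE_mean_oscillation_le:
  fixes f :: "'a::euclidean_space \<Rightarrow> real"
  assumes f[measurable]: "f \<in> borel_measurable lebesgue" and B[measurable]: "B \<in> sets lebesgue"
    and finB: "emeasure lebesgue B < \<infinity>"
    and int: "(\<integral>\<^sup>+x\<in>B. ennreal \<bar>f x\<bar> \<partial>lebesgue) < \<infinity>" and a: "0 < a"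
  shows "AE x in lebesgue. x \<in> interior B \<longrightarrow> (\<forall>\<^sub>F r in at_right 0. mean_oscillation f x r \<le> ennreal (3 * a))"
proof -
  define V where "V = unit_ball_vol DIM('a)"
  have V: "0 < V" by (simp add: V_def)
  define C where "C = 5 ^ DIM('a) * V"
  have C: "0 < C" using V by (simp add: C_def)
  define S where "S = {x. \<not> (x \<in> interior B \<longrightarrow> (\<forall>\<^sub>F r in at_right 0. mean_oscillation f x r \<le> ennreal (3 * a)))}"
  have "negligible S"
    unfolding negligible_outer_le
  proof (intro allI impI)
    fix \<epsilon> :: real assume \<epsilon>: "0 < \<epsilon>"
    \<comment> \<open>The superlevel sets will have measure at most C \<delta> / a and V \<delta> / a.\<close>
    define \<delta> where "\<delta> = \<epsilon> * a / (C + V)"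
    have \<delta>: "0 < \<delta>" using \<epsilon> a C V by (simp add: \<delta>_def)
    obtain g where g: "continuous_on UNIV g" "(\<integral>\<^sup>+x\<in>B. ennreal \<bar>f x - g x\<bar> \<partial>lebesgue) < ennreal \<delta>"
      using continuous_approximation_L1[OF f B finB int \<delta>] .
    define v where "v = (\<lambda>z. ennreal \<bar>f z - g z\<bar> * indicator B z)"
    have gm[measurable]: "g \<in> borel_measurable lebesgue"
      by (rule borel_measurable_lebesgue_continuous[OF g(1)])
    have vm[measurable]: "v \<in> borel_measurable lebesgue" unfolding v_def by measurable
    have vint: "(\<integral>\<^sup>+x. v x \<partial>lebesgue) \<le> ennreal \<delta>" using g(2) by (simp add: v_def)
    define T1 where "T1 = {x. ennreal a < maximal_function v x}"
    define T2 where "T2 = {x \<in> space lebesgue. ennreal a \<le> ennreal V * v x}"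
    have [measurable]: "T1 \<in> sets lebesgue"
      unfolding T1_def
      by (intro sets_completionI_sets) (simp add: borel_open open_superlevel_maximal_function)
    have [measurable]: "T2 \<in> sets lebesgue" unfolding T2_def by measurable
    have "ennreal a * emeasure lebesgue T1 \<le> ennreal C * (\<integral>\<^sup>+x. v x \<partial>lebesgue)"
      unfolding T1_def C_def V_def by (rule maximal_function_weak_type[OF vm a])
    also have "\<dots> \<le> ennreal C * ennreal \<delta>" by (intro mult_left_mono vint) auto
    finally have T1: "ennreal a * emeasure lebesgue T1 \<le> ennreal (C * \<delta>)"
      using C \<delta> by (simp add: ennreal_mult)
    have "ennreal a * emeasure lebesgue T2 = (\<integral>\<^sup>+x. ennreal a * indicator T2 x \<partial>lebesgue)"
      by (simp add: nn_integral_cmult_indicator)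
    also have "\<dots> \<le> (\<integral>\<^sup>+x. ennreal V * v x \<partial>lebesgue)"
      by (intro nn_integral_mono) (auto simp: indicator_def T2_def)
    also have "\<dots> = ennreal V * (\<integral>\<^sup>+x. v x \<partial>lebesgue)" by (rule nn_integral_cmult) measurable
    also have "\<dots> \<le> ennreal V * ennreal \<delta>" by (intro mult_left_mono vint) auto
    finally have T2: "ennreal a * emeasure lebesgue T2 \<le> ennreal (V * \<delta>)"
      using V \<delta> by (simp add: ennreal_mult)
    have "ennreal a * emeasure lebesgue (T1 \<union> T2) \<le> ennreal a * (emeasure lebesgue T1 + emeasure lebesgue T2)"
      by (intro mult_left_mono emeasure_subadditive) auto
    also have "\<dots> \<le> ennreal (C * \<delta>) + ennreal (V * \<delta>)"
      unfolding distrib_left by (intro add_mono T1 T2)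
    also have "\<dots> = ennreal (a * \<epsilon>)"
    proof -
      have "C * \<delta> + V * \<delta> = (C + V) * \<delta>" by (simp add: distrib_right)
      also have "\<dots> = a * \<epsilon>" using C V by (simp add: \<delta>_def)
      finally show ?thesis using C V \<delta> by (simp flip: ennreal_plus)
    qed
    also have "\<dots> = ennreal a * ennreal \<epsilon>" using a \<epsilon> by (simp add: ennreal_mult)
    finally have le: "emeasure lebesgue (T1 \<union> T2) \<le> ennreal \<epsilon>"
      using a by (subst (asm) ennreal_mult_le_mult_iff) auto
    have "S \<subseteq> T1 \<union> T2"
    proof (rule subsetI, rule ccontr)
      fix x assume x: "x \<in> S" "x \<notin> T1 \<union> T2"
      then have "maximal_function v x \<le> ennreal a" "ennreal V * v x \<le> ennreal a"
        by (auto simp: T1_def T2_def)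
      then have "\<forall>\<^sub>F r in at_right 0. mean_oscillation f x r \<le> ennreal (3 * a)"
        using x(1) unfolding S_def v_def V_def
        by (intro mean_oscillation_eventually_le[OF f g(1) B _ a]) auto
      then show False using x(1) by (simp add: S_def)
    qed
    moreover have "T1 \<union> T2 \<in> lmeasurable"
      using le by (intro fmeasurableI) (auto simp: le_less_trans)
    moreover have "measure lebesgue (T1 \<union> T2) \<le> \<epsilon>"
      using le \<epsilon> by (simp add: measure_def enn2real_leI)
    ultimately show "\<exists>T. S \<subseteq> T \<and> T \<in> lmeasurable \<and> measure lebesgue T \<le> \<epsilon>" by blast
  qed
  then have "S \<in> null_sets lebesgue" by (simp add: negligible_iff_null_sets)
  then have "AE x in lebesgue. x \<notin> S" by (rule AE_not_in)
  then show ?thesis by (simp add: S_def)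
qed

lemma locally_integrable_nn_integral_finite:
  fixes f :: "'a::euclidean_space \<Rightarrow> real"
  assumes "locally_integrable f" "compact K"
  shows "(\<integral>\<^sup>+x\<in>K. ennreal \<bar>f x\<bar> \<partial>lebesgue) < \<infinity>"
proof -
  have "set_integrable lebesgue K f" using assms by (auto simp: locally_integrable_def)
  then have "(\<integral>\<^sup>+x. ennreal (norm (indicator K x *\<^sub>R f x)) \<partial>lebesgue) < \<infinity>"
    unfolding set_integrable_def integrable_iff_bounded by blast
  also have "(\<integral>\<^sup>+x. ennreal (norm (indicator K x *\<^sub>R f x)) \<partial>lebesgue) = (\<integral>\<^sup>+x\<in>K. ennreal \<bar>f x\<bar> \<partial>lebesgue)"
    by (intro nn_integral_cong) (auto simp: indicator_def)
  finally show ?thesis .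
qed

lemma lebesgue_points:
  fixes f :: "'a::euclidean_space \<Rightarrow> real"
  assumes f: "locally_integrable f"
  shows "AE x in lebesgue. (mean_oscillation f x \<longlongrightarrow> 0) (at_right 0)"
proof -
  have "AE x in lebesgue. x \<in> interior (cball 0 (real R)) \<longrightarrow>
      (\<forall>\<^sub>F r in at_right 0. mean_oscillation f x r \<le> ennreal (3 * (1 / Suc m)))" for R m :: nat
  proof (rule AE_mean_oscillation_le)
    show "f \<in> borel_measurable lebesgue" using f by (simp add: locally_integrable_def)
    show "(\<integral>\<^sup>+x\<in>cball 0 (real R). ennreal \<bar>f x\<bar> \<partial>lebesgue) < \<infinity>"
      by (rule locally_integrable_nn_integral_finite[OF f]) simp
    show "emeasure lebesgue (cball (0::'a) (real R)) < \<infinity>"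
      by (simp add: emeasure_cball)
  qed auto
  then have "AE x in lebesgue. \<forall>R m. x \<in> interior (cball 0 (real R)) \<longrightarrow>
      (\<forall>\<^sub>F r in at_right 0. mean_oscillation f x r \<le> ennreal (3 * (1 / Suc m)))"
    by (simp only: AE_all_countable) blast
  then show ?thesis
  proof eventually_elim
    case (elim x)
    obtain R :: nat where "norm x < real R" using reals_Archimedean2 by blast
    then have "x \<in> interior (cball 0 (real R))" by (simp add: interior_cball)
    with elim have *: "\<forall>\<^sub>F r in at_right 0. mean_oscillation f x r \<le> ennreal (3 * (1 / Suc m))" for m by blast
    show ?case
    proof (rule order_tendstoI)
      fix y :: ennreal assume y: "0 < y"
      obtain m :: nat where m: "ennreal (3 * (1 / Suc m)) < y"
      proof (cases y)
        case (real s)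
        then have "0 < s / 3" using y by simp
        then obtain m where "inverse (real (Suc m)) < s / 3" using reals_Archimedean by blast
        then have "3 * (1 / Suc m) < s" by (simp add: inverse_eq_divide)
        then show ?thesis using real that[of m] by (simp add: ennreal_less_iff)
      qed (use that in auto)
      show "\<forall>\<^sub>F r in at_right 0. mean_oscillation f x r < y"
        using *[of m] by eventually_elim (rule le_less_trans[OF _ m])
    qed simp
  qed
qed

section \<open>Smooth bump functions\<close>

definition flat_exp :: "nat \<Rightarrow> real \<Rightarrow> real" where
  "flat_exp m t = (if 0 < t then (1 / t) ^ m * exp (- (1 / t)) else 0)"

text \<open>
  Differentiation only raises m, so the linear combinations of the functions t^(-m) exp(-1/t),
  extended by 0, are closed under derivatives. At 0 the difference quotient tends to 0 because
  exponentials beat powers.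
\<close>

lemma flat_exp_DERIV:
  "(flat_exp m has_real_derivative (- real m * flat_exp (m + 1) t + flat_exp (m + 2) t)) (at t)"
proof (cases t "0::real" rule: linorder_cases)
  case less
  have "((\<lambda>_. 0) has_real_derivative 0) (at t)" by simp
  then have "(flat_exp m has_real_derivative 0) (at t)"
    by (rule DERIV_cong_ev[THEN iffD1, rotated -1])
      (use less eventually_nhds_in_open[of "{..<0}" t] in \<open>auto elim!: eventually_mono simp: flat_exp_def\<close>)
  then show ?thesis using less by (simp add: flat_exp_def)
next
  case greater
  have i: "((\<lambda>t. 1 / t) has_real_derivative - (1 / t ^ 2)) (at t)"
    using greater by (auto intro!: derivative_eq_intros simp: power2_eq_square)
  have e: "((\<lambda>t. exp (- (1 / t))) has_real_derivative exp (- (1 / t)) * (1 / t ^ 2)) (at t)"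
    using DERIV_fun_exp[OF DERIV_minus[OF i]] by simp
  note DERIV_mult[OF DERIV_power[OF i, of m] e]
  also have "real m * (- (1 / t ^ 2) * (1 / t) ^ (m - Suc 0)) * exp (- (1 / t)) + exp (- (1 / t)) * (1 / t ^ 2) * (1 / t) ^ m
    = - real m * flat_exp (m + 1) t + flat_exp (m + 2) t"
    using greater by (cases m) (auto simp: flat_exp_def power2_eq_square power_add field_simps)
  finally show ?thesis
    by (rule DERIV_cong_ev[THEN iffD1, rotated -1])
      (use greater eventually_nhds_in_open[of "{0<..}" t] in \<open>auto elim!: eventually_mono simp: flat_exp_def\<close>)
next
  case equal
  have "((\<lambda>t. flat_exp m t / t) \<longlongrightarrow> 0) (at_right 0)"
  proof -
    have "((\<lambda>x::real. x ^ (m + 1) / exp x) \<longlongrightarrow> 0) at_top" by (rule tendsto_power_div_exp_0)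
    then have "((\<lambda>t::real. inverse t ^ (m + 1) / exp (inverse t)) \<longlongrightarrow> 0) (at_right 0)"
      by (rule filterlim_compose[OF _ filterlim_inverse_at_top_right])
    then show ?thesis
      by (rule Lim_transform_eventually)
        (use eventually_at_right_less[of "0::real"] in \<open>auto elim!: eventually_mono simp: flat_exp_def exp_minus field_simps\<close>)
  qed
  moreover have "((\<lambda>t. flat_exp m t / t) \<longlongrightarrow> 0) (at_left 0)"
    by (rule Lim_transform_eventually[OF tendsto_const])
      (use eventually_at_left_real[of "-1" "0::real"] in \<open>auto elim!: eventually_mono simp: flat_exp_def\<close>)
  ultimately have "((\<lambda>t. flat_exp m t / t) \<longlongrightarrow> 0) (at 0)"
    by (simp add: filterlim_split_at)
  then show ?thesis using equal
    by (simp add: has_field_derivative_iff flat_exp_def)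
qed

lemma flat_exp_0_DERIV: "(flat_exp 0 has_real_derivative flat_exp 2 t) (at t)"
  using flat_exp_DERIV[of 0 t] by (simp add: numeral_2_eq_2)

lemma continuous_flat_exp: "continuous_on UNIV (flat_exp m)"
  by (meson flat_exp_DERIV DERIV_isCont continuous_at_imp_continuous_on)

lemma flat_exp_nonneg: "0 \<le> flat_exp m t"
  by (simp add: flat_exp_def)

lemma flat_exp_0_le: "flat_exp 0 t \<le> 1"
  by (simp add: flat_exp_def)

lemma flat_exp_2_le: "flat_exp 2 t \<le> 2"
proof (cases "0 < t")
  case True
  have "1 + (1/t) + (1/t)\<^sup>2 / 2 \<le> exp (1 / t)" using True by (intro exp_lower_Taylor_quadratic) auto
  moreover have "0 < 1 / t" using True by simp
  ultimately have "(1/t)\<^sup>2 / 2 \<le> exp (1 / t)" by linarith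
  then have "(1/t)\<^sup>2 / 2 * exp (- (1 / t)) \<le> exp (1 / t) * exp (- (1 / t))"
    by (intro mult_right_mono) auto
  then show ?thesis using True by (simp add: flat_exp_def exp_minus)
qed (simp add: flat_exp_def)

lemma flat_exp_eq_0: "t \<le> 0 \<Longrightarrow> flat_exp m t = 0"
  by (simp add: flat_exp_def)

text \<open>
  A class of functions supported in a ball around y (s is the inverse square of the radius) that is
  closed under partial derivatives. All its members are therefore smooth, without any explicit formula
  for the higher derivatives.
\<close>

inductive bump_function :: "real \<Rightarrow> 'a::euclidean_space \<Rightarrow> ('a \<Rightarrow> real) \<Rightarrow> bool" for s y where
  base: "bump_function s y (\<lambda>z. flat_exp m (1 - s * ((z - y) \<bullet> (z - y))))"
| add: "bump_function s y f \<Longrightarrow> bump_function s y g \<Longrightarrow> bump_function s y (\<lambda>z. f z + g z)"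
| cmult: "bump_function s y f \<Longrightarrow> bump_function s y (\<lambda>z. c * f z)"
| coord: "bump_function s y f \<Longrightarrow> bump_function s y (\<lambda>z. ((z - y) \<bullet> i) * f z)"

lemma has_derivative_flat_exp_radial:
  "((\<lambda>z. flat_exp m (1 - s * ((z - y) \<bullet> (z - y)))) has_derivative
    (\<lambda>b. (- real m * flat_exp (m + 1) (1 - s * ((z - y) \<bullet> (z - y))) + flat_exp (m + 2) (1 - s * ((z - y) \<bullet> (z - y))))
       * (- 2 * s * ((z - y) \<bullet> b)))) (at (z::'a::euclidean_space))"
proof -
  have "((\<lambda>z. 1 - s * ((z - y) \<bullet> (z - y))) has_derivative (\<lambda>b. - 2 * s * ((z - y) \<bullet> b))) (at z)"
    by (auto intro!: derivative_eq_intros simp: inner_commute)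
  from DERIV_compose_FDERIV[OF flat_exp_DERIV this, of m]
  show ?thesis by (simp add: mult.commute)
qed

lemma bump_function_derivative:
  assumes "bump_function s y f"
  shows "\<exists>D. (\<forall>z. (f has_derivative D z) (at z)) \<and> (\<forall>b. bump_function s y (\<lambda>z. D z b))"
  using assms
proof induction
  case (base m)
  let ?q = "\<lambda>z. 1 - s * ((z - y) \<bullet> (z - y))"
  let ?d = "\<lambda>z. - real m * flat_exp (m + 1) (?q z) + flat_exp (m + 2) (?q z)"
  have "bump_function s y (\<lambda>z. ((z - y) \<bullet> b) * ((- 2 * s) * ?d z))" for b
    by (intro bump_function.intros)
  moreover have "((z - y) \<bullet> b) * ((- 2 * s) * ?d z) = ?d z * (- 2 * s * ((z - y) \<bullet> b))" for z b
    by (simp only: mult_ac)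
  ultimately have "bump_function s y (\<lambda>z. ?d z * (- 2 * s * ((z - y) \<bullet> b)))" for b
    by (simp only:)
  then show ?case
    by (intro exI[of _ "\<lambda>z b. ?d z * (- 2 * s * ((z - y) \<bullet> b))"] conjI allI has_derivative_flat_exp_radial)
next
  case (add f g)
  then obtain D E where "\<And>z. (f has_derivative D z) (at z)" "\<And>b. bump_function s y (\<lambda>z. D z b)"
    "\<And>z. (g has_derivative E z) (at z)" "\<And>b. bump_function s y (\<lambda>z. E z b)" by blast
  then show ?case
    by (intro exI[of _ "\<lambda>z b. D z b + E z b"]) (auto intro!: derivative_intros bump_function.intros)
next
  case (cmult f c)
  then obtain D where "\<And>z. (f has_derivative D z) (at z)" "\<And>b. bump_function s y (\<lambda>z. D z b)" by blast
  then show ?case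
    by (intro exI[of _ "\<lambda>z b. c * D z b"]) (auto intro!: derivative_intros bump_function.intros)
next
  case (coord f i)
  then obtain D where D: "\<And>z. (f has_derivative D z) (at z)" "\<And>b. bump_function s y (\<lambda>z. D z b)" by blast
  have "((\<lambda>z. ((z - y) \<bullet> i) * f z) has_derivative (\<lambda>b. ((z - y) \<bullet> i) * D z b + (b \<bullet> i) * f z)) (at z)" for z
    using D(1) by (auto intro!: derivative_eq_intros)
  moreover have "bump_function s y (\<lambda>z. ((z - y) \<bullet> i) * D z b + (b \<bullet> i) * f z)" for b
    using D(2) coord.hyps by (intro bump_function.intros)
  ultimately show ?case by (intro exI[of _ "\<lambda>z b. ((z - y) \<bullet> i) * D z b + (b \<bullet> i) * f z"]) blast
qed

lemma bump_function_smooth: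
  assumes "bump_function s y f"
  shows "times_continuously_differentiable k f"
  using assms
proof (induction k arbitrary: f)
  case 0
  then obtain D where "\<And>z. (f has_derivative D z) (at z)" using bump_function_derivative by blast
  then show ?case
    by (auto intro!: continuous_at_imp_continuous_on has_derivative_continuous)
next
  case (Suc k)
  then obtain D where D: "\<And>z. (f has_derivative D z) (at z)" "\<And>b. bump_function s y (\<lambda>z. D z b)"
    using bump_function_derivative by blast
  have "frechet_derivative f (at z) = D z" for z using D(1) by (metis frechet_derivative_at)
  then show ?case using Suc.IH D by (auto simp: differentiable_def)
qed

lemma bump_function_eq_0: "bump_function s y f \<Longrightarrow> 1 \<le> s * ((z - y) \<bullet> (z - y)) \<Longrightarrow> f z = 0"
  by (induction rule: bump_function.induct) (auto simp: flat_exp_eq_0)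

lemma bump_function_test_function:
  fixes f :: "'a::euclidean_space \<Rightarrow> real"
  assumes f: "bump_function (1 / r\<^sup>2) y f" and r: "0 < r"
  shows "test_function f"
proof -
  have "{x. f x \<noteq> 0} \<subseteq> cball y r"
  proof (rule subsetI, rule ccontr)
    fix z assume z: "z \<in> {x. f x \<noteq> 0}" "z \<notin> cball y r"
    then have "r \<le> norm (z - y)" by (simp add: dist_norm norm_minus_commute)
    then have "r\<^sup>2 \<le> (z - y) \<bullet> (z - y)" using r by (simp add: power_mono flip: power2_norm_eq_inner)
    then have "1 \<le> 1 / r\<^sup>2 * ((z - y) \<bullet> (z - y))" using r by (simp add: field_simps)
    then show False using z bump_function_eq_0[OF f] by blast
  qed
  then have "bounded {x. f x \<noteq> 0}" by (rule bounded_subset[OF bounded_cball])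
  then show ?thesis
    using bump_function_smooth[OF f] by (simp add: test_function_def compact_closure)
qed

section \<open>Integrals against test functions\<close>

text \<open>
  Differentiation under the integral sign. The mean value theorem bounds the difference quotients
  by w, so dominated convergence applies along every sequence.
\<close>

lemma has_real_derivative_integral:
  fixes F F' :: "real \<Rightarrow> 'a \<Rightarrow> real"
  assumes t0: "a < t0" "t0 < b"
    and int: "\<And>t. a < t \<Longrightarrow> t < b \<Longrightarrow> integrable M (F t)"
    and deriv: "\<And>t x. a < t \<Longrightarrow> t < b \<Longrightarrow> ((\<lambda>t. F t x) has_real_derivative F' t x) (at t)"
    and bound: "\<And>t x. a < t \<Longrightarrow> t < b \<Longrightarrow> \<bar>F' t x\<bar> \<le> w x"
    and w: "integrable M w"
    and F'[measurable]: "F' t0 \<in> borel_measurable M"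
  shows "((\<lambda>t. \<integral>x. F t x \<partial>M) has_real_derivative (\<integral>x. F' t0 x \<partial>M)) (at t0)"
proof -
  let ?q = "\<lambda>t x. (F t x - F t0 x) / (t - t0)"
  have "((\<lambda>t. ((\<integral>x. F t x \<partial>M) - (\<integral>x. F t0 x \<partial>M)) / (t - t0)) \<longlongrightarrow> (\<integral>x. F' t0 x \<partial>M)) (at t0 within {a<..<b})"
    unfolding tendsto_at_iff_sequentially comp_def
  proof (intro allI impI)
    fix X :: "nat \<Rightarrow> real" assume X: "\<forall>i. X i \<in> {a<..<b} - {t0}" "X \<longlonglongrightarrow> t0"
    have [measurable]: "F t \<in> borel_measurable M" if "a < t" "t < b" for t
      using int[OF that] by (rule borel_measurable_integrable)
    have m[measurable]: "F (X i) \<in> borel_measurable M" "F t0 \<in> borel_measurable M" for i using X t0 by auto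
    have "(\<lambda>i. \<integral>x. ?q (X i) x \<partial>M) \<longlonglongrightarrow> (\<integral>x. F' t0 x \<partial>M)"
    proof (rule integral_dominated_convergence[where w=w])
      show "AE x in M. (\<lambda>i. ?q (X i) x) \<longlonglongrightarrow> F' t0 x"
      proof (rule AE_I2)
        fix x
        have "((\<lambda>t. ?q t x) \<longlongrightarrow> F' t0 x) (at t0 within {a<..<b})"
          using deriv[OF t0, of x] unfolding has_field_derivative_iff
          by (rule tendsto_within_subset) simp
        then show "(\<lambda>i. ?q (X i) x) \<longlonglongrightarrow> F' t0 x"
          using X unfolding tendsto_at_iff_sequentially comp_def by blast
      qed
      show "AE x in M. norm (?q (X i) x) \<le> w x" for i
      proof (rule AE_I2)
        fix x
        have "norm (F (X i) x - F t0 x) \<le> w x * norm (X i - t0)"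
        proof (rule field_differentiable_bound[where S="{a<..<b}" and f'="\<lambda>t. F' t x"])
          show "((\<lambda>t. F t x) has_field_derivative F' z x) (at z within {a<..<b})" if "z \<in> {a<..<b}" for z
            by (rule has_field_derivative_at_within[OF deriv]) (use that in auto)
          show "convex {a<..<b}" by (rule convex_real_interval)
          show "norm (F' z x) \<le> w x" if "z \<in> {a<..<b}" for z using bound[of z x] that by simp
          show "X i \<in> {a<..<b}" using X(1) by blast
          show "t0 \<in> {a<..<b}" using t0 by simp
        qed
        moreover have "X i \<noteq> t0" using X by auto
        ultimately show "norm (?q (X i) x) \<le> w x" by (simp add: divide_le_eq)
      qed
    qed (use w in auto)
    moreover have "(\<integral>x. ?q (X i) x \<partial>M) = ((\<integral>x. F (X i) x \<partial>M) - (\<integral>x. F t0 x \<partial>M)) / (X i - t0)" for i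
      using X t0 int by (subst Bochner_Integration.integral_diff[symmetric]) auto
    ultimately show "(\<lambda>i. ((\<integral>x. F (X i) x \<partial>M) - (\<integral>x. F t0 x \<partial>M)) / (X i - t0)) \<longlonglongrightarrow> (\<integral>x. F' t0 x \<partial>M)"
      by (simp only:)
  qed
  moreover have "at t0 within {a<..<b} = at t0" using t0 by (intro at_within_open) auto
  ultimately show ?thesis by (simp add: has_field_derivative_iff)
qed

lemma integrable_locally_integrable_mult:
  fixes f \<phi> :: "'a::euclidean_space \<Rightarrow> real"
  assumes f: "locally_integrable f" and [measurable]: "\<phi> \<in> borel_measurable lebesgue"
    and K: "compact K" "\<And>z. z \<notin> K \<Longrightarrow> \<phi> z = 0" and C: "\<And>z. \<bar>\<phi> z\<bar> \<le> C"
  shows "integrable lebesgue (\<lambda>z. f z * \<phi> z)"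
proof (rule Bochner_Integration.integrable_bound)
  have [measurable]: "f \<in> borel_measurable lebesgue" using f by (simp add: locally_integrable_def)
  show "integrable lebesgue (\<lambda>z. C * norm (indicator K z *\<^sub>R f z))"
    using f K(1) unfolding locally_integrable_def set_integrable_def by auto
  show "(\<lambda>z. f z * \<phi> z) \<in> borel_measurable lebesgue" by measurable
  show "AE z in lebesgue. norm (f z * \<phi> z) \<le> norm (C * norm (indicator K z *\<^sub>R f z))"
  proof (rule AE_I2)
    fix z
    have "0 \<le> C" using C[of z] by linarith
    then show "norm (f z * \<phi> z) \<le> norm (C * norm (indicator K z *\<^sub>R f z))"
      using C[of z] K(2)[of z] by (cases "z \<in> K") (auto simp: abs_mult mult.commute mult_right_mono)
  qed
qed

text \<open>
  The analytic content of being a test function that the sequel uses: \<phi> and its partial derivatives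
  are continuous and vanish outside one compact set.
\<close>

lemma test_function_bounds:
  fixes \<phi> :: "'a::euclidean_space \<Rightarrow> real"
  assumes \<phi>: "test_function \<phi>"
  shows "continuous_on UNIV \<phi>"
    and "\<And>i. i \<in> Basis \<Longrightarrow> continuous_on UNIV (\<lambda>x. frechet_derivative \<phi> (at x) i)"
    and "\<And>x. (\<phi> has_derivative frechet_derivative \<phi> (at x)) (at x)"
    and "\<And>x. x \<notin> closure {x. \<phi> x \<noteq> 0} \<Longrightarrow> \<phi> x = 0"
    and "\<And>x i. x \<notin> closure {x. \<phi> x \<noteq> 0} \<Longrightarrow> frechet_derivative \<phi> (at x) i = 0"
    and "compact (closure {x. \<phi> x \<noteq> 0})"
proof -
  have C: "times_continuously_differentiable k \<phi>" for k using \<phi> by (simp add: test_function_def)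
  show "continuous_on UNIV \<phi>" using C[of 0] by simp
  show "continuous_on UNIV (\<lambda>x. frechet_derivative \<phi> (at x) i)" if "i \<in> Basis" for i
    using C[of "Suc 0"] that by simp
  show "(\<phi> has_derivative frechet_derivative \<phi> (at x)) (at x)" for x
    using C[of "Suc 0"] by (simp add: frechet_derivative_works[symmetric])
  show 0: "\<phi> x = 0" if "x \<notin> closure {x. \<phi> x \<noteq> 0}" for x
    using that closure_subset[of "{x. \<phi> x \<noteq> 0}"] by blast
  show "frechet_derivative \<phi> (at x) i = 0" if x: "x \<notin> closure {x. \<phi> x \<noteq> 0}" for x i
  proof -
    have "(\<phi> has_derivative (\<lambda>_. 0)) (at x)"
    proof (rule has_derivative_transform_within_open[of "\<lambda>_. 0"])
      show "open (- closure {x. \<phi> x \<noteq> 0})" by auto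
      show "0 = \<phi> y" if "y \<in> - closure {x. \<phi> x \<noteq> 0}" for y using 0[of y] that by simp
    qed (use x in auto)
    then have "frechet_derivative \<phi> (at x) = (\<lambda>_. 0)" by (rule frechet_derivative_at[symmetric])
    then show ?thesis by simp
  qed
  show "compact (closure {x. \<phi> x \<noteq> 0})" using \<phi> by (simp add: test_function_def)
qed

lemma continuous_compact_support_bounded:
  fixes \<phi> :: "'a::euclidean_space \<Rightarrow> real"
  assumes "continuous_on UNIV \<phi>" "compact K" "\<And>x. x \<notin> K \<Longrightarrow> \<phi> x = 0"
  obtains C where "0 < C" "\<And>x. \<bar>\<phi> x\<bar> \<le> C"
proof -
  have "compact (\<phi> ` K)" 
    by (rule compact_continuous_image[OF continuous_on_subset[OF assms(1) subset_UNIV] assms(2)])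
  then have "bounded (\<phi> ` K)" by (rule compact_imp_bounded)
  then obtain C where C: "0 < C" "\<forall>y\<in>\<phi> ` K. norm y \<le> C"
    unfolding bounded_pos by blast
  have "\<bar>\<phi> x\<bar> \<le> C" for x
    using C assms(3)[of x] by (cases "x \<in> K") auto
  with C(1) show thesis by (rule that)
qed

lemma integrable_locally_integrable_continuous:
  fixes f \<phi> :: "'a::euclidean_space \<Rightarrow> real"
  assumes "locally_integrable f" and \<phi>: "continuous_on UNIV \<phi>" "compact K" "\<And>x. x \<notin> K \<Longrightarrow> \<phi> x = 0"
  shows "integrable lebesgue (\<lambda>x. f x * \<phi> x)"
proof -
  obtain C where "\<And>x. \<bar>\<phi> x\<bar> \<le> C" using continuous_compact_support_bounded[OF \<phi>] by metis
  with assms show ?thesis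
    by (intro integrable_locally_integrable_mult borel_measurable_lebesgue_continuous) auto
qed

lemma integrable_test_function:
  fixes f \<phi> :: "'a::euclidean_space \<Rightarrow> real"
  assumes f: "locally_integrable f" and \<phi>: "test_function \<phi>"
  shows "integrable lebesgue (\<lambda>x. f x * \<phi> x)"
    and "i \<in> Basis \<Longrightarrow> integrable lebesgue (\<lambda>x. f x * frechet_derivative \<phi> (at x) i)"
proof -
  note b = test_function_bounds[OF \<phi>]
  show "integrable lebesgue (\<lambda>x. f x * \<phi> x)"
    by (rule integrable_locally_integrable_continuous[OF f b(1) b(6) b(4)])
  show "integrable lebesgue (\<lambda>x. f x * frechet_derivative \<phi> (at x) i)" if "i \<in> Basis"
    by (rule integrable_locally_integrable_continuous[OF f b(2)[OF that] b(6) b(5)])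
qed

lemma locally_integrable_inner:
  fixes G :: "'a::euclidean_space \<Rightarrow> 'a"
  assumes "locally_integrable G"
  shows "locally_integrable (\<lambda>x. G x \<bullet> i)"
proof -
  have [measurable]: "G \<in> borel_measurable lebesgue" using assms by (simp add: locally_integrable_def)
  have "set_integrable lebesgue K (\<lambda>x. G x \<bullet> i)" if "compact K" for K
  proof -
    have "integrable lebesgue (\<lambda>x. (indicator K x *\<^sub>R G x) \<bullet> i)"
      using assms that unfolding locally_integrable_def set_integrable_def by (intro integrable_inner_left) auto
    then show ?thesis by (simp add: set_integrable_def)
  qed
  then show ?thesis by (simp add: locally_integrable_def)
qed

section \<open>Averages along a cone\<close>

definition bump :: "'a::euclidean_space \<Rightarrow> real \<Rightarrow> 'a \<Rightarrow> real" where
  "bump y r z = flat_exp 0 (1 - 1 / r\<^sup>2 * ((z - y) \<bullet> (z - y)))"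

definition bump_mean :: "('a::euclidean_space \<Rightarrow> real) \<Rightarrow> 'a \<Rightarrow> real \<Rightarrow> real" where
  "bump_mean f y r = 1 / r ^ DIM('a) * (LINT z|lebesgue. f z * bump y r z)"

definition bump_mass :: "'a::euclidean_space itself \<Rightarrow> real" where
  "bump_mass _ = (LINT z|lebesgue. bump (0::'a) 1 z)"

lemma flat_exp_radial_eq_0:
  assumes "0 < r" "z \<notin> cball y r"
  shows "flat_exp m (1 - 1 / r\<^sup>2 * ((z - y) \<bullet> (z - y))) = 0"
proof -
  have "r \<le> norm (z - y)" using assms by (simp add: dist_norm norm_minus_commute)
  then have "r\<^sup>2 \<le> (z - y) \<bullet> (z - y)" using assms by (simp add: power_mono flip: power2_norm_eq_inner)
  then have "1 \<le> 1 / r\<^sup>2 * ((z - y) \<bullet> (z - y))" using assms by (simp add: field_simps)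
  then show ?thesis by (intro flat_exp_eq_0) simp
qed

lemma bump_eq_0: "0 < r \<Longrightarrow> z \<notin> cball y r \<Longrightarrow> bump y r z = 0"
  unfolding bump_def by (rule flat_exp_radial_eq_0)

lemma bump_nonneg: "0 \<le> bump y r z" by (simp add: bump_def flat_exp_nonneg)

lemma bump_le_1: "bump y r z \<le> 1" by (simp add: bump_def flat_exp_0_le)

lemma continuous_bump: "continuous_on UNIV (bump (y::'a::euclidean_space) r)"
  unfolding bump_def[abs_def]
  by (intro continuous_on_compose2[OF continuous_flat_exp] continuous_intros) auto

lemma borel_measurable_bump [measurable]: "bump y r \<in> borel_measurable lebesgue"
  by (rule borel_measurable_lebesgue_continuous[OF continuous_bump])

lemma locally_integrable_const: "locally_integrable (\<lambda>_::'a::euclidean_space. c::real)"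
  unfolding locally_integrable_def set_integrable_def
  by (auto intro!: integrable_scaleR_left finite_measure_lebesgue_on simp: integrable_indicator_iff emeasure_compact_finite less_top[symmetric] dest: lmeasurable_compact fmeasurableD2)

lemma integrable_mult_bump:
  assumes "locally_integrable f" "0 < r"
  shows "integrable lebesgue (\<lambda>z. f z * bump y r z)"
  using assms bump_eq_0
  by (intro integrable_locally_integrable_continuous[of f "bump y r" "cball y r"] continuous_bump) auto

lemma integrable_bump: "0 < r \<Longrightarrow> integrable lebesgue (bump y r)"
  using integrable_mult_bump[OF locally_integrable_const[of 1]] by simp

lemma bump_mass_pos: "0 < bump_mass TYPE('a::euclidean_space)"
proof -
  have "0 \<le> bump_mass TYPE('a)" by (simp add: bump_mass_def bump_nonneg)
  moreover have "bump_mass TYPE('a) \<noteq> 0"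
  proof
    assume "bump_mass TYPE('a) = 0"
    then have "AE z in lebesgue. bump (0::'a) 1 z = 0"
      unfolding bump_mass_def
      by (subst (asm) integral_nonneg_eq_0_iff_AE) (auto simp: integrable_bump bump_nonneg)
    then have "AE z in lebesgue. z \<notin> ball (0::'a) 1"
    proof eventually_elim
      case (elim z)
      show ?case
      proof
        assume "z \<in> ball 0 1"
        then have "norm z ^ 2 < 1" by (simp add: power_less_one_iff)
        then have "z \<bullet> z < 1" by (simp add: power2_norm_eq_inner)
        with elim show False by (simp add: bump_def flat_exp_def)
      qed
    qed
    then have "ball (0::'a) 1 \<in> null_sets lebesgue"
      by (subst (asm) AE_iff_null_sets[symmetric]) auto
    then show False
      using unit_ball_vol_pos[of "real DIM('a)"] by (simp add: null_sets_def emeasure_ball del: unit_ball_vol_pos)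
  qed
  ultimately show ?thesis by simp
qed

lemma integral_bump:
  fixes y :: "'a::euclidean_space"
  assumes r: "0 < r"
  shows "(LINT z|lebesgue. bump y r z) = r ^ DIM('a) * bump_mass TYPE('a)"
proof -
  have m: "bump y r \<in> borel_measurable lborel" for y :: 'a and r
    using borel_measurable_continuous_onI[OF continuous_bump] by simp
  have eq: "bump y r (y + r *\<^sub>R z) = bump 0 1 z" for z
    using r by (simp add: bump_def power2_eq_square)
  have "(LINT z|lebesgue. bump y r z) = (LINT z|lborel. bump y r z)"
    by (rule integral_completion[OF m])
  also have "\<dots> = (LINT z|density (distr lborel borel (\<lambda>x. y + r *\<^sub>R x)) (\<lambda>_. \<bar>r\<bar> ^ DIM('a)). bump y r z)"
    using lborel_affine[of r y] r by simp
  also have "\<dots> = (LINT z|distr lborel borel (\<lambda>x. y + r *\<^sub>R x). r ^ DIM('a) * bump y r z)"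
    using m[of y r] r by (subst integral_density) auto
  also have "\<dots> = (LINT z|lborel. r ^ DIM('a) * bump y r (y + r *\<^sub>R z))"
    using m[of y r] by (intro integral_distr) auto
  also have "\<dots> = r ^ DIM('a) * (LINT z|lborel. bump (0::'a) 1 z)"
    by (simp add: eq)
  also have "(LINT z|lborel. bump (0::'a) 1 z) = bump_mass TYPE('a)"
    unfolding bump_mass_def by (rule integral_completion[OF m, symmetric])
  finally show ?thesis .
qed

text \<open>
  The balls of radius t around x + t e stay within the ball of radius 2 t around their common vertex x,
  which is why the maximal function at x controls averages over them.
\<close>

lemma cball_along_cone:
  fixes x e z :: "'a::euclidean_space"
  assumes t: "0 < t" and e: "norm e \<le> 1" and z: "z \<in> cball (x + t *\<^sub>R e) t"
  shows "z \<in> cball x (2 * t)"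
proof -
  have "norm (z - x) \<le> norm (z - (x + t *\<^sub>R e)) + norm (t *\<^sub>R e)"
    using norm_triangle_ineq[of "z - (x + t *\<^sub>R e)" "t *\<^sub>R e"] by simp
  moreover have "norm (t *\<^sub>R e) \<le> t" using t e by (simp add: mult_left_le)
  ultimately show ?thesis using z by (simp add: dist_norm norm_minus_commute)
qed

lemma ennreal_abs_integral_le:
  fixes F :: "'a \<Rightarrow> real"
  shows "ennreal \<bar>LINT z|M. F z\<bar> \<le> (\<integral>\<^sup>+z. ennreal (norm (F z)) \<partial>M)"
proof (cases "integrable M F")
  case True
  then show ?thesis using integral_norm_bound_ennreal[OF True] by simp
qed (simp add: not_integrable_integral_eq)

lemma bump_function_coord:
  fixes x y :: "'a::euclidean_space"
  shows "bump_function (1 / t\<^sup>2) y (\<lambda>z. ((z - x) \<bullet> j) * bump y t z)"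
proof -
  have "bump_function (1 / t\<^sup>2) y (\<lambda>z. ((z - y) \<bullet> j) * bump y t z + ((y - x) \<bullet> j) * bump y t z)"
    unfolding bump_def by (intro bump_function.intros)
  moreover have "((z - y) \<bullet> j) * bump y t z + ((y - x) \<bullet> j) * bump y t z = ((z - x) \<bullet> j) * bump y t z" for z
    by (simp add: inner_diff_left algebra_simps)
  ultimately show ?thesis by (simp only:)
qed

lemma frechet_derivative_coord_bump:
  fixes x y :: "'a::euclidean_space"
  defines "p \<equiv> \<lambda>t z. 1 - 1 / t\<^sup>2 * ((z - y) \<bullet> (z - y))"
  shows "frechet_derivative (\<lambda>z. ((z - x) \<bullet> j) * bump y t z) (at z) b
    = (b \<bullet> j) * flat_exp 0 (p t z) - 2 / t\<^sup>2 * flat_exp 2 (p t z) * (((z - x) \<bullet> j) * ((z - y) \<bullet> b))"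
proof -
  have "(bump y t has_derivative (\<lambda>b. flat_exp 2 (p t z) * (- 2 * (1 / t\<^sup>2) * ((z - y) \<bullet> b)))) (at z)"
    using has_derivative_flat_exp_radial[of 0 "1 / t\<^sup>2" y z]
    by (simp add: bump_def[abs_def] p_def numeral_2_eq_2)
  then have "((\<lambda>z. ((z - x) \<bullet> j) * bump y t z) has_derivative
      (\<lambda>b. ((z - x) \<bullet> j) * (flat_exp 2 (p t z) * (- 2 * (1 / t\<^sup>2) * ((z - y) \<bullet> b))) + (b \<bullet> j) * bump y t z)) (at z)"
    by (auto intro!: derivative_eq_intros)
  then have "frechet_derivative (\<lambda>z. ((z - x) \<bullet> j) * bump y t z) (at z) =
      (\<lambda>b. ((z - x) \<bullet> j) * (flat_exp 2 (p t z) * (- 2 * (1 / t\<^sup>2) * ((z - y) \<bullet> b))) + (b \<bullet> j) * bump y t z)"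
    by (rule frechet_derivative_at[symmetric])
  then show ?thesis by (simp add: bump_def p_def)
qed

text \<open>
  The divergence of the vector field (z - x) b(z), where b is the bump of radius t around y.
\<close>

definition bump_divergence :: "'a::euclidean_space \<Rightarrow> 'a \<Rightarrow> real \<Rightarrow> 'a \<Rightarrow> real" where
  "bump_divergence x y t z =
     (\<Sum>j\<in>Basis. frechet_derivative (\<lambda>z. ((z - x) \<bullet> j) * bump y t z) (at z) j)"

lemma bump_divergence_eq:
  fixes x y :: "'a::euclidean_space"
  defines "p \<equiv> \<lambda>t z. 1 - 1 / t\<^sup>2 * ((z - y) \<bullet> (z - y))"
  shows "bump_divergence x y t z
    = DIM('a) * flat_exp 0 (p t z) - 2 / t\<^sup>2 * flat_exp 2 (p t z) * ((z - x) \<bullet> (z - y))"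
proof -
  have "bump_divergence x y t z = (\<Sum>j\<in>Basis. (j \<bullet> j) * flat_exp 0 (p t z)
      - 2 / t\<^sup>2 * flat_exp 2 (p t z) * (((z - x) \<bullet> j) * ((z - y) \<bullet> j)))"
    unfolding bump_divergence_def p_def by (simp only: frechet_derivative_coord_bump)
  also have "\<dots> = (\<Sum>j\<in>(Basis::'a set). (j \<bullet> j) * flat_exp 0 (p t z))
      - 2 / t\<^sup>2 * flat_exp 2 (p t z) * (\<Sum>j\<in>Basis. ((z - x) \<bullet> j) * ((z - y) \<bullet> j))"
    by (simp only: sum_subtractf sum_distrib_left)
  also have "(\<Sum>j\<in>(Basis::'a set). (j \<bullet> j) * flat_exp 0 (p t z)) = DIM('a) * flat_exp 0 (p t z)"
    by simp
  also have "(\<Sum>j\<in>Basis. ((z - x) \<bullet> j) * ((z - y) \<bullet> j)) = (z - x) \<bullet> (z - y)"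
    by (rule euclidean_inner[symmetric])
  finally show ?thesis .
qed

lemma DERIV_one_over_power:
  fixes t :: real
  assumes "0 < t"
  shows "((\<lambda>t. 1 / t ^ n) has_real_derivative - (real n / t ^ (n + 1))) (at t)"
proof -
  have "((\<lambda>t. inverse (t ^ n)) has_real_derivative - (inverse (t ^ n) * (real n * t ^ (n - 1)) * inverse (t ^ n))) (at t)"
    using assms by (auto intro!: derivative_eq_intros)
  also have "- (inverse (t ^ n) * (real n * t ^ (n - 1)) * inverse (t ^ n)) = - (real n / t ^ (n + 1))"
    using assms by (cases n) (auto simp: field_simps)
  finally show ?thesis by (simp add: inverse_eq_divide)
qed

text \<open>
  The scaled bump is transported along the cone by the vector field (z - x) / t, so its derivative in t
  is minus the divergence of the bump times this field. Having a divergence here allows the derivative to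
  be moved from the bump to f by the definition of the weak gradient.
\<close>

lemma DERIV_scaled_bump:
  fixes x e z :: "'a::euclidean_space"
  assumes t: "0 < t"
  shows "((\<lambda>t. 1 / t ^ DIM('a) * bump (x + t *\<^sub>R e) t z) has_real_derivative
     - (1 / t ^ (DIM('a) + 1)) * bump_divergence x (x + t *\<^sub>R e) t z) (at t)"
proof -
  let ?d = "\<lambda>t. z - (x + t *\<^sub>R e)"
  let ?p = "\<lambda>t. 1 - 1 / t\<^sup>2 * (?d t \<bullet> ?d t)"
  have dd: "((\<lambda>t. ?d t \<bullet> ?d t) has_real_derivative - 2 * (?d t \<bullet> e)) (at t)"
  proof -
    have "((\<lambda>t. (z - x) \<bullet> (z - x) - 2 * t * ((z - x) \<bullet> e) + t\<^sup>2 * (e \<bullet> e)) has_real_derivative - 2 * (?d t \<bullet> e)) (at t)"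
      by (auto intro!: derivative_eq_intros simp: inner_diff_left inner_add_left algebra_simps)
    moreover have "(z - x) \<bullet> (z - x) - 2 * t * ((z - x) \<bullet> e) + t\<^sup>2 * (e \<bullet> e) = ?d t \<bullet> ?d t" for t
      by (simp add: inner_diff_left inner_add_left inner_diff_right inner_add_right inner_commute algebra_simps power2_eq_square)
    ultimately show ?thesis by (simp only:)
  qed
  have "(?p has_real_derivative - (- (real 2 / t ^ (2 + 1)) * (?d t \<bullet> ?d t) + (- 2 * (?d t \<bullet> e)) * (1 / t ^ 2))) (at t)"
    using DERIV_diff[OF DERIV_const DERIV_mult[OF DERIV_one_over_power[OF t] dd], of 1 2] by simp
  also have "- (- (real 2 / t ^ (2 + 1)) * (?d t \<bullet> ?d t) + (- 2 * (?d t \<bullet> e)) * (1 / t ^ 2))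
      = 2 / t ^ 3 * ((z - x) \<bullet> ?d t)"
  proof -
    have add: "(a + t *\<^sub>R e) \<bullet> a = a \<bullet> a + t * (a \<bullet> e)" for a
      by (simp add: inner_add_left inner_add_right inner_commute)
    have "(z - x) \<bullet> ?d t = (?d t + t *\<^sub>R e) \<bullet> ?d t" by simp
    also have "\<dots> = ?d t \<bullet> ?d t + t * (?d t \<bullet> e)" by (rule add)
    finally show ?thesis using t by (simp add: power3_eq_cube power2_eq_square field_simps)
  qed
  finally have "((\<lambda>t. flat_exp 0 (?p t)) has_real_derivative flat_exp 2 (?p t) * (2 / t ^ 3 * ((z - x) \<bullet> ?d t))) (at t)"
    by (rule DERIV_chain2[OF flat_exp_0_DERIV])
  from DERIV_mult[OF DERIV_one_over_power[OF t, of "DIM('a)"] this]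
  have "((\<lambda>t. 1 / t ^ DIM('a) * bump (x + t *\<^sub>R e) t z) has_real_derivative
      (- (real DIM('a) / t ^ (DIM('a) + 1)) * flat_exp 0 (?p t)
      + flat_exp 2 (?p t) * (2 / t ^ 3 * ((z - x) \<bullet> ?d t)) * (1 / t ^ DIM('a)))) (at t)"
    by (simp only: bump_def)
  also have "- (real DIM('a) / t ^ (DIM('a) + 1)) * flat_exp 0 (?p t)
      + flat_exp 2 (?p t) * (2 / t ^ 3 * ((z - x) \<bullet> ?d t)) * (1 / t ^ DIM('a))
    = - (1 / t ^ (DIM('a) + 1)) * bump_divergence x (x + t *\<^sub>R e) t z"
    unfolding bump_divergence_eq using t by (simp add: power3_eq_cube power2_eq_square field_simps)
  finally show ?thesis .
qed

text \<open>
  Supplies the dominating function for differentiation under the integral sign. The constant 8 is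
  2 / t^2 times the bound 2 for the derivative of the profile times |z - x| |z - y| \<le> 2 t^2.
\<close>

lemma bump_divergence_bound:
  fixes x e z :: "'a::euclidean_space"
  assumes t: "0 < t" and e: "norm e \<le> 1"
  shows "\<bar>bump_divergence x (x + t *\<^sub>R e) t z\<bar> \<le> DIM('a) + 8"
    and "z \<notin> cball x (2 * t) \<Longrightarrow> bump_divergence x (x + t *\<^sub>R e) t z = 0"
proof -
  let ?y = "x + t *\<^sub>R e"
  let ?p = "1 - 1 / t\<^sup>2 * ((z - ?y) \<bullet> (z - ?y))"
  have 0: "bump_divergence x ?y t z = 0" if "z \<notin> cball ?y t"
    unfolding bump_divergence_eq using flat_exp_radial_eq_0[OF t that] by simp
  show "bump_divergence x ?y t z = 0" if "z \<notin> cball x (2 * t)"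
    using that cball_along_cone[OF t e] by (intro 0) auto
  show "\<bar>bump_divergence x ?y t z\<bar> \<le> DIM('a) + 8"
  proof (cases "z \<in> cball ?y t")
    case True
    then have n1: "norm (z - ?y) \<le> t" by (simp add: dist_norm norm_minus_commute)
    have n2: "norm (z - x) \<le> 2 * t"
      using cball_along_cone[OF t e True] by (simp add: dist_norm norm_minus_commute)
    have "\<bar>(z - x) \<bullet> (z - ?y)\<bar> \<le> norm (z - x) * norm (z - ?y)" by (rule Cauchy_Schwarz_ineq2)
    also have "\<dots> \<le> (2 * t) * t" using n2 n1 t by (intro mult_mono) auto
    finally have *: "\<bar>(z - x) \<bullet> (z - ?y)\<bar> \<le> 2 * t\<^sup>2" by (simp add: power2_eq_square)
    have "\<bar>2 / t\<^sup>2 * flat_exp 2 ?p * ((z - x) \<bullet> (z - ?y))\<bar> = 2 / t\<^sup>2 * flat_exp 2 ?p * \<bar>(z - x) \<bullet> (z - ?y)\<bar>"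
      using t by (simp add: abs_mult flat_exp_nonneg)
    also have "\<dots> \<le> 2 / t\<^sup>2 * 2 * (2 * t\<^sup>2)"
      using t * flat_exp_2_le by (intro mult_mono) (auto simp: flat_exp_nonneg)
    also have "\<dots> = 8" using t by simp
    finally have 1: "\<bar>2 / t\<^sup>2 * flat_exp 2 ?p * ((z - x) \<bullet> (z - ?y))\<bar> \<le> 8" .
    have 2: "\<bar>DIM('a) * flat_exp 0 ?p\<bar> \<le> DIM('a)"
      using flat_exp_0_le flat_exp_nonneg by (simp add: abs_mult mult_left_le)
    show ?thesis unfolding bump_divergence_eq using 1 2 by linarith
  qed (simp add: 0)
qed

text \<open>
  Differentiate under the integral sign, and integrate the divergence by parts: each
  coordinate of (z - x) times the bump is a test function.
\<close>

lemma bump_mean_has_derivative: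
  fixes f :: "'a::euclidean_space \<Rightarrow> real" and G :: "'a \<Rightarrow> 'a"
  assumes G: "weak_gradient f G" and e: "norm e \<le> 1" and t0: "0 < t0"
  shows "((\<lambda>t. bump_mean f (x + t *\<^sub>R e) t) has_real_derivative
    1 / t0 ^ (DIM('a) + 1) * (LINT z|lebesgue. (G z \<bullet> (z - x)) * bump (x + t0 *\<^sub>R e) t0 z)) (at t0)"
proof -
  let ?n = "DIM('a)"
  let ?\<phi> = "\<lambda>t j z. ((z - x) \<bullet> j) * bump (x + t *\<^sub>R e) t z"
  have f: "locally_integrable f" and Gl: "locally_integrable G" using G by (auto simp: weak_gradient_def)
  have [measurable]: "f \<in> borel_measurable lebesgue" using f by (simp add: locally_integrable_def)
  have test: "test_function (?\<phi> t j)" if "0 < t" for t j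
    by (rule bump_function_test_function[OF bump_function_coord that])
  define K where "K t z = - (1 / t ^ (?n + 1)) * bump_divergence x (x + t *\<^sub>R e) t z" for t z
  \<comment> \<open>A bound that is uniform for t between t0 / 2 and 2 t0; the supports then lie in the ball of radius
    4 t0 around x.\<close>
  define Cb where "Cb = (?n + 8) / (t0 / 2) ^ (?n + 1)"
  have Cb: "0 \<le> Cb" using t0 by (simp add: Cb_def)
  let ?B = "cball x (4 * t0)"
  have Kb: "\<bar>K t z\<bar> \<le> Cb * indicator ?B z" if "t0 / 2 < t" "t < 2 * t0" for t z
  proof (cases "z \<in> cball x (2 * t)")
    case False
    then have "K t z = 0" using bump_divergence_bound(2)[OF _ e, of t z x] that t0 by (simp add: K_def)
    then show ?thesis using Cb by simp
  next
    case True
    then have z: "z \<in> ?B" using that by auto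
    have t: "0 < t" using that t0 by simp
    have "\<bar>K t z\<bar> = 1 / t ^ (?n + 1) * \<bar>bump_divergence x (x + t *\<^sub>R e) t z\<bar>"
      using t by (simp add: K_def abs_mult)
    also have "\<dots> \<le> 1 / (t0 / 2) ^ (?n + 1) * (?n + 8)"
      using bump_divergence_bound(1)[OF t e, of x z] that t0 t
      by (intro mult_mono divide_left_mono power_mono) auto
    also have "\<dots> = Cb * indicator ?B z" using z by (simp add: Cb_def mult.commute)
    finally show ?thesis .
  qed
  have div_cont: "continuous_on UNIV (\<lambda>z. bump_divergence x (x + t *\<^sub>R e) t z)" if "0 < t" for t
    unfolding bump_divergence_def
    by (intro continuous_on_sum test_function_bounds(2)[OF test[OF that]])
  have Km[measurable]: "K t \<in> borel_measurable lebesgue" if "0 < t" for t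
    unfolding K_def[abs_def] using borel_measurable_lebesgue_continuous[OF div_cont[OF that]] by measurable
  have "((\<lambda>t. LINT z|lebesgue. f z * (1 / t ^ ?n * bump (x + t *\<^sub>R e) t z)) has_real_derivative
      (LINT z|lebesgue. f z * K t0 z)) (at t0)"
  proof (rule has_real_derivative_integral[where a="t0 / 2" and b="2 * t0" and w="\<lambda>z. \<bar>f z * (Cb * indicator ?B z)\<bar>"])
    show "t0 / 2 < t0" "t0 < 2 * t0" using t0 by auto
    fix t assume tt: "t0 / 2 < t" "t < 2 * t0"
    then have t: "0 < t" using t0 by simp
    have "integrable lebesgue (\<lambda>z. (f z * bump (x + t *\<^sub>R e) t z) * (1 / t ^ ?n))"
      by (intro integrable_mult_left integrable_mult_bump f t)
    then show "integrable lebesgue (\<lambda>z. f z * (1 / t ^ ?n * bump (x + t *\<^sub>R e) t z))"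
      by (simp add: mult_ac)
    show "((\<lambda>t. f z * (1 / t ^ ?n * bump (x + t *\<^sub>R e) t z)) has_real_derivative f z * K t z) (at t)" for z
      unfolding K_def by (intro DERIV_cmult DERIV_scaled_bump t)
    show "\<bar>f z * K t z\<bar> \<le> \<bar>f z * (Cb * indicator ?B z)\<bar>" for z
      unfolding abs_mult using Kb[OF tt, of z] Cb by (intro mult_left_mono) auto
  next
    have "integrable lebesgue (\<lambda>z. f z * (Cb * indicator ?B z))"
    proof (rule integrable_locally_integrable_mult[OF f, of _ ?B Cb])
      show "(\<lambda>z. Cb * indicator ?B z) \<in> borel_measurable lebesgue" by measurable
    qed (auto simp: Cb indicator_def)
    then show "integrable lebesgue (\<lambda>z. \<bar>f z * (Cb * indicator ?B z)\<bar>)" by (rule integrable_abs)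
    show "(\<lambda>z. f z * K t0 z) \<in> borel_measurable lebesgue" using Km[OF t0] by measurable
  qed
  moreover have "(LINT z|lebesgue. f z * (1 / t ^ ?n * bump (x + t *\<^sub>R e) t z)) = bump_mean f (x + t *\<^sub>R e) t" for t
    unfolding bump_mean_def by (subst integral_mult_right_zero[symmetric]) (simp add: mult_ac)
  moreover have "(LINT z|lebesgue. f z * K t0 z)
      = 1 / t0 ^ (?n + 1) * (LINT z|lebesgue. (G z \<bullet> (z - x)) * bump (x + t0 *\<^sub>R e) t0 z)"
  proof -
    have "(LINT z|lebesgue. f z * K t0 z) =
        (LINT z|lebesgue. - (1 / t0 ^ (?n + 1)) * (\<Sum>j\<in>Basis. f z * frechet_derivative (?\<phi> t0 j) (at z) j))"
      unfolding K_def bump_divergence_def by (simp only: sum_distrib_left[symmetric] mult.left_commute)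
    also have "\<dots> = - (1 / t0 ^ (?n + 1)) * (\<Sum>j\<in>Basis. LINT z|lebesgue. f z * frechet_derivative (?\<phi> t0 j) (at z) j)"
      using integrable_test_function(2)[OF f test[OF t0]]
      by (subst integral_mult_right_zero) (simp add: Bochner_Integration.integral_sum)
    also have "(\<Sum>j\<in>Basis. LINT z|lebesgue. f z * frechet_derivative (?\<phi> t0 j) (at z) j)
        = (\<Sum>j\<in>Basis. - (LINT z|lebesgue. (G z \<bullet> j) * ?\<phi> t0 j z))"
      using G test[OF t0] by (intro sum.cong) (auto simp: weak_gradient_def)
    also have "\<dots> = - (LINT z|lebesgue. (\<Sum>j\<in>Basis. (G z \<bullet> j) * ?\<phi> t0 j z))"
      using integrable_test_function(1)[OF locally_integrable_inner[OF Gl] test[OF t0]]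
      by (simp add: Bochner_Integration.integral_sum sum_negf)
    also have "(\<lambda>z. \<Sum>j\<in>Basis. (G z \<bullet> j) * ?\<phi> t0 j z) = (\<lambda>z. (G z \<bullet> (z - x)) * bump (x + t0 *\<^sub>R e) t0 z)"
      by (rule ext) (simp only: euclidean_inner[of "G _" "_ - x"] sum_distrib_right mult.assoc)
    finally show ?thesis by simp
  qed
  ultimately show ?thesis by (simp only:)
qed

text \<open>
  On the support of the bump |z - x| \<le> 2 t, so the integral is at most 2 t times the integral of |G| over
  the ball of radius 2 t around x.
\<close>

lemma bump_mean_derivative_bound:
  fixes f :: "'a::euclidean_space \<Rightarrow> real" and G :: "'a \<Rightarrow> 'a"
  assumes G: "weak_gradient f G" and e: "norm e \<le> 1" and t: "0 < t"
    and M: "maximal_function (\<lambda>z. ennreal (norm (G z))) x \<le> ennreal m" and m: "0 \<le> m"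
  shows "\<bar>1 / t ^ (DIM('a) + 1) * (LINT z|lebesgue. (G z \<bullet> (z - x)) * bump (x + t *\<^sub>R e) t z)\<bar>
    \<le> 2 ^ (DIM('a) + 1) * m"
proof -
  let ?I = "LINT z|lebesgue. (G z \<bullet> (z - x)) * bump (x + t *\<^sub>R e) t z"
  let ?n = "DIM('a)"
  have Gl: "locally_integrable G" using G by (simp add: weak_gradient_def)
  have Gm[measurable]: "G \<in> borel_measurable lebesgue" using Gl by (simp add: locally_integrable_def)
  have "ennreal \<bar>?I\<bar> \<le> (\<integral>\<^sup>+z. ennreal (norm ((G z \<bullet> (z - x)) * bump (x + t *\<^sub>R e) t z)) \<partial>lebesgue)"
    by (rule ennreal_abs_integral_le)
  also have "\<dots> \<le> (\<integral>\<^sup>+z. ennreal (2 * t) * (ennreal (norm (G z)) * indicator (cball x (2 * t)) z) \<partial>lebesgue)"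
  proof (rule nn_integral_mono)
    fix z
    show "ennreal (norm ((G z \<bullet> (z - x)) * bump (x + t *\<^sub>R e) t z))
      \<le> ennreal (2 * t) * (ennreal (norm (G z)) * indicator (cball x (2 * t)) z)"
    proof (cases "z \<in> cball (x + t *\<^sub>R e) t")
      case False
      then show ?thesis using bump_eq_0[OF t False] by simp
    next
      case True
      then have zx: "norm (z - x) \<le> 2 * t"
        using cball_along_cone[OF t e True] by (simp add: dist_norm norm_minus_commute)
      have "norm ((G z \<bullet> (z - x)) * bump (x + t *\<^sub>R e) t z) = \<bar>G z \<bullet> (z - x)\<bar> * bump (x + t *\<^sub>R e) t z"
        by (simp add: abs_mult bump_nonneg)
      also have "\<dots> \<le> (norm (G z) * (2 * t)) * 1"
      proof (intro mult_mono bump_le_1)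
        have "\<bar>G z \<bullet> (z - x)\<bar> \<le> norm (G z) * norm (z - x)" by (rule Cauchy_Schwarz_ineq2)
        also have "\<dots> \<le> norm (G z) * (2 * t)" using zx by (intro mult_left_mono) auto
        finally show "\<bar>G z \<bullet> (z - x)\<bar> \<le> norm (G z) * (2 * t)" .
      qed (use t in \<open>auto simp: bump_nonneg\<close>)
      finally have "ennreal (norm ((G z \<bullet> (z - x)) * bump (x + t *\<^sub>R e) t z)) \<le> ennreal (2 * t * norm (G z))"
        by (intro ennreal_leI) (simp add: mult.commute)
      also have "\<dots> = ennreal (2 * t) * (ennreal (norm (G z)) * indicator (cball x (2 * t)) z)"
        using t zx by (simp add: ennreal_mult dist_norm norm_minus_commute)
      finally show ?thesis .
    qed
  qed
  also have "\<dots> = ennreal (2 * t) * (\<integral>\<^sup>+z\<in>cball x (2 * t). ennreal (norm (G z)) \<partial>lebesgue)"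
    by (rule nn_integral_cmult) measurable
  also have "(\<integral>\<^sup>+z\<in>cball x (2 * t). ennreal (norm (G z)) \<partial>lebesgue)
      = ennreal ((2 * t) ^ ?n) * (ennreal (1 / (2 * t) ^ ?n) * (\<integral>\<^sup>+z\<in>cball x (2 * t). ennreal (norm (G z)) \<partial>lebesgue))"
  proof -
    have "ennreal ((2 * t) ^ ?n) * ennreal (1 / (2 * t) ^ ?n) = 1"
      using t by (simp flip: ennreal_mult)
    then show ?thesis by (simp only: mult.assoc[symmetric] mult_1)
  qed
  also have "ennreal (2 * t) * \<dots> \<le> ennreal (2 * t) * (ennreal ((2 * t) ^ ?n) * ennreal m)"
    using maximal_function_upper[where r="2 * t" and x=x and u="\<lambda>z. ennreal (norm (G z))"] M t
    by (intro mult_left_mono) auto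
  also have "\<dots> = ennreal ((2 * t) ^ (?n + 1) * m)"
    using t m by (simp add: ennreal_mult[symmetric] mult_ac)
  finally have I: "\<bar>?I\<bar> \<le> (2 * t) ^ (?n + 1) * m"
    using t m by (subst (asm) ennreal_le_iff) auto
  have "\<bar>1 / t ^ (?n + 1) * ?I\<bar> = 1 / t ^ (?n + 1) * \<bar>?I\<bar>" using t by (simp add: abs_mult)
  also have "\<dots> \<le> 1 / t ^ (?n + 1) * ((2 * t) ^ (?n + 1) * m)"
    using I t by (intro mult_left_mono) auto
  also have "\<dots> = 2 ^ (?n + 1) * m" using t by (simp add: power_mult_distrib field_simps)
  finally show ?thesis .
qed

text \<open>
  The bump average of f - f x is bounded by the mean oscillation over the ball of radius 2 s. The bound
  does not depend on e, so a Lebesgue point serves all directions at once.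
\<close>

lemma bump_mean_tendsto:
  fixes f :: "'a::euclidean_space \<Rightarrow> real"
  assumes f: "locally_integrable f" and x: "(mean_oscillation f x \<longlongrightarrow> 0) (at_right 0)" and e: "norm e \<le> 1"
  shows "((\<lambda>s. bump_mean f (x + s *\<^sub>R e) s) \<longlongrightarrow> bump_mass TYPE('a) * f x) (at_right 0)"
proof -
  let ?n = "DIM('a)"
  let ?c = "bump_mass TYPE('a)"
  have [measurable]: "f \<in> borel_measurable lebesgue" using f by (simp add: locally_integrable_def)
  have bound: "ennreal \<bar>bump_mean f (x + s *\<^sub>R e) s - ?c * f x\<bar> \<le> ennreal (2 ^ ?n) * mean_oscillation f x (2 * s)"
    if s: "0 < s" for s
  proof -
    let ?b = "bump (x + s *\<^sub>R e) s"
    have "?c * f x = 1 / s ^ ?n * (LINT z|lebesgue. f x * ?b z)"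
      using s by (simp add: integral_bump)
    then have "bump_mean f (x + s *\<^sub>R e) s - ?c * f x = 1 / s ^ ?n * ((LINT z|lebesgue. f z * ?b z) - (LINT z|lebesgue. f x * ?b z))"
      unfolding bump_mean_def by (simp add: right_diff_distrib)
    also have "(LINT z|lebesgue. f z * ?b z) - (LINT z|lebesgue. f x * ?b z) = (LINT z|lebesgue. (f z - f x) * ?b z)"
      using integrable_mult_bump[OF f s] integrable_bump[OF s]
      by (subst Bochner_Integration.integral_diff[symmetric]) (auto simp: left_diff_distrib)
    finally have "ennreal \<bar>bump_mean f (x + s *\<^sub>R e) s - ?c * f x\<bar> = ennreal (1 / s ^ ?n) * ennreal \<bar>LINT z|lebesgue. (f z - f x) * ?b z\<bar>"
      using s by (simp add: abs_mult flip: ennreal_mult)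
    also have "ennreal \<bar>LINT z|lebesgue. (f z - f x) * ?b z\<bar> \<le> (\<integral>\<^sup>+z. ennreal (norm ((f z - f x) * ?b z)) \<partial>lebesgue)"
      by (rule ennreal_abs_integral_le)
    also have "\<dots> \<le> (\<integral>\<^sup>+z\<in>cball x (2 * s). ennreal \<bar>f z - f x\<bar> \<partial>lebesgue)"
    proof (rule nn_integral_mono)
      fix z
      show "ennreal (norm ((f z - f x) * ?b z)) \<le> ennreal \<bar>f z - f x\<bar> * indicator (cball x (2 * s)) z"
      proof (cases "z \<in> cball (x + s *\<^sub>R e) s")
        case False
        then show ?thesis using bump_eq_0[OF s False] by simp
      next
        case True
        then have "indicator (cball x (2 * s)) z = (1::ennreal)"
          using cball_along_cone[OF s e True] by simp
        moreover have "norm ((f z - f x) * ?b z) \<le> \<bar>f z - f x\<bar>"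
          by (simp add: abs_mult bump_nonneg mult_left_le[OF bump_le_1])
        ultimately show ?thesis by (simp add: ennreal_leI)
      qed
    qed
    finally have "ennreal \<bar>bump_mean f (x + s *\<^sub>R e) s - ?c * f x\<bar>
        \<le> ennreal (1 / s ^ ?n) * (\<integral>\<^sup>+z\<in>cball x (2 * s). ennreal \<bar>f z - f x\<bar> \<partial>lebesgue)"
      by (simp add: mult_left_mono)
    also have "ennreal (1 / s ^ ?n) = ennreal (2 ^ ?n) * ennreal (1 / (2 * s) ^ ?n)"
      using s by (simp add: power_mult_distrib flip: ennreal_mult)
    finally show ?thesis by (simp add: mean_oscillation_def mult.assoc)
  qed
  have "filterlim (\<lambda>s::real. 2 * s) (at_right 0) (at_right 0)"
    unfolding filterlim_at
    by (auto intro!: tendsto_eq_intros simp: eventually_at_filter)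
  then have "((\<lambda>s. mean_oscillation f x (2 * s)) \<longlongrightarrow> 0) (at_right 0)"
    by (rule filterlim_compose[OF x])
  then have "((\<lambda>s. ennreal (2 ^ ?n) * mean_oscillation f x (2 * s)) \<longlongrightarrow> ennreal (2 ^ ?n) * 0) (at_right 0)"
    by (intro tendsto_mult_ennreal tendsto_const) auto
  then have lim: "((\<lambda>s. ennreal (2 ^ ?n) * mean_oscillation f x (2 * s)) \<longlongrightarrow> 0) (at_right 0)"
    by simp
  have "((\<lambda>s. ennreal \<bar>bump_mean f (x + s *\<^sub>R e) s - ?c * f x\<bar>) \<longlongrightarrow> 0) (at_right 0)"
    by (rule tendsto_sandwich[OF _ _ tendsto_const lim])
      (use eventually_at_right_less[of "0::real"] in \<open>auto elim!: eventually_mono intro: bound\<close>)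
  then have "((\<lambda>s. \<bar>bump_mean f (x + s *\<^sub>R e) s - ?c * f x\<bar>) \<longlongrightarrow> 0) (at_right 0)"
    using tendsto_ennreal_iff[of "\<lambda>s. \<bar>bump_mean f (x + s *\<^sub>R e) s - ?c * f x\<bar>" "at_right 0" 0]
    by (simp only: ennreal_0 abs_ge_zero eventually_True order_refl)
  then have "((\<lambda>s. bump_mean f (x + s *\<^sub>R e) s - ?c * f x) \<longlongrightarrow> 0) (at_right 0)"
    by (rule tendsto_rabs_zero_cancel)
  then show ?thesis by (rule Lim_null[THEN iffD2])
qed

text \<open>
  The derivative bound makes the average Lipschitz in t; let the other endpoint tend to 0.
\<close>

lemma bump_mean_close:
  fixes f :: "'a::euclidean_space \<Rightarrow> real" and G :: "'a \<Rightarrow> 'a"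
  assumes G: "weak_gradient f G" and x: "(mean_oscillation f x \<longlongrightarrow> 0) (at_right 0)"
    and M: "maximal_function (\<lambda>z. ennreal (norm (G z))) x \<le> ennreal m" and m: "0 \<le> m"
    and e: "norm e \<le> 1" and t: "0 < t"
  shows "\<bar>bump_mean f (x + t *\<^sub>R e) t - bump_mass TYPE('a) * f x\<bar> \<le> 2 ^ (DIM('a) + 1) * m * t"
proof -
  let ?L = "2 ^ (DIM('a) + 1) * m"
  let ?F = "\<lambda>t. bump_mean f (x + t *\<^sub>R e) t"
  have f: "locally_integrable f" using G by (simp add: weak_gradient_def)
  have lip: "norm (?F t - ?F s) \<le> ?L * norm (t - s)" if s: "0 < s" for s
  proof (rule field_differentiable_bound[where S="{0<..}"])
    show "convex {0::real<..}" by (rule convex_real_interval)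
    show "(?F has_field_derivative 1 / z ^ (DIM('a) + 1) * (LINT y|lebesgue. (G y \<bullet> (y - x)) * bump (x + z *\<^sub>R e) z y))
        (at z within {0<..})" if "z \<in> {0<..}" for z
      using that by (intro has_field_derivative_at_within[OF bump_mean_has_derivative[OF G e]]) simp
    show "norm (1 / z ^ (DIM('a) + 1) * (LINT y|lebesgue. (G y \<bullet> (y - x)) * bump (x + z *\<^sub>R e) z y)) \<le> ?L"
      if "z \<in> {0<..}" for z
      using bump_mean_derivative_bound[OF G e _ M m, of z] that by simp
    show "t \<in> {0<..}" "s \<in> {0<..}" using t s by auto
  qed
  have lim: "((\<lambda>s. \<bar>?F t - ?F s\<bar>) \<longlongrightarrow> \<bar>?F t - bump_mass TYPE('a) * f x\<bar>) (at_right 0)"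
    by (intro tendsto_intros bump_mean_tendsto f x e)
  have "\<forall>\<^sub>F s in at_right 0. s \<in> {0<..<t}" by (rule eventually_at_right_real[OF t])
  then have "\<forall>\<^sub>F s in at_right 0. \<bar>?F t - ?F s\<bar> \<le> ?L * t"
  proof eventually_elim
    case (elim s)
    have "\<bar>?F t - ?F s\<bar> \<le> ?L * norm (t - s)" using lip[of s] elim by simp
    also have "\<dots> \<le> ?L * t" using elim m by (intro mult_left_mono) auto
    finally show ?case .
  qed
  then show ?thesis by (rule tendsto_upperbound[OF lim]) simp
qed

text \<open>
  With e the unit vector from x towards y and r half the distance, the path from x in direction e and the
  path from y in direction -e arrive at the same bump around the midpoint.
\<close>

lemma pointwise_maximal_estimate:
  fixes f :: "'a::euclidean_space \<Rightarrow> real" and G :: "'a \<Rightarrow> 'a"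
  assumes G: "weak_gradient f G"
    and x: "(mean_oscillation f x \<longlongrightarrow> 0) (at_right 0)" "(mean_oscillation f y \<longlongrightarrow> 0) (at_right 0)"
    and M: "maximal_function (\<lambda>z. ennreal (norm (G z))) x \<le> ennreal a"
      "maximal_function (\<lambda>z. ennreal (norm (G z))) y \<le> ennreal b"
    and ab: "0 \<le> a" "0 \<le> b"
  shows "\<bar>f x - f y\<bar> \<le> norm (x - y) * (2 ^ DIM('a) / bump_mass TYPE('a) * a + 2 ^ DIM('a) / bump_mass TYPE('a) * b)"
proof (cases "x = y")
  case False
  define r where "r = norm (y - x) / 2"
  have r: "0 < r" using False by (simp add: r_def)
  define e where "e = (1 / (2 * r)) *\<^sub>R (y - x)"
  have e: "norm e \<le> 1" using r by (simp add: e_def r_def)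
  have re: "r *\<^sub>R e = (1 / 2) *\<^sub>R (y - x)" using r by (simp add: e_def)
  have "y - (1 / 2) *\<^sub>R (y - x) = x + (1 / 2) *\<^sub>R (y - x)"
  proof -
    have "y - x = (1 / 2) *\<^sub>R (y - x) + (1 / 2) *\<^sub>R (y - x)" by (simp only: scaleR_half_double[symmetric] scaleR_add_right[symmetric])
    then show ?thesis by (simp add: algebra_simps)
  qed
  then have mid: "y + r *\<^sub>R (- e) = x + r *\<^sub>R e" by (simp add: re)
  let ?c = "bump_mass TYPE('a)"
  have c: "0 < ?c" by (rule bump_mass_pos)
  have "\<bar>bump_mean f (x + r *\<^sub>R e) r - ?c * f x\<bar> \<le> 2 ^ (DIM('a) + 1) * a * r"
    by (rule bump_mean_close[OF G x(1) M(1) ab(1) e r])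
  moreover have "\<bar>bump_mean f (x + r *\<^sub>R e) r - ?c * f y\<bar> \<le> 2 ^ (DIM('a) + 1) * b * r"
    using bump_mean_close[OF G x(2) M(2) ab(2), of "- e", OF _ r] e unfolding mid by simp
  ultimately have "\<bar>?c * f x - ?c * f y\<bar> \<le> 2 ^ (DIM('a) + 1) * a * r + 2 ^ (DIM('a) + 1) * b * r"
    by linarith
  also have "\<dots> = norm (x - y) * (2 ^ DIM('a) * a + 2 ^ DIM('a) * b)"
    by (simp add: r_def norm_minus_commute algebra_simps)
  finally have "?c * \<bar>f x - f y\<bar> \<le> norm (x - y) * (2 ^ DIM('a) * a + 2 ^ DIM('a) * b)"
    using c by (simp add: abs_mult flip: right_diff_distrib)
  then have "\<bar>f x - f y\<bar> \<le> norm (x - y) * (2 ^ DIM('a) * a + 2 ^ DIM('a) * b) / ?c"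
    using c by (simp add: le_divide_eq mult.commute)
  also have "\<dots> = norm (x - y) * (2 ^ DIM('a) / ?c * a + 2 ^ DIM('a) / ?c * b)"
    by (simp flip: add_divide_distrib)
  finally show ?thesis .
qed simp

section \<open>Almost everywhere convergent averages of tails\<close>

text \<open>
  The closure of a tail of the sequence under midpoints. Midpoints are all that the parallelogram
  identity needs, and they allow properties to be transferred from the sequence by induction.
\<close>

inductive_set midpoint_hull :: "(nat \<Rightarrow> 'a \<Rightarrow> real) \<Rightarrow> nat \<Rightarrow> ('a \<Rightarrow> real) set" for V n where
  tail: "n \<le> k \<Longrightarrow> V k \<in> midpoint_hull V n"
| midpoint: "u \<in> midpoint_hull V n \<Longrightarrow> v \<in> midpoint_hull V n \<Longrightarrow> (\<lambda>x. (u x + v x) / 2) \<in> midpoint_hull V n"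

lemma midpoint_hull_mono: "m \<le> n \<Longrightarrow> midpoint_hull V n \<subseteq> midpoint_hull V m"
proof
  fix u assume "m \<le> n" "u \<in> midpoint_hull V n"
  then show "u \<in> midpoint_hull V m"
    by (induction rule: midpoint_hull.induct[consumes 1, OF \<open>u \<in> midpoint_hull V n\<close>])
      (auto intro: midpoint_hull.intros)
qed

lemma midpoint_hull_measurable:
  assumes "u \<in> midpoint_hull V n" "\<And>k. V k \<in> borel_measurable M"
  shows "u \<in> borel_measurable M"
  using assms by induction (auto intro: borel_measurable_divide borel_measurable_add)

lemma midpoint_hull_bounded:
  assumes "u \<in> midpoint_hull V n" "\<And>k x. \<bar>V k x\<bar> \<le> C"
  shows "\<bar>u x\<bar> \<le> C"
  using assms(1)
proof induction
  case (midpoint u v)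
  then show ?case by (simp add: abs_le_iff)
qed (rule assms(2))

lemma AE_convergent_of_L1_summable:
  fixes u :: "nat \<Rightarrow> 'a \<Rightarrow> real"
  assumes [measurable]: "\<And>k. u k \<in> borel_measurable M"
    and sum: "(\<Sum>k. \<integral>\<^sup>+x. ennreal \<bar>u (Suc k) x - u k x\<bar> \<partial>M) < \<infinity>"
  shows "AE x in M. convergent (\<lambda>k. u k x)"
proof -
  have "(\<integral>\<^sup>+x. (\<Sum>k. ennreal \<bar>u (Suc k) x - u k x\<bar>) \<partial>M) = (\<Sum>k. \<integral>\<^sup>+x. ennreal \<bar>u (Suc k) x - u k x\<bar> \<partial>M)"
    by (rule nn_integral_suminf) measurable
  then have "AE x in M. (\<Sum>k. ennreal \<bar>u (Suc k) x - u k x\<bar>) \<noteq> \<infinity>"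
    using sum by (intro nn_integral_PInf_AE) auto
  then show ?thesis
  proof eventually_elim
    case (elim x)
    then have "summable (\<lambda>k. \<bar>u (Suc k) x - u k x\<bar>)"
      by (intro summable_suminf_not_top) auto
    then have "summable (\<lambda>k. u (Suc k) x - u k x)"
      by (rule summable_rabs_cancel)
    then have "convergent (\<lambda>n. \<Sum>k<n. (u (Suc k) x - u k x))"
      by (simp add: summable_iff_convergent)
    then have "convergent (\<lambda>n. u n x - u 0 x)" by (simp add: sum_lessThan_telescope[of "\<lambda>n. u n x"])
    then show ?case
      using convergent_add[OF _ convergent_const[of "u 0 x"]] by fastforce
  qed
qed

text \<open>
  As for the element of minimal norm of a convex set in a Hilbert space: the infima d of the squared L2 norms
  over the hulls of the tails increase with n to a finite limit. The parallelogram identity therefore makes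
  almost minimal elements u a Cauchy sequence in L2, and a subsequence that converges fast enough converges
  almost everywhere.
\<close>

lemma (in finite_measure) midpoint_hull_AE_convergent:
  fixes V :: "nat \<Rightarrow> 'a \<Rightarrow> real"
  assumes Vm: "\<And>k. V k \<in> borel_measurable M" and Vb: "\<And>k x. \<bar>V k x\<bar> \<le> C"
  obtains U where "\<And>n. U n \<in> midpoint_hull V n" "AE x in M. convergent (\<lambda>n. U n x)"
proof -
  let ?H = "midpoint_hull V"
  have C: "0 \<le> C" using Vb[of 0 undefined] by linarith
  have Hm[measurable]: "u \<in> borel_measurable M" if "u \<in> ?H n" for u n
    using that Vm by (rule midpoint_hull_measurable)
  have Hb: "\<bar>u x\<bar> \<le> C" if "u \<in> ?H n" for u n x
    using that Vb by (rule midpoint_hull_bounded)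
  have int: "integrable M (\<lambda>x. (a * u x + b * v x)\<^sup>2)" if "u \<in> ?H n" "v \<in> ?H m" for u v n m and a b :: real
  proof (rule integrable_const_bound[where B="(\<bar>a\<bar> * C + \<bar>b\<bar> * C)\<^sup>2"])
    show "AE x in M. norm ((a * u x + b * v x)\<^sup>2) \<le> (\<bar>a\<bar> * C + \<bar>b\<bar> * C)\<^sup>2"
    proof (rule AE_I2)
      fix x
      have "\<bar>a * u x + b * v x\<bar> \<le> \<bar>a\<bar> * \<bar>u x\<bar> + \<bar>b\<bar> * \<bar>v x\<bar>"
        by (metis abs_mult abs_triangle_ineq)
      also have "\<dots> \<le> \<bar>a\<bar> * C + \<bar>b\<bar> * C"
        using Hb that by (intro add_mono mult_left_mono) auto
      finally show "norm ((a * u x + b * v x)\<^sup>2) \<le> (\<bar>a\<bar> * C + \<bar>b\<bar> * C)\<^sup>2"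
        by (simp add: abs_le_square_iff[symmetric])
    qed
    show "(\<lambda>x. (a * u x + b * v x)\<^sup>2) \<in> borel_measurable M"
      using Hm[OF that(1)] Hm[OF that(2)] by measurable
  qed
  define N where "N u = (\<integral>x. (u x)\<^sup>2 \<partial>M)" for u :: "'a \<Rightarrow> real"
  have N0: "0 \<le> N u" for u by (simp add: N_def)
  define d where "d n = (INF u\<in>?H n. N u)" for n
  have bdd: "bdd_below (N ` ?H n)" for n by (rule bdd_belowI[of _ 0]) (auto simp: N0)
  have ne: "?H n \<noteq> {}" for n using midpoint_hull.tail[of n n V] by auto
  have d_le: "d n \<le> N u" if "u \<in> ?H n" for u n
    unfolding d_def by (rule cINF_lower[OF bdd that])
  have inc: "incseq d"
    unfolding incseq_def d_def by (intro allI impI cINF_superset_mono ne bdd midpoint_hull_mono) auto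
  have "d n \<le> measure M (space M) * C\<^sup>2" for n
  proof -
    have "d n \<le> N (V n)" by (rule d_le) (rule midpoint_hull.tail, simp)
    also have "N (V n) \<le> (\<integral>x. C\<^sup>2 \<partial>M)"
      unfolding N_def using int[of "V n" n "V n" n 1 0] midpoint_hull.tail[of n n V] Vb C
      by (intro integral_mono) (auto simp: abs_le_square_iff[symmetric])
    finally show ?thesis by simp
  qed
  then obtain dl where dl: "d \<longlonglongrightarrow> dl" using incseq_convergent[OF inc] by blast
  have d_dl: "d n \<le> dl" for n by (rule incseq_le[OF inc dl])
  have "\<exists>u\<in>?H n. N u < d n + 1 / Suc n" for n
    using cINF_less_iff[OF ne bdd, of n "d n + 1 / Suc n"] by (auto simp: d_def)
  then obtain u where u: "\<And>n. u n \<in> ?H n" "\<And>n. N (u n) < d n + 1 / Suc n" by metis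
  define \<delta> where "\<delta> n = 2 * (dl - d n) + 4 / Suc n" for n
  \<comment> \<open>Parallelogram identity; the midpoint of u m and u n lies in the hull of the n-th tail.\<close>
  have diff: "(\<integral>x. (u m x - u n x)\<^sup>2 \<partial>M) \<le> \<delta> n" if "n \<le> m" for n m
  proof -
    have um: "u m \<in> ?H n" using u(1)[of m] midpoint_hull_mono[OF that] by auto
    have i: "integrable M (\<lambda>x. (u m x)\<^sup>2)" "integrable M (\<lambda>x. (u n x)\<^sup>2)"
      "integrable M (\<lambda>x. ((u m x + u n x) / 2)\<^sup>2)"
      using int[OF um u(1)[of n], of 1 0] int[OF um u(1)[of n], of 0 1] int[OF um u(1)[of n], of "1/2" "1/2"]
      by (simp_all add: add_divide_distrib)
    have "(\<integral>x. (u m x - u n x)\<^sup>2 \<partial>M) = (\<integral>x. 2 * (u m x)\<^sup>2 + 2 * (u n x)\<^sup>2 - 4 * ((u m x + u n x) / 2)\<^sup>2 \<partial>M)"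
      by (intro Bochner_Integration.integral_cong) (auto simp: power2_eq_square field_simps)
    also have "\<dots> = 2 * N (u m) + 2 * N (u n) - 4 * N (\<lambda>x. (u m x + u n x) / 2)"
      using i unfolding N_def by simp
    also have "\<dots> \<le> 2 * (d m + 1 / Suc m) + 2 * (d n + 1 / Suc n) - 4 * d n"
    proof -
      have "2 * a + 2 * b - 4 * c \<le> 2 * A + 2 * B - 4 * D" if "a < A" "b < B" "D \<le> c" for a b c A B D :: real
        using that by linarith
      then show ?thesis
        using u(2)[of m] u(2)[of n] d_le[OF midpoint_hull.midpoint[OF um u(1)[of n]]] .
    qed
    also have "\<dots> \<le> \<delta> n"
    proof -
      have "1 / real (Suc m) \<le> 1 / real (Suc n)" using that by (simp add: field_simps)
      then show ?thesis using d_dl[of m] by (simp add: \<delta>_def)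
    qed
    finally show ?thesis .
  qed
  have "\<delta> \<longlonglongrightarrow> 2 * (dl - dl) + 4 * 0"
    unfolding \<delta>_def using LIMSEQ_Suc[OF lim_1_over_n[where 'a=real]]
    by (intro tendsto_intros dl) (auto dest: tendsto_mult_left[of _ 0 _ 4])
  then have "\<forall>\<^sub>F n in sequentially. \<delta> n < (1 / 4) ^ k" for k :: nat
    by (intro order_tendstoD(2)) auto
  then have "\<exists>n0. \<forall>n\<ge>n0. \<delta> n < (1 / 4) ^ k" for k :: nat by (simp add: eventually_sequentially)
  then obtain n0 where n0: "\<And>k n. n0 k \<le> n \<Longrightarrow> \<delta> n < (1 / 4) ^ k" by metis
  \<comment> \<open>This choice makes r increasing, at least n0 k so that successive squared L2 distances are below
    4^(-k), and at least k so that u (r k) belongs to the hull of the k-th tail.\<close>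
  define r where "r k = k + (\<Sum>i\<le>k. n0 i)" for k
  have r: "k \<le> r k" "n0 k \<le> r k" "r k \<le> r (Suc k)" for k
    using member_le_sum[of k "{..k}" n0] by (auto simp: r_def)
  have L1: "(\<integral>\<^sup>+x. ennreal \<bar>u (r (Suc k)) x - u (r k) x\<bar> \<partial>M) \<le> ennreal ((measure M (space M) + 1) * (1 / 2) ^ k)" for k
  proof -
    let ?w = "\<lambda>x. u (r (Suc k)) x - u (r k) x"
    have i: "integrable M (\<lambda>x. (?w x)\<^sup>2)"
      using int[OF u(1) u(1), of 1 "r (Suc k)" "-1" "r k"] by simp
    have "(\<integral>\<^sup>+x. ennreal \<bar>?w x\<bar> \<partial>M) \<le> (\<integral>\<^sup>+x. ennreal ((1 / 2) ^ k + 2 ^ k * (?w x)\<^sup>2) \<partial>M)"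
    proof (intro nn_integral_mono ennreal_leI)
      fix x
      \<comment> \<open>A substitute for the Cauchy-Schwarz inequality that passes from L2 to L1.\<close>
      show "\<bar>?w x\<bar> \<le> (1 / 2) ^ k + 2 ^ k * (?w x)\<^sup>2"
      proof (cases "\<bar>?w x\<bar> \<le> (1 / 2) ^ k")
        case False
        then have "(1 / 2) ^ k * \<bar>?w x\<bar> \<le> \<bar>?w x\<bar> * \<bar>?w x\<bar>" by (intro mult_right_mono) auto
        then have "2 ^ k * ((1 / 2) ^ k * \<bar>?w x\<bar>) \<le> 2 ^ k * (?w x)\<^sup>2"
          by (intro mult_left_mono) (auto simp: power2_eq_square abs_mult[symmetric])
        then have "\<bar>?w x\<bar> \<le> 2 ^ k * (?w x)\<^sup>2" by (simp add: power_divide)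
        then show ?thesis by (simp add: add_increasing)
      qed (simp add: add_increasing2)
    qed
    also have "\<dots> = ennreal (\<integral>x. (1 / 2) ^ k + 2 ^ k * (?w x)\<^sup>2 \<partial>M)"
      using i by (intro nn_integral_eq_integral) auto
    also have "(\<integral>x. (1 / 2) ^ k + 2 ^ k * (?w x)\<^sup>2 \<partial>M) = measure M (space M) * (1 / 2) ^ k + 2 ^ k * (\<integral>x. (?w x)\<^sup>2 \<partial>M)"
      using i by (subst Bochner_Integration.integral_add) auto
    also have "\<dots> \<le> measure M (space M) * (1 / 2) ^ k + 2 ^ k * (1 / 4) ^ k"
      using diff[OF r(3)[of k]] n0[OF r(2)[of k]] by (intro add_left_mono mult_left_mono) auto
    also have "(2::real) ^ k * (1 / 4) ^ k = (1 / 2) ^ k"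
      by (simp add: power_mult_distrib[symmetric])
    finally show ?thesis by (simp add: distrib_right ennreal_leI)
  qed
  have "(\<Sum>k. \<integral>\<^sup>+x. ennreal \<bar>u (r (Suc k)) x - u (r k) x\<bar> \<partial>M) \<le> (\<Sum>k. ennreal ((measure M (space M) + 1) * (1 / 2) ^ k))"
    by (intro suminf_le summableI L1)
  also have "\<dots> < \<infinity>"
    by (subst suminf_ennreal2) (auto intro!: summable_mult summable_geometric)
  finally have "AE x in M. convergent (\<lambda>k. u (r k) x)"
    using Hm[OF u(1)] by (intro AE_convergent_of_L1_summable)
  moreover have "u (r n) \<in> ?H n" for n using u(1)[of "r n"] midpoint_hull_mono[OF r(1)[of n]] by auto
  ultimately show thesis by (intro that[of "\<lambda>n. u (r n)"])
qed

section \<open>Weak gradients from difference quotients\<close>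

lemma translation_measurable [measurable]:
  "(\<lambda>x. x + a) \<in> lebesgue \<rightarrow>\<^sub>M (lebesgue :: 'a::euclidean_space measure)"
  and distr_translation: "distr lebesgue lebesgue (\<lambda>x. x + a) = (lebesgue :: 'a::euclidean_space measure)"
proof -
  have eq: "(\<lambda>x. a + (\<Sum>j\<in>Basis. (1 * (x \<bullet> j)) *\<^sub>R j)) = (\<lambda>x. x + a)"
    by (rule ext) (simp only: mult_1 euclidean_representation add.commute)
  show "(\<lambda>x. x + a) \<in> lebesgue \<rightarrow>\<^sub>M (lebesgue :: 'a measure)"
    using lebesgue_affine_measurable[of "\<lambda>_. 1" a] unfolding eq by simp
  have "lebesgue = density (distr lebesgue lebesgue (\<lambda>x. x + a)) (\<lambda>_. 1)"
    using lebesgue_affine_euclidean[of "\<lambda>_. 1" a] unfolding eq by simp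
  then show "distr lebesgue lebesgue (\<lambda>x. x + a) = (lebesgue :: 'a measure)"
    by (simp add: density_1)
qed

lemma integral_translation:
  fixes F :: "'a::euclidean_space \<Rightarrow> real"
  assumes "F \<in> borel_measurable lebesgue"
  shows "(LINT x|lebesgue. F (x + a)) = (LINT x|lebesgue. F x)"
  using integral_distr[OF translation_measurable assms, of a] by (simp add: distr_translation)

lemma integrable_translation:
  fixes F :: "'a::euclidean_space \<Rightarrow> real"
  assumes "integrable lebesgue F"
  shows "integrable lebesgue (\<lambda>x. F (x + a))"
  using integrable_distr_eq[OF translation_measurable borel_measurable_integrable[OF assms], of a] assms
  by (simp add: distr_translation)

lemma AE_translation:
  assumes "AE x in lebesgue. P x"
  shows "AE x in lebesgue. P (x + a :: 'a::euclidean_space)"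
proof -
  have "AE x in distr lebesgue lebesgue (\<lambda>x. x + a). P x" using assms by (simp only: distr_translation)
  then show ?thesis by (rule AE_distrD[OF translation_measurable])
qed

locale pointwise_gradient =
  fixes f g :: "'a::euclidean_space \<Rightarrow> real" and S :: "'a set"
  assumes f: "locally_integrable f" and g: "locally_integrable g"
    and g_nonneg: "\<And>x. 0 \<le> g x" and S: "S \<in> null_sets lebesgue"
    and ineq: "\<And>x y. x \<notin> S \<Longrightarrow> y \<notin> S \<Longrightarrow> \<bar>f x - f y\<bar> \<le> norm (x - y) * (g x + g y)"
begin

lemma fg_measurable[measurable]: "f \<in> borel_measurable lebesgue" "g \<in> borel_measurable lebesgue"
  using f g by (auto simp: locally_integrable_def)

text \<open>
  The difference quotient divided by the bound from the pointwise inequality. The truncation changes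
  it only on a null set and makes the bound valid everywhere. Where the denominator vanishes, the
  difference quotient vanishes almost everywhere as well, which agrees with division by 0 giving 0.
\<close>

definition slope :: "'a \<Rightarrow> real \<Rightarrow> 'a \<Rightarrow> real" where
  "slope e h x = max (- 1) (min 1 ((f (x + h *\<^sub>R e) - f x) / h / (g x + g (x + h *\<^sub>R e))))"

lemma slope_measurable [measurable]: "slope e h \<in> borel_measurable lebesgue"
proof -
  have [measurable]: "(\<lambda>x. f (x + h *\<^sub>R e)) \<in> borel_measurable lebesgue"
    "(\<lambda>x. g (x + h *\<^sub>R e)) \<in> borel_measurable lebesgue"
    by (rule measurable_compose[OF translation_measurable]; measurable)+
  show ?thesis unfolding slope_def[abs_def] by measurable
qed

lemma slope_bound: "\<bar>slope e h x\<bar> \<le> 1"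
  by (auto simp: slope_def)

lemma difference_quotient_eq:
  assumes h: "0 < h" and e: "norm e = 1"
  shows "AE x in lebesgue. (f (x + h *\<^sub>R e) - f x) / h = slope e h x * (g x + g (x + h *\<^sub>R e))"
proof -
  have "AE x in lebesgue. x \<notin> S" using S by (rule AE_not_in)
  moreover from this have "AE x in lebesgue. x + h *\<^sub>R e \<notin> S" by (rule AE_translation)
  ultimately show ?thesis
  proof eventually_elim
    case (elim x)
    let ?G = "g x + g (x + h *\<^sub>R e)"
    have "\<bar>f (x + h *\<^sub>R e) - f x\<bar> \<le> h * ?G"
      using ineq[OF elim(2) elim(1)] h e by (simp add: add.commute)
    then have le: "\<bar>(f (x + h *\<^sub>R e) - f x) / h\<bar> \<le> ?G"
      using h by (simp add: field_simps)
    show ?case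
    proof (cases "?G = 0")
      case True
      then show ?thesis using le by simp
    next
      case False
      then have G: "0 < ?G" using g_nonneg[of x] g_nonneg[of "x + h *\<^sub>R e"] by linarith
      have "\<bar>Q / ?G\<bar> \<le> 1" if "\<bar>Q\<bar> \<le> ?G" for Q
        using that G by (simp add: abs_divide divide_le_eq)
      moreover have "max (- 1) (min 1 Q) = Q" if "\<bar>Q\<bar> \<le> 1" for Q :: real
        using that by (auto simp: abs_le_iff)
      ultimately have "slope e h x = (f (x + h *\<^sub>R e) - f x) / h / ?G"
        using le unfolding slope_def by blast
      then show ?thesis using G by simp
    qed
  qed
qed

text \<open>
  Testing g(x + h e) slope(x) against \<phi> and substituting x - h e for x turns the slope into its translate,
  up to the difference of \<phi> and its translate. The two terms of the bound g x + g(x + h e) thus contribute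
  the two summands.
\<close>

definition symmetric_slope :: "'a \<Rightarrow> nat \<Rightarrow> 'a \<Rightarrow> real" where
  "symmetric_slope e k x = slope e (1 / Suc k) x + slope e (1 / Suc k) (x - (1 / Suc k) *\<^sub>R e)"

lemma symmetric_slope_bound: "\<bar>symmetric_slope e k x\<bar> \<le> 2"
  unfolding symmetric_slope_def
  using slope_bound[of e "1 / Suc k" x] slope_bound[of e "1 / Suc k" "x - (1 / Suc k) *\<^sub>R e"] by linarith

lemma slope_translation_measurable [measurable]:
  "(\<lambda>x. slope e h (x - a)) \<in> borel_measurable lebesgue"
  using measurable_compose[OF translation_measurable[of "- a"] slope_measurable[of e h]] by simp

lemma symmetric_slope_measurable [measurable]: "symmetric_slope e k \<in> borel_measurable lebesgue"
  unfolding symmetric_slope_def[abs_def] by measurable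

lemma integrable_mult_test_function:
  assumes \<phi>: "test_function \<phi>" and [measurable]: "u \<in> borel_measurable lebesgue" and u: "\<And>x. \<bar>u x\<bar> \<le> c"
  shows "integrable lebesgue (\<lambda>x. g x * (\<phi> x * u x))"
proof -
  note T = test_function_bounds[OF \<phi>]
  obtain C where C: "0 < C" "\<And>x. \<bar>\<phi> x\<bar> \<le> C"
    using continuous_compact_support_bounded[OF T(1) T(6) T(4)] by metis
  have [measurable]: "\<phi> \<in> borel_measurable lebesgue" by (rule borel_measurable_lebesgue_continuous[OF T(1)])
  show ?thesis
  proof (rule integrable_locally_integrable_mult[OF g _ T(6)])
    show "\<bar>\<phi> x * u x\<bar> \<le> C * c" for x
      unfolding abs_mult using C u by (intro mult_mono) (auto intro: less_imp_le)
    show "\<phi> x * u x = 0" if "x \<notin> closure {x. \<phi> x \<noteq> 0}" for x using T(4)[OF that] by simp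
  qed measurable
qed

text \<open>
  The translates are moved from f and from g onto the test function, whose difference quotients converge
  boundedly by the mean value theorem. This takes the place of the continuity of translations in L1.
\<close>

lemma symmetric_slope_weak_limit:
  assumes e: "e \<in> Basis" and \<phi>: "test_function \<phi>"
  shows "(\<lambda>k. LINT x|lebesgue. g x * (\<phi> x * symmetric_slope e k x))
    \<longlonglongrightarrow> - (LINT x|lebesgue. f x * frechet_derivative \<phi> (at x) e)"
proof -
  note T = test_function_bounds[OF \<phi>]
  have e1: "norm e = 1" using e by simp
  define h where "h k = 1 / real (Suc k)" for k
  have h: "0 < h k" "h k \<le> 1" for k by (auto simp: h_def)
  have h0: "h \<longlonglongrightarrow> 0" unfolding h_def by (rule LIMSEQ_Suc[OF lim_1_over_n])
  obtain R where "0 < R \<and> closure {x. \<phi> x \<noteq> 0} \<subseteq> ball 0 R"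
    using bounded_subset_ballD[OF compact_imp_bounded[OF T(6)], of 0] ..
  then have R: "0 < R" "closure {x. \<phi> x \<noteq> 0} \<subseteq> cball 0 R"
    using ball_subset_cball[of 0 R] by auto
  have \<phi>0: "\<phi> x = 0" if "x \<notin> cball 0 R" for x using T(4)[of x] R that by blast
  have \<phi>h0: "\<phi> (x - h k *\<^sub>R e) = 0" if "x \<notin> cball 0 (R + 1)" for x k
  proof (rule \<phi>0)
    have "norm x \<le> norm (x - h k *\<^sub>R e) + norm (h k *\<^sub>R e)" using norm_triangle_ineq[of "x - h k *\<^sub>R e" "h k *\<^sub>R e"] by simp
    moreover have "norm (h k *\<^sub>R e) \<le> 1" using h[of k] e1 by simp
    ultimately show "x - h k *\<^sub>R e \<notin> cball 0 R" using that by auto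
  qed
  have c\<phi>h: "continuous_on UNIV (\<lambda>x. \<phi> (x - h k *\<^sub>R e))" for k
    by (rule continuous_on_compose2[OF T(1)]) (auto intro!: continuous_intros)
  have [measurable]: "\<phi> \<in> borel_measurable lebesgue" "(\<lambda>x. \<phi> (x - h k *\<^sub>R e)) \<in> borel_measurable lebesgue" for k
    by (intro borel_measurable_lebesgue_continuous T(1) c\<phi>h)+
  obtain C where C: "0 < C" "\<And>x. \<bar>\<phi> x\<bar> \<le> C"
    using continuous_compact_support_bounded[OF T(1) T(6) T(4)] by metis
  obtain B where B: "0 < B" "\<And>x. \<bar>frechet_derivative \<phi> (at x) e\<bar> \<le> B"
    using continuous_compact_support_bounded[OF T(2)[OF e] T(6) T(5)] by metis
  have dirD: "((\<lambda>t. \<phi> (x + t *\<^sub>R e)) has_real_derivative frechet_derivative \<phi> (at (x + t *\<^sub>R e)) e) (at t)" for x t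
  proof -
    have "((\<lambda>t. \<phi> (x + t *\<^sub>R e)) has_derivative (\<lambda>s. frechet_derivative \<phi> (at (x + t *\<^sub>R e)) (s *\<^sub>R e))) (at t)"
      by (rule has_derivative_compose[OF _ T(3)]) (auto intro!: derivative_eq_intros)
    moreover have "linear (frechet_derivative \<phi> (at (x + t *\<^sub>R e)))"
      using T(3) has_derivative_linear by blast
    ultimately show ?thesis by (simp add: has_field_derivative_def linear_cmul mult.commute[of _ "frechet_derivative _ _ _"])
  qed
  define q where "q k x = (\<phi> (x - h k *\<^sub>R e) - \<phi> x) / h k" for k x
  have q_lim: "(\<lambda>k. q k x) \<longlonglongrightarrow> - frechet_derivative \<phi> (at x) e" for x
  proof -
    have "((\<lambda>t. (\<phi> (x + t *\<^sub>R e) - \<phi> x) / t) \<longlongrightarrow> frechet_derivative \<phi> (at x) e) (at 0)"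
      using dirD[of x 0] by (simp add: has_field_derivative_iff)
    moreover have "filterlim (\<lambda>k. - h k) (at 0) sequentially"
      unfolding filterlim_at using tendsto_minus[OF h0] by (auto simp: h_def intro!: always_eventually)
    ultimately have "(\<lambda>k. (\<phi> (x + (- h k) *\<^sub>R e) - \<phi> x) / (- h k)) \<longlonglongrightarrow> frechet_derivative \<phi> (at x) e"
      by (rule filterlim_compose)
    from tendsto_minus[OF this] show ?thesis by (simp add: q_def)
  qed
  have q_bound: "\<bar>q k x\<bar> \<le> B" for k x
  proof -
    have "norm (\<phi> (x + (- h k) *\<^sub>R e) - \<phi> (x + 0 *\<^sub>R e)) \<le> B * norm (- h k - 0)"
      by (rule field_differentiable_bound[where S=UNIV and f="\<lambda>t. \<phi> (x + t *\<^sub>R e)" and f'="\<lambda>t. frechet_derivative \<phi> (at (x + t *\<^sub>R e)) e"])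
        (use dirD B in auto)
    then show ?thesis using h[of k] by (simp add: q_def divide_le_eq)
  qed
  have q_supp: "q k x = 0" if "x \<notin> cball 0 (R + 1)" for k x
    using \<phi>h0[OF that, of k] \<phi>0[of x] that by (simp add: q_def)
  have [measurable]: "q k \<in> borel_measurable lebesgue" for k unfolding q_def[abs_def] by measurable
  let ?K = "cball 0 (R + 1) :: 'a set"
  have cK: "compact ?K" by simp
  have iB: "integrable lebesgue (\<lambda>x. \<bar>F x * (b * indicator ?K x)\<bar>)" if F: "locally_integrable F" and b: "0 \<le> b"
    for F :: "'a \<Rightarrow> real" and b :: real
  proof (rule integrable_abs, rule integrable_locally_integrable_mult[OF F _ cK])
    show "(\<lambda>x. b * indicator ?K x) \<in> borel_measurable lebesgue" by measurable
    show "\<bar>b * indicator ?K z\<bar> \<le> b" for z using b by (simp add: indicator_def)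
  qed simp
  have left: "(\<lambda>k. LINT x|lebesgue. f x * q k x) \<longlonglongrightarrow> (LINT x|lebesgue. f x * - frechet_derivative \<phi> (at x) e)"
  proof (rule integral_dominated_convergence[where w="\<lambda>x. \<bar>f x * (B * indicator ?K x)\<bar>"])
    show "integrable lebesgue (\<lambda>x. \<bar>f x * (B * indicator ?K x)\<bar>)" using B by (intro iB f) simp
    show "AE x in lebesgue. (\<lambda>k. f x * q k x) \<longlonglongrightarrow> f x * - frechet_derivative \<phi> (at x) e"
      by (intro AE_I2 tendsto_mult_left q_lim)
    show "AE x in lebesgue. norm (f x * q k x) \<le> \<bar>f x * (B * indicator ?K x)\<bar>" for k
    proof (rule AE_I2)
      fix x
      show "norm (f x * q k x) \<le> \<bar>f x * (B * indicator ?K x)\<bar>"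
        using q_bound[of k x] q_supp[of x k] B by (cases "x \<in> ?K") (auto simp: abs_mult intro!: mult_left_mono)
    qed
    show "(\<lambda>x. f x * - frechet_derivative \<phi> (at x) e) \<in> borel_measurable lebesgue"
      using borel_measurable_lebesgue_continuous[OF T(2)[OF e]] by measurable
  qed measurable
  define s where "s k = slope e (h k)" for k
  have [measurable]: "s k \<in> borel_measurable lebesgue" "(\<lambda>x. s k (x - h k *\<^sub>R e)) \<in> borel_measurable lebesgue" for k
    unfolding s_def by measurable
  have sb: "\<bar>s k x\<bar> \<le> 1" for k x by (simp add: s_def slope_bound)
  \<comment> \<open>The price of replacing the translate of \<phi> by \<phi> itself: it is of order h k.\<close>
  define err where "err k x = g x * ((\<phi> (x - h k *\<^sub>R e) - \<phi> x) * s k (x - h k *\<^sub>R e))" for k x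
  have err: "(\<lambda>k. LINT x|lebesgue. err k x) \<longlonglongrightarrow> (LINT x|(lebesgue::'a measure). 0)"
  proof (rule integral_dominated_convergence[where w="\<lambda>x. \<bar>g x * (B * indicator ?K x)\<bar>"])
    show "integrable lebesgue (\<lambda>x. \<bar>g x * (B * indicator ?K x)\<bar>)" using B by (intro iB g) simp
    have est: "\<bar>err k x\<bar> \<le> \<bar>g x\<bar> * (\<bar>q k x\<bar> * h k)" for k x
    proof -
      have "\<phi> (x - h k *\<^sub>R e) - \<phi> x = q k x * h k" using h[of k] by (simp add: q_def)
      then have "\<bar>err k x\<bar> = \<bar>g x\<bar> * (\<bar>q k x\<bar> * h k * \<bar>s k (x - h k *\<^sub>R e)\<bar>)"
        using h[of k] by (simp add: err_def abs_mult)
      also have "\<dots> \<le> \<bar>g x\<bar> * (\<bar>q k x\<bar> * h k * 1)"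
        using h[of k] sb by (intro mult_left_mono) auto
      finally show ?thesis by simp
    qed
    show "AE x in lebesgue. norm (err k x) \<le> \<bar>g x * (B * indicator ?K x)\<bar>" for k
    proof (rule AE_I2)
      fix x
      have "\<bar>q k x\<bar> * h k \<le> B * indicator ?K x"
      proof (cases "x \<in> ?K")
        case True
        have "\<bar>q k x\<bar> * h k \<le> B * 1" using q_bound[of k x] h[of k] B by (intro mult_mono) auto
        then show ?thesis using True by simp
      qed (simp add: q_supp)
      then have "\<bar>g x\<bar> * (\<bar>q k x\<bar> * h k) \<le> \<bar>g x\<bar> * (B * indicator ?K x)" by (intro mult_left_mono) auto
      with est[of k x] show "norm (err k x) \<le> \<bar>g x * (B * indicator ?K x)\<bar>"
        using B by (simp add: abs_mult)
    qed
    show "AE x in lebesgue. (\<lambda>k. err k x) \<longlonglongrightarrow> 0"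
    proof (rule AE_I2)
      fix x
      have lim: "(\<lambda>k. \<bar>g x\<bar> * (\<bar>q k x\<bar> * h k)) \<longlonglongrightarrow> \<bar>g x\<bar> * (\<bar>- frechet_derivative \<phi> (at x) e\<bar> * 0)"
        by (intro tendsto_intros q_lim h0)
      show "(\<lambda>k. err k x) \<longlonglongrightarrow> 0"
        by (rule Lim_null_comparison[of _ "\<lambda>k. \<bar>g x\<bar> * (\<bar>q k x\<bar> * h k)"]) (use est lim in auto)
    qed
    show "err k \<in> borel_measurable lebesgue" for k unfolding err_def[abs_def] by measurable
  qed measurable
  have main: "(LINT x|lebesgue. g x * (\<phi> x * symmetric_slope e k x)) = (LINT x|lebesgue. f x * q k x) - (LINT x|lebesgue. err k x)" for k
  proof -
    let ?a = "h k *\<^sub>R e"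
    have i1: "integrable lebesgue (\<lambda>x. f x * \<phi> x)" by (rule integrable_test_function(1)[OF f \<phi>])
    have i2: "integrable lebesgue (\<lambda>x. f x * \<phi> (x - ?a))"
      by (rule integrable_locally_integrable_continuous[OF f c\<phi>h cK \<phi>h0])
    have i2': "integrable lebesgue (\<lambda>x. f (x + ?a) * \<phi> x)"
      using integrable_translation[OF i2, of ?a] by simp
    have i3: "integrable lebesgue (\<lambda>x. g x * (\<phi> x * s k x))"
      by (rule integrable_mult_test_function[OF \<phi> _ sb]) measurable
    have i4: "integrable lebesgue (\<lambda>x. g x * (\<phi> (x - ?a) * s k (x - ?a)))"
    proof (rule integrable_locally_integrable_mult[OF g _ cK])
      show "\<phi> (z - ?a) * s k (z - ?a) = 0" if "z \<notin> ?K" for z using \<phi>h0[OF that] by simp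
      show "\<bar>\<phi> (z - ?a) * s k (z - ?a)\<bar> \<le> C * 1" for z unfolding abs_mult using C sb by (intro mult_mono) (auto intro: less_imp_le)
    qed measurable
    have i4': "integrable lebesgue (\<lambda>x. g (x + ?a) * (\<phi> x * s k x))"
      using integrable_translation[OF i4, of ?a] by simp
    have i5: "integrable lebesgue (\<lambda>x. g x * (\<phi> x * s k (x - ?a)))"
      by (rule integrable_mult_test_function[OF \<phi> _ sb]) measurable
    have "(LINT x|lebesgue. f x * q k x) = (LINT x|lebesgue. (f x * \<phi> (x - ?a) - f x * \<phi> x) / h k)"
      by (intro Bochner_Integration.integral_cong) (auto simp: q_def right_diff_distrib)
    also have "\<dots> = ((LINT x|lebesgue. f x * \<phi> (x - ?a)) - (LINT x|lebesgue. f x * \<phi> x)) / h k"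
      using i1 i2 by simp
    also have "(LINT x|lebesgue. f x * \<phi> (x - ?a)) = (LINT x|lebesgue. f (x + ?a) * \<phi> x)"
      using integral_translation[OF borel_measurable_integrable[OF i2], of ?a] by simp
    also have "((LINT x|lebesgue. f (x + ?a) * \<phi> x) - (LINT x|lebesgue. f x * \<phi> x)) / h k
      = (LINT x|lebesgue. (f (x + ?a) * \<phi> x - f x * \<phi> x) / h k)"
      using i1 i2' by simp
    also have "\<dots> = (LINT x|lebesgue. g x * (\<phi> x * s k x) + g (x + ?a) * (\<phi> x * s k x))"
    proof (rule integral_cong_AE)
      show "AE x in lebesgue. (f (x + ?a) * \<phi> x - f x * \<phi> x) / h k = g x * (\<phi> x * s k x) + g (x + ?a) * (\<phi> x * s k x)"
        using difference_quotient_eq[OF h(1)[of k] e1]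
      proof eventually_elim
        case (elim x)
        have "(f (x + ?a) * \<phi> x - f x * \<phi> x) / h k = (f (x + ?a) - f x) / h k * \<phi> x"
          by (simp add: left_diff_distrib)
        also have "\<dots> = s k x * (g x + g (x + ?a)) * \<phi> x" unfolding elim s_def ..
        finally show ?case by (simp add: algebra_simps)
      qed
    qed (use i1 i2' i3 i4' in \<open>auto intro!: borel_measurable_integrable[OF Bochner_Integration.integrable_add] borel_measurable_integrable[OF integrable_divide[OF Bochner_Integration.integrable_diff]]\<close>)
    also have "\<dots> = (LINT x|lebesgue. g x * (\<phi> x * s k x)) + (LINT x|lebesgue. g (x + ?a) * (\<phi> x * s k x))"
      by (rule Bochner_Integration.integral_add[OF i3 i4'])
    also have "(LINT x|lebesgue. g (x + ?a) * (\<phi> x * s k x)) = (LINT x|lebesgue. g x * (\<phi> (x - ?a) * s k (x - ?a)))"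
      using integral_translation[OF borel_measurable_integrable[OF i4], of ?a] by simp
    finally have A: "(LINT x|lebesgue. f x * q k x)
      = (LINT x|lebesgue. g x * (\<phi> x * s k x)) + (LINT x|lebesgue. g x * (\<phi> (x - ?a) * s k (x - ?a)))" .
    have "(LINT x|lebesgue. err k x) = (LINT x|lebesgue. g x * (\<phi> (x - ?a) * s k (x - ?a)) - g x * (\<phi> x * s k (x - ?a)))"
      by (intro Bochner_Integration.integral_cong) (auto simp: err_def algebra_simps)
    also have "\<dots> = (LINT x|lebesgue. g x * (\<phi> (x - ?a) * s k (x - ?a))) - (LINT x|lebesgue. g x * (\<phi> x * s k (x - ?a)))"
      by (rule Bochner_Integration.integral_diff[OF i4 i5])
    finally have E: "(LINT x|lebesgue. err k x)
      = (LINT x|lebesgue. g x * (\<phi> (x - ?a) * s k (x - ?a))) - (LINT x|lebesgue. g x * (\<phi> x * s k (x - ?a)))" .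
    have "(LINT x|lebesgue. g x * (\<phi> x * symmetric_slope e k x))
      = (LINT x|lebesgue. g x * (\<phi> x * s k x) + g x * (\<phi> x * s k (x - ?a)))"
      by (intro Bochner_Integration.integral_cong) (auto simp: symmetric_slope_def s_def h_def algebra_simps)
    also have "\<dots> = (LINT x|lebesgue. g x * (\<phi> x * s k x)) + (LINT x|lebesgue. g x * (\<phi> x * s k (x - ?a)))"
      by (rule Bochner_Integration.integral_add[OF i3 i5])
    finally show ?thesis using A E by linarith
  qed
  have "(\<lambda>k. (LINT x|lebesgue. f x * q k x) - (LINT x|lebesgue. err k x))
      \<longlonglongrightarrow> (LINT x|lebesgue. f x * - frechet_derivative \<phi> (at x) e) - (LINT x|(lebesgue::'a measure). 0)"
    by (intro tendsto_diff left err)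
  then show ?thesis by (simp add: main)
qed

end

lemma abs_midpoint_diff_le:
  fixes a b c d :: real
  assumes "\<bar>a - c\<bar> \<le> d" "\<bar>b - c\<bar> \<le> d"
  shows "\<bar>(a + b) / 2 - c\<bar> \<le> d"
  using assms by argo

context pointwise_gradient
begin

definition weak_partial :: "'a \<Rightarrow> ('a \<Rightarrow> real) \<Rightarrow> bool" where
  "weak_partial e v \<longleftrightarrow> (\<forall>\<phi>. test_function \<phi> \<longrightarrow>
     (LINT x|lebesgue. f x * frechet_derivative \<phi> (at x) e) = - (LINT x|lebesgue. v x * \<phi> x))"

text \<open>
  Averages U n of the tails of the symmetric slopes converge almost everywhere to some w. The integrals of
  g \<phi> U n inherit the limit of the integrals for the slopes, because the distance to that limit does not grow
  under midpoints, and they converge to the integral of g \<phi> w by dominated convergence.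
\<close>

lemma ex_weak_partial:
  assumes e: "e \<in> Basis"
  shows "\<exists>w. w \<in> borel_measurable lebesgue \<and> (\<forall>x. \<bar>w x\<bar> \<le> 2) \<and>
    weak_partial e (\<lambda>x. g x * w x)"
proof -
  let ?V = "symmetric_slope e"
  interpret L: sigma_finite_measure "lebesgue :: 'a measure" by (rule sigma_finite_lebesgue)
  \<comment> \<open>Convergence of the averages is available for finite measures; a positive integrable density gives
    one with the same null sets as Lebesgue measure.\<close>
  obtain h :: "'a \<Rightarrow> ennreal" where h: "h \<in> borel_measurable lebesgue" "integral\<^sup>N lebesgue h \<noteq> \<infinity>"
    "\<And>x. 0 < h x"
    using L.Ex_finite_integrable_function by auto
  have "emeasure (density lebesgue h) (space (density lebesgue h)) \<noteq> \<infinity>"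
    using h by (subst emeasure_density) (auto simp: space_density)
  then interpret D: finite_measure "density lebesgue h" by (rule finite_measureI)
  have "?V k \<in> borel_measurable (density lebesgue h)" for k by simp
  then obtain U where U: "\<And>n. U n \<in> midpoint_hull ?V n"
    and conv: "AE x in density lebesgue h. convergent (\<lambda>n. U n x)"
    using D.midpoint_hull_AE_convergent[of ?V 2] symmetric_slope_bound by metis
  have Um[measurable]: "U n \<in> borel_measurable lebesgue" for n
    using U symmetric_slope_measurable by (rule midpoint_hull_measurable)
  have Ub: "\<bar>U n x\<bar> \<le> 2" for n x
    using U symmetric_slope_bound by (rule midpoint_hull_bounded)
  define w where "w x = max (- 2) (min 2 (lim (\<lambda>n. U n x)))" for x
  have wm[measurable]: "w \<in> borel_measurable lebesgue"
    unfolding w_def[abs_def] by measurable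
  have wb: "\<bar>w x\<bar> \<le> 2" for x by (auto simp: w_def)
  have lim: "AE x in lebesgue. (\<lambda>n. U n x) \<longlonglongrightarrow> w x"
  proof -
    have "AE x in lebesgue. convergent (\<lambda>n. U n x)"
      using conv h by (simp add: AE_density)
    then show ?thesis
    proof eventually_elim
      case (elim x)
      then have *: "(\<lambda>n. U n x) \<longlonglongrightarrow> lim (\<lambda>n. U n x)" by (simp add: convergent_LIMSEQ_iff)
      have "\<bar>lim (\<lambda>n. U n x)\<bar> \<le> 2"
        using tendsto_rabs[OF *] by (rule LIMSEQ_le_const2) (use Ub in auto)
      then have "w x = lim (\<lambda>n. U n x)" by (auto simp: w_def abs_le_iff)
      with * show ?case by simp
    qed
  qed
  have "(LINT x|lebesgue. f x * frechet_derivative \<phi> (at x) e) = - (LINT x|lebesgue. g x * w x * \<phi> x)"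
    if \<phi>: "test_function \<phi>" for \<phi>
  proof -
    define L where "L = - (LINT x|lebesgue. f x * frechet_derivative \<phi> (at x) e)"
    let ?I = "\<lambda>u. LINT x|lebesgue. g x * (\<phi> x * u x)"
    have VL: "(\<lambda>k. ?I (?V k)) \<longlonglongrightarrow> L"
      unfolding L_def by (rule symmetric_slope_weak_limit[OF e \<phi>])
    have hull: "\<bar>?I u - L\<bar> \<le> \<epsilon>" if "u \<in> midpoint_hull ?V n" "\<And>k. n \<le> k \<Longrightarrow> \<bar>?I (?V k) - L\<bar> \<le> \<epsilon>" for u n \<epsilon>
      using that(1)
    proof induction
      case (tail k)
      then show ?case by (rule that(2))
    next
      case (midpoint u v)
      have "integrable lebesgue (\<lambda>x. g x * (\<phi> x * u x))" "integrable lebesgue (\<lambda>x. g x * (\<phi> x * v x))"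
        using midpoint.hyps symmetric_slope_measurable symmetric_slope_bound
        by (auto intro!: integrable_mult_test_function[OF \<phi>] intro: midpoint_hull_measurable midpoint_hull_bounded)
      then have eq: "?I (\<lambda>x. (u x + v x) / 2) = (?I u + ?I v) / 2"
        by (simp add: distrib_left add_divide_distrib)
      show ?case unfolding eq using midpoint.IH by (rule abs_midpoint_diff_le)
    qed
    have "(\<lambda>n. ?I (U n)) \<longlonglongrightarrow> L"
    proof (rule LIMSEQ_I)
      fix \<epsilon> :: real assume "0 < \<epsilon>"
      then obtain n0 where n0: "\<And>k. n0 \<le> k \<Longrightarrow> norm (?I (?V k) - L) < \<epsilon> / 2"
        using LIMSEQ_D[OF VL, of "\<epsilon> / 2"] by auto
      have "norm (?I (U n) - L) < \<epsilon>" if "n0 \<le> n" for n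
      proof -
        have "\<bar>?I (U n) - L\<bar> \<le> \<epsilon> / 2"
        proof (rule hull[OF U])
          show "\<bar>?I (?V k) - L\<bar> \<le> \<epsilon> / 2" if "n \<le> k" for k
            using n0[of k] that \<open>n0 \<le> n\<close> by simp
        qed
        then show ?thesis using \<open>0 < \<epsilon>\<close> by simp
      qed
      then show "\<exists>n0. \<forall>n\<ge>n0. norm (?I (U n) - L) < \<epsilon>" by blast
    qed
    moreover have "(\<lambda>n. ?I (U n)) \<longlonglongrightarrow> ?I w"
    proof (rule integral_dominated_convergence[where w="\<lambda>x. \<bar>g x * (\<phi> x * 2)\<bar>"])
      have [measurable]: "\<phi> \<in> borel_measurable lebesgue"
        by (rule borel_measurable_lebesgue_continuous[OF test_function_bounds(1)[OF \<phi>]])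
      show "integrable lebesgue (\<lambda>x. \<bar>g x * (\<phi> x * 2)\<bar>)"
        by (intro integrable_abs integrable_mult_test_function[OF \<phi>, of "\<lambda>_. 2" 2]) auto
      show "AE x in lebesgue. (\<lambda>n. g x * (\<phi> x * U n x)) \<longlonglongrightarrow> g x * (\<phi> x * w x)"
        using lim by eventually_elim (intro tendsto_intros)
      show "AE x in lebesgue. norm (g x * (\<phi> x * U n x)) \<le> \<bar>g x * (\<phi> x * 2)\<bar>" for n
        using Ub by (intro AE_I2) (simp add: abs_mult mult_left_mono)
      show "(\<lambda>x. g x * (\<phi> x * w x)) \<in> borel_measurable lebesgue" by measurable
      show "(\<lambda>x. g x * (\<phi> x * U n x)) \<in> borel_measurable lebesgue" for n by measurable
    qed
    ultimately have "L = ?I w" by (rule LIMSEQ_unique)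
    then show ?thesis by (simp add: L_def mult_ac)
  qed
  with wm wb show ?thesis unfolding weak_partial_def by (intro exI[of _ w] conjI allI impI)
qed

lemma ex_weak_gradient:
  shows "\<exists>G. weak_gradient f G \<and> (\<forall>x. norm (G x) \<le> real (2 * DIM('a)) * g x)"
proof -
  have "\<forall>e\<in>(Basis::'a set). \<exists>w. w \<in> borel_measurable lebesgue \<and> (\<forall>x. \<bar>w x\<bar> \<le> 2) \<and>
    weak_partial e (\<lambda>x. g x * w x)"
    using ex_weak_partial by (rule ballI)
  from bchoice[OF this]
  obtain w where W: "\<forall>e\<in>(Basis::'a set). w e \<in> borel_measurable lebesgue \<and> (\<forall>x. \<bar>w e x\<bar> \<le> 2) \<and>
    weak_partial e (\<lambda>x. g x * w e x)" ..
  have w: "\<And>e. e \<in> Basis \<Longrightarrow> w e \<in> borel_measurable lebesgue"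
    "\<And>e x. e \<in> Basis \<Longrightarrow> \<bar>w e x\<bar> \<le> 2"
    "\<And>e. e \<in> Basis \<Longrightarrow> weak_partial e (\<lambda>x. g x * w e x)"
    using W by blast+
  define G where "G x = (\<Sum>e\<in>Basis. (g x * w e x) *\<^sub>R e)" for x
  have G_inner: "G x \<bullet> e = g x * w e x" if "e \<in> Basis" for x e
    using that by (simp add: G_def inner_sum_left_Basis)
  have "locally_integrable G"
    unfolding locally_integrable_def
  proof (intro conjI allI impI)
    show "G \<in> borel_measurable lebesgue"
      unfolding G_def[abs_def] using w(1)
      by (intro borel_measurable_sum borel_measurable_scaleR borel_measurable_times fg_measurable) auto
    fix K :: "'a set" assume K: "compact K"
    have "integrable lebesgue (\<lambda>x. (indicator K x *\<^sub>R (g x * w e x)) *\<^sub>R e)" if e: "e \<in> Basis" for e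
    proof -
      have [measurable]: "w e \<in> borel_measurable lebesgue" by (rule w(1)[OF e])
      have [measurable]: "K \<in> sets lebesgue" using K by (simp add: lmeasurable_compact fmeasurableD)
      have "integrable lebesgue (\<lambda>x. g x * (indicator K x * w e x))"
      proof (rule integrable_locally_integrable_mult[OF g _ K])
        show "\<bar>indicator K x * w e x\<bar> \<le> 2" for x
          using w(2)[OF e, of x] by (simp add: indicator_def)
      qed auto
      then show ?thesis by (intro integrable_scaleR_left) (simp add: mult_ac)
    qed
    then have "integrable lebesgue (\<lambda>x. \<Sum>e\<in>Basis. (indicator K x *\<^sub>R (g x * w e x)) *\<^sub>R e)"
      by (intro Bochner_Integration.integrable_sum)
    then show "set_integrable lebesgue K G"
      by (simp add: set_integrable_def G_def scaleR_sum_right)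
  qed
  then have "weak_gradient f G"
    unfolding weak_gradient_def using f w(3) by (auto simp: G_inner weak_partial_def)
  moreover have "norm (G x) \<le> real (2 * DIM('a)) * g x" for x
  proof -
    have "norm (G x) \<le> (\<Sum>e\<in>(Basis::'a set). g x * 2)"
      unfolding G_def
    proof (intro order_trans[OF norm_sum] sum_mono)
      fix e :: 'a assume e: "e \<in> Basis"
      then have "norm ((g x * w e x) *\<^sub>R e) = g x * \<bar>w e x\<bar>" using g_nonneg by (simp add: abs_mult)
      also have "\<dots> \<le> g x * 2" using w(2)[OF e] g_nonneg by (intro mult_left_mono) auto
      finally show "norm ((g x * w e x) *\<^sub>R e) \<le> g x * 2" .
    qed
    then show ?thesis by (simp add: mult_ac)
  qed
  ultimately show ?thesis by (intro exI[of _ G] conjI allI)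
qed

end

section \<open>The characterisation\<close>

lemma function_space_locally_integrable:
  fixes f :: "'a::euclidean_space \<Rightarrow> real"
  assumes \<rho>: "function_norm lebesgue \<rho>" and f: "f \<in> function_space lebesgue \<rho>"
  shows "locally_integrable f"
proof -
  interpret function_norm lebesgue \<rho> by fact
  have [measurable]: "f \<in> borel_measurable lebesgue" and fin: "\<rho> (\<lambda>x. ennreal \<bar>f x\<bar>) < \<infinity>"
    using f by (auto simp: function_space_def)
  have "set_integrable lebesgue K f" if K: "compact K" for K
    unfolding set_integrable_def integrable_iff_bounded
  proof
    have KL: "K \<in> lmeasurable" using K by (rule lmeasurable_compact)
    then have [measurable]: "K \<in> sets lebesgue" by (rule fmeasurableD)
    show "(\<lambda>x. indicat_real K x *\<^sub>R f x) \<in> borel_measurable lebesgue" by measurable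
    have "emeasure lebesgue K < \<infinity>" using KL by (auto simp: fmeasurable_def)
    then obtain C where C: "\<And>f. f \<in> borel_measurable lebesgue \<Longrightarrow> (\<integral>\<^sup>+x\<in>K. f x \<partial>lebesgue) \<le> ennreal C * \<rho> f"
      using local_bound[of K] by (metis \<open>K \<in> sets lebesgue\<close>)
    have "(\<integral>\<^sup>+x. ennreal (norm (indicat_real K x *\<^sub>R f x)) \<partial>lebesgue) = (\<integral>\<^sup>+x\<in>K. ennreal \<bar>f x\<bar> \<partial>lebesgue)"
      by (intro nn_integral_cong) (auto simp: indicator_def)
    also have "\<dots> \<le> ennreal C * \<rho> (\<lambda>x. ennreal \<bar>f x\<bar>)" by (intro C) measurable
    also have "\<dots> < \<infinity>" using fin by (simp add: ennreal_mult_less_top)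
    finally show "(\<integral>\<^sup>+x. ennreal (norm (indicat_real K x *\<^sub>R f x)) \<partial>lebesgue) < \<infinity>" .
  qed
  then show ?thesis by (simp add: locally_integrable_def)
qed

lemma sobolev_space_of_pointwise:
  fixes f :: "'a::euclidean_space \<Rightarrow> real"
  assumes \<rho>: "function_norm lebesgue \<rho>" and fX: "f \<in> function_space lebesgue \<rho>"
    and gX: "g \<in> function_space lebesgue \<rho>" "\<And>x. 0 \<le> g x"
    and S: "S \<in> null_sets lebesgue"
    and ineq: "\<And>x y. x \<notin> S \<Longrightarrow> y \<notin> S \<Longrightarrow> \<bar>f x - f y\<bar> \<le> norm (x - y) * (g x + g y)"
  shows "f \<in> sobolev_space \<rho>"
proof -
  interpret function_norm lebesgue \<rho> by fact
  interpret pointwise_gradient f g S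
    by standard (use assms function_space_locally_integrable[OF \<rho>] in auto)
  obtain G where G: "weak_gradient f G" "\<And>x. norm (G x) \<le> real (2 * DIM('a)) * g x"
    using ex_weak_gradient by blast
  have [measurable]: "G \<in> borel_measurable lebesgue" using G(1) by (simp add: weak_gradient_def locally_integrable_def)
  have "\<rho> (\<lambda>x. ennreal \<bar>norm (G x)\<bar>) \<le> \<rho> (\<lambda>x. ennreal (real (2 * DIM('a))) * ennreal \<bar>g x\<bar>)"
  proof (intro mono AE_I2)
    fix x
    have "ennreal \<bar>norm (G x)\<bar> \<le> ennreal (real (2 * DIM('a)) * g x)" using G(2)[of x] by (intro ennreal_leI) simp
    also have "\<dots> = ennreal (real (2 * DIM('a))) * ennreal \<bar>g x\<bar>"
      using gX(2)[of x] by (simp only: ennreal_mult abs_of_nonneg of_nat_0_le_iff)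
    finally show "ennreal \<bar>norm (G x)\<bar> \<le> ennreal (real (2 * DIM('a))) * ennreal \<bar>g x\<bar>" .
  qed measurable
  also have "\<dots> = ennreal (real (2 * DIM('a))) * \<rho> (\<lambda>x. ennreal \<bar>g x\<bar>)"
    by (intro cmult) auto
  also have "\<dots> < \<infinity>" using gX(1) by (simp add: function_space_def ennreal_mult_less_top)
  finally have "(\<lambda>x. norm (G x)) \<in> function_space lebesgue \<rho>" by (simp add: function_space_def)
  with fX G(1) show ?thesis by (auto simp: sobolev_space_def)
qed

lemma pointwise_of_sobolev_space:
  fixes f :: "'a::euclidean_space \<Rightarrow> real"
  assumes \<rho>: "banach_function_norm lebesgue \<rho>" "rearrangement_invariant lebesgue \<rho>"
    and index: "upper_boyd_index lebesgue \<rho> < 1"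
    and f: "f \<in> sobolev_space \<rho>"
  obtains g S where "g \<in> function_space lebesgue \<rho>" "\<And>x. 0 \<le> g x" "S \<in> null_sets lebesgue"
    "\<And>x y. x \<notin> S \<Longrightarrow> y \<notin> S \<Longrightarrow> \<bar>f x - f y\<bar> \<le> norm (x - y) * (g x + g y)"
proof -
  define \<rho>' where "\<rho>' = luxemburg_representation lebesgue \<rho>"
  interpret luxemburg_pair \<rho> \<rho>'
    unfolding \<rho>'_def by (rule luxemburg_pair_luxemburg_representation[OF \<rho>])
  obtain N where N: "1 < N" "dilation_norm \<rho>' N < ennreal N"
    using ex_dilation_norm_less index unfolding upper_boyd_index_def \<rho>'_def by blast
  obtain G where G: "weak_gradient f G" and GX: "(\<lambda>x. norm (G x)) \<in> function_space lebesgue \<rho>"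
    using f by (auto simp: sobolev_space_def)
  let ?u = "\<lambda>z. ennreal (norm (G z))"
  let ?M = "maximal_function ?u"
  have [measurable]: "G \<in> borel_measurable lebesgue" using G by (simp add: weak_gradient_def locally_integrable_def)
  have fin: "\<rho> ?M < \<infinity>"
    using GX by (intro maximal_function_bounded[OF N]) (auto simp: function_space_def)
  define c where "c = 2 ^ DIM('a) / bump_mass TYPE('a)"
  have c: "0 < c" using bump_mass_pos[where 'a='a] by (simp add: c_def)
  \<comment> \<open>Where the maximal function is infinite, enn2real returns the meaningless value 0; these points go into
    the exceptional set S.\<close>
  define g where "g x = c * enn2real (?M x)" for x
  have g0: "0 \<le> g x" for x using c by (simp add: g_def)
  have [measurable]: "g \<in> borel_measurable lebesgue" unfolding g_def[abs_def] by measurable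
  have "\<rho> (\<lambda>x. ennreal \<bar>g x\<bar>) \<le> \<rho> (\<lambda>x. ennreal c * ?M x)"
  proof (intro mono AE_I2)
    fix x
    have "ennreal \<bar>g x\<bar> = ennreal c * ennreal (enn2real (?M x))"
      using c by (simp add: g_def abs_mult ennreal_mult)
    also have "\<dots> \<le> ennreal c * ?M x" by (intro mult_left_mono) (cases "?M x"; simp)+
    finally show "ennreal \<bar>g x\<bar> \<le> ennreal c * ?M x" .
  qed measurable
  also have "\<dots> = ennreal c * \<rho> ?M" using c by (intro cmult) auto
  also have "\<dots> < \<infinity>" using fin by (simp add: ennreal_mult_less_top)
  finally have gX: "g \<in> function_space lebesgue \<rho>" by (simp add: function_space_def)
  have "AE x in lebesgue. ?M x \<noteq> \<infinity>"
    using fin by (intro finite_AE sigma_finite_lebesgue) auto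
  moreover have "AE x in lebesgue. (mean_oscillation f x \<longlongrightarrow> 0) (at_right 0)"
    using G by (intro lebesgue_points) (simp add: weak_gradient_def)
  ultimately have "AE x in lebesgue. ?M x \<noteq> \<infinity> \<and> (mean_oscillation f x \<longlongrightarrow> 0) (at_right 0)"
    by eventually_elim simp
  moreover define S where "S = {x \<in> space lebesgue. \<not> (?M x \<noteq> \<infinity> \<and> (mean_oscillation f x \<longlongrightarrow> 0) (at_right 0))}"
  ultimately have S: "S \<in> null_sets lebesgue"
    by (simp only: completion.AE_iff_null_sets)
  have good: "?M x \<le> ennreal (enn2real (?M x))" "(mean_oscillation f x \<longlongrightarrow> 0) (at_right 0)" if "x \<notin> S" for x
    using that by (auto simp: S_def less_top)
  have "\<bar>f x - f y\<bar> \<le> norm (x - y) * (g x + g y)" if "x \<notin> S" "y \<notin> S" for x y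
    unfolding g_def c_def
    by (rule pointwise_maximal_estimate[OF G good(2)[OF that(1)] good(2)[OF that(2)] good(1)[OF that(1)] good(1)[OF that(2)]]) auto
  with gX g0 S show thesis by (rule that)
qed

theorem corollary3p1:
  fixes \<rho> :: "(real ^ 'n \<Rightarrow> ennreal) \<Rightarrow> ennreal" and f :: "real ^ 'n \<Rightarrow> real"
  assumes "banach_function_norm lebesgue \<rho>"
    and "rearrangement_invariant lebesgue \<rho>"
    and "upper_boyd_index lebesgue \<rho> < 1"
  shows "f \<in> sobolev_space \<rho> \<longleftrightarrow>
    f \<in> function_space lebesgue \<rho> \<and>
    (\<exists>g \<in> function_space lebesgue \<rho>. (\<forall>x. 0 \<le> g x) \<and>
      (\<exists>S \<in> null_sets lebesgue. \<forall>x y. x \<notin> S \<longrightarrow> y \<notin> S \<longrightarrow>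
        \<bar>f x - f y\<bar> \<le> norm (x - y) * (g x + g y)))"
proof
  assume f: "f \<in> sobolev_space \<rho>"
  then have "f \<in> function_space lebesgue \<rho>" by (simp add: sobolev_space_def)
  moreover obtain g S where "g \<in> function_space lebesgue \<rho>" "\<And>x. 0 \<le> g x" "S \<in> null_sets lebesgue"
    "\<And>x y. x \<notin> S \<Longrightarrow> y \<notin> S \<Longrightarrow> \<bar>f x - f y\<bar> \<le> norm (x - y) * (g x + g y)"
    using pointwise_of_sobolev_space[OF assms f] by metis
  ultimately show "f \<in> function_space lebesgue \<rho> \<and>
    (\<exists>g \<in> function_space lebesgue \<rho>. (\<forall>x. 0 \<le> g x) \<and>
      (\<exists>S \<in> null_sets lebesgue. \<forall>x y. x \<notin> S \<longrightarrow> y \<notin> S \<longrightarrow>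
        \<bar>f x - f y\<bar> \<le> norm (x - y) * (g x + g y)))" by blast
next
  have "function_norm lebesgue \<rho>" by standard (rule assms(1))
  then show "f \<in> sobolev_space \<rho>" if "f \<in> function_space lebesgue \<rho> \<and>
    (\<exists>g \<in> function_space lebesgue \<rho>. (\<forall>x. 0 \<le> g x) \<and>
      (\<exists>S \<in> null_sets lebesgue. \<forall>x y. x \<notin> S \<longrightarrow> y \<notin> S \<longrightarrow>
        \<bar>f x - f y\<bar> \<le> norm (x - y) * (g x + g y)))"
    using that sobolev_space_of_pointwise by blast
qed

end
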